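(* Let $1<q<\infty$ and let $\Omega\subset\mathbb{R}^n$ be a bounded domain. A function $f$ belongs to $W^{1,q)}(\Omega)$ if and only if $f\in L^{q)}(\Omega)$ and there exist a non-negative function $g\in L^{q)}(\Omega)$ and a set $S\subset\Omega$ of Lebesgue measure zero such that the inequality $$|f(x)-f(y)|\le|x-y|\,(g(x)+g(y))$$ holds for all points $x,y\in\Omega\setminus S$ with $B(x,3|x-y|)\subset\Omega$.
   Context: A domain is an open connected set; $n\ge2$; $B(x,r)$ is the ball with center $x$ and radius $r$. For a bounded domain $\Omega\subset\mathbb{R}^n$ and $1<q<\infty$, the grand Lebesgue space $L^{q)}(\Omega)$ consists of all measurable $g\in\bigcap_{1<p<q}L^p(\Omega)$ with $$\|g\|_{L^{q)}(\Omega)}=\sup_{0<\varepsilon<q-1}\left(\varepsilon\int_\Omega|g(x)|^{q-\varepsilon}\,dx\right)^{\frac1{q-\varepsilon}}<\infty.$$ The grand Sobolev space $W^{1,q)}(\Omega)$ consists of all $f\in\bigcap_{0<\varepsilon<q-1}W^{1,q-\varepsilon}(\Omega)$ with $$\|f\|_{W^{1,q)}(\Omega)}=\sup_{0<\varepsilon<q-1}\varepsilon^{\frac1{q-\varepsilon}}\|f\|_{W^{1,q-\varepsilon}(\Omega)}<\infty,$$ where $\|f\|_{W^{1,r}(\Omega)}=\|f\|_{L^r(\Omega)}+\|\nabla f\|_{L^r(\Omega)}$. *)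

theory Defs
  imports "HOL-Analysis.Analysis"
begin

definition domain :: "'a::euclidean_space set \<Rightarrow> bool" where
  "domain \<Omega> \<longleftrightarrow> open \<Omega> \<and> connected \<Omega>"

text \<open>Elements of the function spaces below are represented by functions on the whole type, of
  which only the values on \<open>\<Omega>\<close> matter; functions that agree almost everywhere are not identified.
  Measurability is with respect to the Lebesgue (completed) sigma-algebra.\<close>

definition Lp_space :: "'a::euclidean_space set \<Rightarrow> real \<Rightarrow> ('a \<Rightarrow> 'b::real_normed_vector) set" where
  "Lp_space \<Omega> p = {f. f \<in> borel_measurable (lebesgue_on \<Omega>) \<and>
                      integrable (lebesgue_on \<Omega>) (\<lambda>x. norm (f x) powr p)}"

definition Lp_norm :: "'a::euclidean_space set \<Rightarrow> real \<Rightarrow> ('a \<Rightarrow> 'b::real_normed_vector) \<Rightarrow> real" where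
  "Lp_norm \<Omega> p f = (LINT x|lebesgue_on \<Omega>. norm (f x) powr p) powr (1 / p)"

primrec Ck :: "nat \<Rightarrow> ('a::euclidean_space \<Rightarrow> real) \<Rightarrow> bool" where
  "Ck 0 \<phi> \<longleftrightarrow> continuous_on UNIV \<phi>"
| "Ck (Suc k) \<phi> \<longleftrightarrow> (\<forall>x. \<phi> differentiable (at x)) \<and>
                    (\<forall>i\<in>Basis. Ck k (\<lambda>x. frechet_derivative \<phi> (at x) i))"

definition test_function :: "'a::euclidean_space set \<Rightarrow> ('a \<Rightarrow> real) \<Rightarrow> bool" where
  "test_function \<Omega> \<phi> \<longleftrightarrow> (\<forall>k. Ck k \<phi>) \<and>
     compact (closure {x. \<phi> x \<noteq> 0}) \<and> closure {x. \<phi> x \<noteq> 0} \<subseteq> \<Omega>"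

definition locally_integrable_on ::
    "'a::euclidean_space set \<Rightarrow> ('a \<Rightarrow> 'b::euclidean_space) \<Rightarrow> bool" where
  "locally_integrable_on \<Omega> f \<longleftrightarrow> (\<forall>K. compact K \<and> K \<subseteq> \<Omega> \<longrightarrow> integrable (lebesgue_on K) f)"

definition has_weak_gradient ::
    "'a::euclidean_space set \<Rightarrow> ('a \<Rightarrow> real) \<Rightarrow> ('a \<Rightarrow> 'a) \<Rightarrow> bool" where
  "has_weak_gradient \<Omega> f v \<longleftrightarrow>
     locally_integrable_on \<Omega> f \<and> locally_integrable_on \<Omega> v \<and>
     (\<forall>\<phi>. test_function \<Omega> \<phi> \<longrightarrow>
       (\<forall>i\<in>Basis. (LINT x|lebesgue_on \<Omega>. f x * frechet_derivative \<phi> (at x) i)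
                 = - (LINT x|lebesgue_on \<Omega>. (v x \<bullet> i) * \<phi> x)))"

text \<open>The weak gradient is unique up to null sets, so its norms do not depend on the choice.\<close>

definition weak_gradient :: "'a::euclidean_space set \<Rightarrow> ('a \<Rightarrow> real) \<Rightarrow> ('a \<Rightarrow> 'a)" where
  "weak_gradient \<Omega> f = (SOME v. has_weak_gradient \<Omega> f v)"

definition sobolev_space :: "'a::euclidean_space set \<Rightarrow> real \<Rightarrow> ('a \<Rightarrow> real) set" where
  "sobolev_space \<Omega> p = {f. f \<in> Lp_space \<Omega> p \<and> (\<exists>v. has_weak_gradient \<Omega> f v \<and> v \<in> Lp_space \<Omega> p)}"

definition sobolev_norm :: "'a::euclidean_space set \<Rightarrow> real \<Rightarrow> ('a \<Rightarrow> real) \<Rightarrow> real" where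
  "sobolev_norm \<Omega> p f = Lp_norm \<Omega> p f + Lp_norm \<Omega> p (weak_gradient \<Omega> f)"

text \<open>The grand norms may be infinite. They are meaningful only for functions
  lying in all the underlying spaces, because the Bochner integral of a non-integrable function
  is 0; the definitions of the grand spaces include that membership.\<close>

definition grand_Lebesgue_norm :: "'a::euclidean_space set \<Rightarrow> real \<Rightarrow> ('a \<Rightarrow> real) \<Rightarrow> ennreal" where
  "grand_Lebesgue_norm \<Omega> q g =
     (SUP \<epsilon>\<in>{0<..<q - 1}.
        ennreal ((\<epsilon> * (LINT x|lebesgue_on \<Omega>. \<bar>g x\<bar> powr (q - \<epsilon>))) powr (1 / (q - \<epsilon>))))"

definition grand_Lebesgue_space :: "'a::euclidean_space set \<Rightarrow> real \<Rightarrow> ('a \<Rightarrow> real) set" where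
  "grand_Lebesgue_space \<Omega> q =
     {g. g \<in> (\<Inter>p\<in>{1<..<q}. Lp_space \<Omega> p) \<and> grand_Lebesgue_norm \<Omega> q g < \<infinity>}"

definition grand_sobolev_norm :: "'a::euclidean_space set \<Rightarrow> real \<Rightarrow> ('a \<Rightarrow> real) \<Rightarrow> ennreal" where
  "grand_sobolev_norm \<Omega> q f =
     (SUP \<epsilon>\<in>{0<..<q - 1}. ennreal (\<epsilon> powr (1 / (q - \<epsilon>)) * sobolev_norm \<Omega> (q - \<epsilon>) f))"

definition grand_sobolev_space :: "'a::euclidean_space set \<Rightarrow> real \<Rightarrow> ('a \<Rightarrow> real) set" where
  "grand_sobolev_space \<Omega> q =
     {f. f \<in> (\<Inter>\<epsilon>\<in>{0<..<q - 1}. sobolev_space \<Omega> (q - \<epsilon>)) \<and> grand_sobolev_norm \<Omega> q f < \<infinity>}"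

end

theory Submission
  imports Defs
begin

text \<open>
  Suppose first that \<open>f\<close> has a weak gradient \<open>v\<close>. Fix a smooth bump of radius comparable with
  \<open>|x - y|\<close> around the midpoint of \<open>x\<close> and \<open>y\<close>, and contract it towards \<open>x\<close> by a factor \<open>t\<close> that
  decreases from 1 to 0. The derivative in \<open>t\<close> of the contracted, normalised bump is a divergence, so
  the derivative of the average of \<open>f\<close> against it is an integral of \<open>v\<close>
  (\<open>dilated_average_has_field_derivative\<close>); it is bounded by a constant times \<open>|x - y|\<close> times the
  Hardy-Littlewood maximal function of \<open>|v|\<close> at \<open>x\<close>. At a Lebesgue point the averages tend to
  \<open>f x\<close>. As the same bump can be contracted towards \<open>y\<close>, the estimate follows with \<open>g\<close> a multiple of
  the maximal function (\<open>weak_gradient_pointwise_estimate\<close>); the condition on the ball of radius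
  \<open>3 |x - y|\<close> keeps all the contracted bumps inside \<open>\<Omega>\<close>.

  Conversely, let the pointwise estimate hold. Moving difference quotients from a test function
  \<open>\<phi>\<close> to \<open>f\<close> bounds the integral of \<open>f\<close> times a partial derivative of \<open>\<phi>\<close> by twice the integral of
  \<open>g |\<phi>|\<close> (\<open>pointwise_estimate_imp_test_bound\<close>). A linear functional on test functions with such a
  bound is integration against a function \<open>u\<close> with \<open>|u| \<le> 2 g\<close> (\<open>test_functional_density\<close>): \<open>u\<close> comes
  from minimising a quadratic functional, and the bound is read off by concentrating the test functions
  at Lebesgue points. Hence a weak gradient exists and is dominated pointwise by a multiple of \<open>g\<close>.

  These two constructions are independent of the exponent, so the grand norms only require constants
  that stay bounded as the exponent \<open>q - \<epsilon>\<close> varies. The norm of the maximal operator on \<open>L\<^sup>p\<close> is bounded for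
  \<open>p\<close> between \<open>(1 + q) / 2\<close> and \<open>q\<close> (\<open>hl_max_strong_type\<close>) but blows up as \<open>p\<close> decreases to 1. On a
  bounded domain the exponents away from \<open>q\<close> are controlled by those near \<open>q\<close>
  (\<open>grand_bounded_of_near\<close>), and this rescues the small exponents.
\<close>

section \<open>The Hardy-Littlewood maximal function\<close>

text \<open>The averages are divided by \<open>r ^ n\<close> instead of by the volume of the ball. This changes the maximal
  function by a constant factor and keeps the volume of the unit ball out of the pointwise estimates.\<close>

definition hl_max :: "('a::euclidean_space \<Rightarrow> ennreal) \<Rightarrow> 'a \<Rightarrow> ennreal" where
  "hl_max h x = (SUP r\<in>{0<..}. (\<integral>\<^sup>+y\<in>ball x r. h y \<partial>lebesgue) / ennreal (r ^ DIM('a)))"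

lemma emeasure_lebesgue_ball:
  fixes x :: "'a::euclidean_space"
  assumes "0 \<le> r"
  shows "emeasure lebesgue (ball x r) = ennreal (unit_ball_vol (DIM('a)) * r ^ DIM('a))"
  using emeasure_ball[OF assms, of x] by simp

lemma ennreal_le_mult_of_divide_le:
  fixes a b :: ennreal
  assumes "0 < c" "a / ennreal c \<le> b"
  shows "a \<le> ennreal c * b"
proof -
  have "a = ennreal c * (a / ennreal c)"
    using assms(1) by (simp add: ennreal_times_divide mult.commute ennreal_mult_divide_eq)
  also have "\<dots> \<le> ennreal c * b"
    by (rule mult_left_mono[OF assms(2)]) simp
  finally show ?thesis .
qed

lemma nn_integral_ball_le_hl_max:
  fixes h :: "'a::euclidean_space \<Rightarrow> ennreal"
  assumes "0 < r"
  shows "(\<integral>\<^sup>+y\<in>ball x r. h y \<partial>lebesgue) \<le> ennreal (r ^ DIM('a)) * hl_max h x"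
proof (rule ennreal_le_mult_of_divide_le)
  show "(\<integral>\<^sup>+y\<in>ball x r. h y \<partial>lebesgue) / ennreal (r ^ DIM('a)) \<le> hl_max h x"
    unfolding hl_max_def by (rule SUP_upper) (use assms in auto)
qed (use assms in auto)

lemma hl_max_gtE:
  fixes h :: "'a::euclidean_space \<Rightarrow> ennreal"
  assumes "ennreal t < hl_max h x" "0 \<le> t"
  obtains r where "0 < r" "ennreal (t * r ^ DIM('a)) < (\<integral>\<^sup>+y\<in>ball x r. h y \<partial>lebesgue)"
proof -
  obtain r where r: "0 < r"
    and lt: "ennreal t < (\<integral>\<^sup>+y\<in>ball x r. h y \<partial>lebesgue) / ennreal (r ^ DIM('a))"
    using assms unfolding hl_max_def less_SUP_iff by auto
  have "\<not> (\<integral>\<^sup>+y\<in>ball x r. h y \<partial>lebesgue) \<le> ennreal (t * r ^ DIM('a))"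
  proof
    assume "(\<integral>\<^sup>+y\<in>ball x r. h y \<partial>lebesgue) \<le> ennreal (t * r ^ DIM('a))"
    then have "(\<integral>\<^sup>+y\<in>ball x r. h y \<partial>lebesgue) / ennreal (r ^ DIM('a))
        \<le> ennreal (t * r ^ DIM('a)) / ennreal (r ^ DIM('a))"
      by (rule divide_right_mono_ennreal)
    also have "\<dots> = ennreal t"
      using r assms(2) by (simp add: divide_ennreal)
    finally show False using lt by simp
  qed
  then show thesis using that r by auto
qed

lemma hl_max_mono:
  assumes "\<And>y. h y \<le> k y"
  shows "hl_max h x \<le> hl_max k x"
  unfolding hl_max_def
  by (intro SUP_mono' divide_right_mono_ennreal nn_integral_mono mult_right_mono assms) auto

text \<open>Every average of a constant is that constant times the volume of the unit ball.\<close>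

lemma hl_max_add_const:
  fixes h :: "'a::euclidean_space \<Rightarrow> ennreal"
  assumes [measurable]: "h \<in> borel_measurable lebesgue" and "0 \<le> c"
  shows "hl_max (\<lambda>y. h y + ennreal c) x \<le> hl_max h x + ennreal (c * unit_ball_vol (DIM('a)))"
  unfolding hl_max_def
proof (rule SUP_least)
  fix r :: real assume "r \<in> {0<..}"
  then have r: "0 < r" by simp
  have [measurable]: "ball x r \<in> sets lebesgue" by simp
  have "(\<integral>\<^sup>+y\<in>ball x r. (h y + ennreal c) \<partial>lebesgue) / ennreal (r ^ DIM('a)) =
      (\<integral>\<^sup>+y\<in>ball x r. h y \<partial>lebesgue) / ennreal (r ^ DIM('a)) +
      ennreal c * emeasure lebesgue (ball x r) / ennreal (r ^ DIM('a))"
    by (simp add: distrib_right nn_integral_add nn_integral_cmult_indicator add_divide_distrib_ennreal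
          del: emeasure_completion)
  also have "ennreal c * emeasure lebesgue (ball x r) / ennreal (r ^ DIM('a))
      = ennreal (c * unit_ball_vol (DIM('a)))"
    using r assms(2) by (subst emeasure_lebesgue_ball) 
      (auto simp: ennreal_mult'[symmetric] divide_ennreal)
  also have "(\<integral>\<^sup>+y\<in>ball x r. h y \<partial>lebesgue) / ennreal (r ^ DIM('a)) \<le>
     (SUP r\<in>{0<..}. (\<integral>\<^sup>+y\<in>ball x r. h y \<partial>lebesgue) / ennreal (r ^ DIM('a)))"
    using r by (intro SUP_upper) auto
  finally show "(\<integral>\<^sup>+y\<in>ball x r. (h y + ennreal c) \<partial>lebesgue) / ennreal (r ^ DIM('a)) \<le>
     (SUP r\<in>{0<..}. (\<integral>\<^sup>+y\<in>ball x r. h y \<partial>lebesgue) / ennreal (r ^ DIM('a))) +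
        ennreal (c * unit_ball_vol (DIM('a)))"
    by (simp add: add_right_mono)
qed

text \<open>If the average over a ball around \<open>x\<close> exceeds \<open>c\<close>, then so does the integral over a slightly smaller
  ball, divided by the same power of the larger radius; the smaller ball is contained in the balls of the
  larger radius around all points near \<open>x\<close>. Openness yields the measurability of the maximal function,
  which a supremum over uncountably many radii does not give directly.\<close>

lemma open_hl_max_gt:
  fixes h :: "'a::euclidean_space \<Rightarrow> ennreal"
  assumes [measurable]: "h \<in> borel_measurable lebesgue"
  shows "open {x. c < hl_max h x}"
  unfolding open_contains_ball
proof safe
  fix x assume "c < hl_max h x"
  then obtain r where r: "0 < r"
    and lt: "c < (\<integral>\<^sup>+y\<in>ball x r. h y \<partial>lebesgue) / ennreal (r ^ DIM('a))"
    unfolding hl_max_def less_SUP_iff by auto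
  define A where "A k = ball x (r - 1 / Suc k)" for k
  have [measurable]: "A k \<in> sets lebesgue" for k by (simp add: A_def)
  have incA: "incseq A"
    unfolding A_def incseq_def
    by (auto intro!: subset_ball simp: frac_le)
  have UA: "(\<Union>k. A k) = ball x r"
  proof safe
    fix y assume "y \<in> ball x r"
    then have "0 < r - dist x y" by simp
    then obtain k where "1 / Suc k < r - dist x y"
      using nat_approx_posE by blast
    then show "y \<in> (\<Union>k. A k)"
      unfolding A_def by (auto intro!: exI[of _ k])
  next
    fix y k assume "y \<in> A k"
    then have "dist x y < r - 1 / Suc k" unfolding A_def by simp
    also have "\<dots> \<le> r" by simp
    finally show "y \<in> ball x r" by simp
  qed
  have "(SUP k. emeasure (density lebesgue h) (A k)) = emeasure (density lebesgue h) (ball x r)"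
    unfolding UA[symmetric] by (rule SUP_emeasure_incseq) (auto simp: incA)
  then have "(\<integral>\<^sup>+y\<in>ball x r. h y \<partial>lebesgue) = (SUP k. (\<integral>\<^sup>+y\<in>A k. h y \<partial>lebesgue))"
    by (simp add: emeasure_density)
  then have "(\<integral>\<^sup>+y\<in>ball x r. h y \<partial>lebesgue) / ennreal (r ^ DIM('a))
      = (SUP k. (\<integral>\<^sup>+y\<in>A k. h y \<partial>lebesgue) / ennreal (r ^ DIM('a)))"
    by (simp add: SUP_divide_ennreal)
  with lt obtain k where k: "c < (\<integral>\<^sup>+y\<in>A k. h y \<partial>lebesgue) / ennreal (r ^ DIM('a))"
    by (auto simp: less_SUP_iff)
  have "c < hl_max h z" if "z \<in> ball x (1 / Suc k)" for z
  proof -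
    have "A k \<subseteq> ball z r"
      unfolding A_def using that by (auto simp: dist_commute) (smt (verit) dist_commute dist_triangle)
    then have "(\<integral>\<^sup>+y\<in>A k. h y \<partial>lebesgue) \<le> (\<integral>\<^sup>+y\<in>ball z r. h y \<partial>lebesgue)"
      by (intro nn_integral_mono mult_left_mono) (auto simp: indicator_def)
    then have "(\<integral>\<^sup>+y\<in>A k. h y \<partial>lebesgue) / ennreal (r ^ DIM('a))
        \<le> (\<integral>\<^sup>+y\<in>ball z r. h y \<partial>lebesgue) / ennreal (r ^ DIM('a))"
      by (rule divide_right_mono_ennreal)
    also have "\<dots> \<le> hl_max h z"
      unfolding hl_max_def using r by (intro SUP_upper) auto
    finally show ?thesis using k by simp
  qed
  then show "\<exists>e>0. ball x e \<subseteq> {x. c < hl_max h x}"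
    by (intro exI[of _ "1 / Suc k"]) auto
qed

lemma borel_measurable_hl_max:
  fixes h :: "'a::euclidean_space \<Rightarrow> ennreal"
  assumes "h \<in> borel_measurable lebesgue"
  shows "hl_max h \<in> borel_measurable lebesgue"
proof (rule borel_measurableI_greater)
  fix c
  show "{x \<in> space lebesgue. c < hl_max h x} \<in> sets lebesgue"
    using open_hl_max_gt[OF assms, of c] by simp
qed

text \<open>Countable subadditivity with the sum written as an integral over the counting measure, because the
  countable index set will be a subfamily chosen by a covering lemma.\<close>

lemma emeasure_UN_countable_le:
  assumes sets[measurable]: "\<And>i. i \<in> I \<Longrightarrow> X i \<in> sets M" and I[simp]: "countable I"
  shows "emeasure M (\<Union>(X ` I)) \<le> (\<integral>\<^sup>+i. emeasure M (X i) \<partial>count_space I)"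
proof -
  have le: "indicator (\<Union>(X ` I)) x \<le> (\<integral>\<^sup>+ i. indicator (X i) x \<partial>count_space I :: ennreal)" for x
  proof (cases "x \<in> \<Union>(X ` I)")
    case True
    then obtain j where j: "x \<in> X j" "j \<in> I" by auto
    have "(1::ennreal) = (\<integral>\<^sup>+ i. indicator {j} i \<partial>count_space I)"
      using j by simp
    also have "\<dots> \<le> (\<integral>\<^sup>+ i. indicator (X i) x \<partial>count_space I)"
      using j by (intro nn_integral_mono) (auto simp: indicator_def)
    finally show ?thesis using True by simp
  qed auto
  note sets.countable_UN'[unfolded subset_eq, measurable]
  have "emeasure M (\<Union>(X ` I)) = (\<integral>\<^sup>+x. indicator (\<Union>(X ` I)) x \<partial>M)"
    by simp
  also have "\<dots> \<le> (\<integral>\<^sup>+x. \<integral>\<^sup>+i. indicator (X i) x \<partial>count_space I \<partial>M)"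
    by (intro nn_integral_mono le)
  also have "\<dots> = (\<integral>\<^sup>+i. \<integral>\<^sup>+x. indicator (X i) x \<partial>M \<partial>count_space I)"
    by (simp add: nn_integral_count_space_nn_integral)
  finally show ?thesis
    by (simp cong: nn_integral_cong_simp)
qed

text \<open>Each point of the level set is the centre of a ball on which the integral of \<open>h\<close> is large compared
  with the volume. Unless the bound is infinite, \<open>h\<close> is integrable and the radii of these balls are bounded,
  so Vitali's lemma selects disjoint ones whose fivefold enlargements cover the level set.\<close>

lemma hl_max_weak_type:
  fixes h :: "'a::euclidean_space \<Rightarrow> ennreal"
  assumes [measurable]: "h \<in> borel_measurable lebesgue" and t: "0 < t"
  shows "emeasure lebesgue {x. ennreal t < hl_max h x}
     \<le> ennreal (unit_ball_vol (DIM('a)) * 5 ^ DIM('a) / t) * (\<integral>\<^sup>+y. h y \<partial>lebesgue)"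
proof (cases "(\<integral>\<^sup>+y. h y \<partial>lebesgue) = \<infinity>")
  case True
  have "unit_ball_vol (DIM('a)) \<noteq> 0" using unit_ball_vol_pos[of "DIM('a)"] by linarith
  then show ?thesis using True t by (simp add: ennreal_mult_top)
next
  case False
  define n where "n = DIM('a)"
  define \<omega> where "\<omega> = unit_ball_vol (real n)"
  have \<omega>: "0 < \<omega>" by (simp add: \<omega>_def)
  obtain I where I: "(\<integral>\<^sup>+y. h y \<partial>lebesgue) = ennreal I" "0 \<le> I"
    using False by (cases "(\<integral>\<^sup>+y. h y \<partial>lebesgue)") auto
  define K where "K = {(x::'a, r). 0 < r \<and> ennreal (t * r ^ n) < (\<integral>\<^sup>+y\<in>ball x r. h y \<partial>lebesgue)}"
  have bound: "0 < snd i \<and> snd i \<le> max 1 (I / t)" if "i \<in> K" for i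
  proof -
    obtain x r where i: "i = (x, r)" by force
    have r: "0 < r" "ennreal (t * r ^ n) < (\<integral>\<^sup>+y\<in>ball x r. h y \<partial>lebesgue)"
      using that by (auto simp: K_def i)
    have "(\<integral>\<^sup>+y\<in>ball x r. h y \<partial>lebesgue) \<le> ennreal I"
      unfolding I(1)[symmetric] by (intro nn_integral_mono) (auto simp: indicator_def)
    then have "ennreal (t * r ^ n) < ennreal I" using r(2) by (rule less_le_trans[rotated])
    then have "t * r ^ n < I"
      by (metis I(2) ennreal_less_iff ennreal_neg not_le order.strict_implies_order ennreal_leI)
    then have rn: "r ^ n \<le> I / t" using t by (simp add: field_simps)
    have "r \<le> max 1 (I / t)"
    proof (cases "r \<le> 1")
      case False
      then have "r ^ 1 \<le> r ^ n" by (intro power_increasing) (auto simp: n_def Suc_le_eq)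
      then show ?thesis using rn by simp
    qed simp
    then show ?thesis using r(1) by (simp add: i)
  qed
  have cover: "{x. ennreal t < hl_max h x} \<subseteq> (\<Union>i\<in>K. ball (fst i) (snd i))"
  proof safe
    fix x assume "ennreal t < hl_max h x"
    then obtain r where "0 < r" "ennreal (t * r ^ n) < (\<integral>\<^sup>+y\<in>ball x r. h y \<partial>lebesgue)"
      using hl_max_gtE t unfolding n_def by (metis less_le)
    then show "x \<in> (\<Union>i\<in>K. ball (fst i) (snd i))"
      by (intro UN_I[of "(x, r)"]) (auto simp: K_def)
  qed
  obtain C where C: "countable C" "C \<subseteq> K"
    and disj: "pairwise (\<lambda>i j. disjnt (ball (fst i) (snd i)) (ball (fst j) (snd j))) C"
    and CS: "{x. ennreal t < hl_max h x} \<subseteq> (\<Union>i\<in>C. ball (fst i) (5 * snd i))"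
    using Vitali_covering_lemma_balls[OF cover bound] by blast
  have "emeasure lebesgue {x. ennreal t < hl_max h x}
     \<le> emeasure lebesgue (\<Union>i\<in>C. ball (fst i) (5 * snd i))"
  proof (rule emeasure_mono[OF CS])
    have "open (\<Union>i\<in>C. ball (fst i) (5 * snd i))" by blast
    then show "(\<Union>i\<in>C. ball (fst i) (5 * snd i)) \<in> sets lebesgue" by simp
  qed
  also have "\<dots> \<le> (\<integral>\<^sup>+i. emeasure lebesgue (ball (fst i) (5 * snd i)) \<partial>count_space C)"
    by (rule emeasure_UN_countable_le) (use C(1) in auto)
  also have "\<dots> \<le> (\<integral>\<^sup>+i. ennreal (\<omega> * 5 ^ n / t) * emeasure (density lebesgue h) (ball (fst i) (snd i)) \<partial>count_space C)"
  proof (rule nn_integral_mono)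
    fix i assume "i \<in> space (count_space C)"
    then have "i \<in> K" using C(2) by auto
    then have r: "0 < snd i" and lt: "ennreal (t * snd i ^ n) < emeasure (density lebesgue h) (ball (fst i) (snd i))"
      by (auto simp: K_def emeasure_density)
    have "emeasure lebesgue (ball (fst i) (5 * snd i)) = ennreal (\<omega> * 5 ^ n / t) * ennreal (t * snd i ^ n)"
      using r t \<omega> unfolding n_def \<omega>_def
      by (subst emeasure_lebesgue_ball) (auto simp: ennreal_mult'[symmetric] power_mult_distrib)
    also have "\<dots> \<le> ennreal (\<omega> * 5 ^ n / t) * emeasure (density lebesgue h) (ball (fst i) (snd i))"
      using lt by (intro mult_left_mono) auto
    finally show "emeasure lebesgue (ball (fst i) (5 * snd i)) \<le> \<dots>" .
  qed
  also have "\<dots> = ennreal (\<omega> * 5 ^ n / t) * emeasure (density lebesgue h) (\<Union>i\<in>C. ball (fst i) (snd i))"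
    using C(1) disj
    by (subst emeasure_UN_countable) (auto simp: nn_integral_cmult disjoint_family_on_def pairwise_def disjnt_def)
  also have "\<dots> \<le> ennreal (\<omega> * 5 ^ n / t) * emeasure (density lebesgue h) UNIV"
    by (intro mult_left_mono emeasure_mono) auto
  also have "emeasure (density lebesgue h) UNIV = (\<integral>\<^sup>+y. h y \<partial>lebesgue)"
    by (simp add: emeasure_density)
  finally show ?thesis by (simp add: n_def \<omega>_def)
qed


text \<open>The measure of the set where the maximal function is infinite is at most a constant over \<open>t\<close> for all
  \<open>t > 0\<close>.\<close>

lemma AE_hl_max_finite:
  fixes h :: "'a::euclidean_space \<Rightarrow> ennreal"
  assumes h[measurable]: "h \<in> borel_measurable lebesgue" and fin: "(\<integral>\<^sup>+x. h x \<partial>lebesgue) < \<infinity>"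
  shows "AE x in lebesgue. hl_max h x < \<infinity>"
proof -
  obtain I where I: "(\<integral>\<^sup>+x. h x \<partial>lebesgue) = ennreal I" "0 \<le> I"
    using fin by (cases "(\<integral>\<^sup>+x. h x \<partial>lebesgue)") auto
  define C where "C = unit_ball_vol (DIM('a)) * 5 ^ DIM('a) * I"
  have C: "0 \<le> C" using I by (simp add: C_def)
  define N where "N = {x. hl_max h x = \<infinity>}"
  have Ns: "N \<in> sets lebesgue"
  proof -
    note [measurable] = borel_measurable_hl_max[OF h]
    have "{x \<in> space lebesgue. hl_max h x = \<infinity>} \<in> sets lebesgue" by measurable
    then show ?thesis by (simp add: N_def)
  qed
  have le: "emeasure lebesgue N \<le> ennreal (C / t)" if t: "0 < t" for t
  proof -
    have "emeasure lebesgue N \<le> emeasure lebesgue {x. ennreal t < hl_max h x}"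
      using open_hl_max_gt[OF h] by (intro emeasure_mono) (auto simp: N_def)
    also have "\<dots> \<le> ennreal (unit_ball_vol (DIM('a)) * 5 ^ DIM('a) / t) * (\<integral>\<^sup>+x. h x \<partial>lebesgue)"
      by (rule hl_max_weak_type[OF h t])
    also have "\<dots> = ennreal (C / t)" using I t by (simp add: C_def ennreal_mult'[symmetric])
    finally show ?thesis .
  qed
  have "emeasure lebesgue N = 0"
  proof (rule ccontr)
    assume "emeasure lebesgue N \<noteq> 0"
    moreover have "emeasure lebesgue N \<noteq> \<infinity>" using le[of 1] by (auto simp: top_unique)
    ultimately obtain e where e: "emeasure lebesgue N = ennreal e" "0 < e"
      by (cases "emeasure lebesgue N") (auto simp: less_le)
    define t where "t = (C + 1) / e"
    have t: "0 < t" using e C by (simp add: t_def)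
    have "e \<le> C / t" using le[OF t] e C t by (simp add: e(1))
    then have "(C + 1) \<le> C" using t e by (simp add: t_def field_simps)
    then show False by simp
  qed
  then have "N \<in> null_sets lebesgue" using Ns by auto
  from AE_not_in[OF this] show ?thesis by (simp add: N_def less_top)
qed

text \<open>Where \<open>w\<close> is at most \<open>t / (2 \<omega>)\<close> it contributes at most \<open>t / 2\<close> to the maximal function, so the weak
  type estimate at level \<open>t / 2\<close> may be applied to the rest of \<open>w\<close>. Removing the small values is what makes
  the estimates at all levels summable.\<close>

lemma hl_max_weak_type_truncated:
  fixes w :: "'a::euclidean_space \<Rightarrow> real"
  assumes [measurable]: "w \<in> borel_measurable lebesgue" and w0: "\<And>x. 0 \<le> w x" and t: "0 < t"
  defines "\<omega> \<equiv> unit_ball_vol (DIM('a))"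
  shows "emeasure lebesgue {x. ennreal t < hl_max (\<lambda>y. ennreal (w y)) x}
     \<le> (\<integral>\<^sup>+y. ennreal (2 * \<omega> * 5 ^ DIM('a) / t * w y) * indicator {y. t < 2 * \<omega> * w y} y \<partial>lebesgue)"
proof -
  have \<omega>: "0 < \<omega>" by (simp add: \<omega>_def)
  define v where "v y = ennreal (w y) * indicator {y. t < 2 * \<omega> * w y} y" for y
  have v_meas[measurable]: "v \<in> borel_measurable lebesgue" unfolding v_def by measurable
  have le: "ennreal (w y) \<le> v y + ennreal (t / (2 * \<omega>))" for y
    using \<omega> by (auto simp: v_def indicator_def field_simps not_less intro!: ennreal_leI)
  have "{x. ennreal t < hl_max (\<lambda>y. ennreal (w y)) x} \<subseteq> {x. ennreal (t / 2) < hl_max v x}"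
  proof safe
    fix x assume lt: "ennreal t < hl_max (\<lambda>y. ennreal (w y)) x"
    have "hl_max (\<lambda>y. ennreal (w y)) x \<le> hl_max (\<lambda>y. v y + ennreal (t / (2 * \<omega>))) x"
      by (rule hl_max_mono) (rule le)
    also have "\<dots> \<le> hl_max v x + ennreal (t / (2 * \<omega>) * \<omega>)"
      unfolding \<omega>_def by (rule hl_max_add_const) (use t in auto)
    also have "t / (2 * \<omega>) * \<omega> = t / 2" using \<omega> by simp
    finally have le': "hl_max (\<lambda>y. ennreal (w y)) x \<le> hl_max v x + ennreal (t / 2)" .
    show "ennreal (t / 2) < hl_max v x"
    proof (rule ccontr)
      assume "\<not> ennreal (t / 2) < hl_max v x"
      then have "hl_max v x + ennreal (t / 2) \<le> ennreal (t / 2) + ennreal (t / 2)"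
        by (intro add_right_mono) auto
      also have "\<dots> = ennreal t" using t by (subst ennreal_plus[symmetric]) auto
      finally show False using le' lt by simp
    qed
  qed
  moreover have "{x. ennreal (t / 2) < hl_max v x} \<in> sets lebesgue"
    using open_hl_max_gt[OF v_meas] by simp
  ultimately have "emeasure lebesgue {x. ennreal t < hl_max (\<lambda>y. ennreal (w y)) x}
      \<le> emeasure lebesgue {x. ennreal (t / 2) < hl_max v x}"
    by (rule emeasure_mono)
  also have "\<dots> \<le> ennreal (\<omega> * 5 ^ DIM('a) / (t / 2)) * (\<integral>\<^sup>+y. v y \<partial>lebesgue)"
    unfolding \<omega>_def by (rule hl_max_weak_type) (use t in auto)
  also have "\<dots> = (\<integral>\<^sup>+y. ennreal (\<omega> * 5 ^ DIM('a) / (t / 2)) * v y \<partial>lebesgue)"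
    by (rule nn_integral_cmult[symmetric]) measurable
  also have "\<dots> = (\<integral>\<^sup>+y. ennreal (2 * \<omega> * 5 ^ DIM('a) / t * w y) * indicator {y. t < 2 * \<omega> * w y} y \<partial>lebesgue)"
    using \<omega> t w0
    by (intro nn_integral_cong) (auto simp: v_def indicator_def ennreal_mult'[symmetric] mult_ac)
  finally show ?thesis .
qed

text \<open>A geometric sum is comparable with its largest term, here the one with \<open>2 ^ k\<close> just below \<open>u\<close>.\<close>

lemma dyadic_geometric_sum_le:
  fixes u p :: real
  assumes p: "1 < p" and u: "0 < u"
  defines "a \<equiv> 2 powr (p - 1)"
  shows "(\<Sum>k. ennreal (a ^ k * indicator {k. 2 ^ k < u} k)) \<le> ennreal (a / (a - 1) * u powr (p - 1))"
proof -
  have a: "1 < a" using p by (simp add: a_def)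
  have fin: "(\<Sum>k<N. a ^ k * indicator {k. 2 ^ k < u} k) \<le> a / (a - 1) * u powr (p - 1)" for N
  proof (induction N)
    case 0
    then show ?case using a by simp
  next
    case (Suc N)
    show ?case
    proof (cases "2 ^ N < u")
      case True
      have "(\<Sum>k<Suc N. a ^ k * indicator {k. 2 ^ k < u} k) \<le> (\<Sum>k<Suc N. a ^ k)"
        using a by (intro sum_mono) (auto simp: indicator_def)
      also have "\<dots> = (a ^ Suc N - 1) / (a - 1)"
        using a by (subst geometric_sum) auto
      also have "\<dots> \<le> a / (a - 1) * a ^ N"
        using a by (simp add: divide_simps)
      also have "a ^ N = (2 ^ N) powr (p - 1)"
        by (simp add: a_def powr_realpow[symmetric] powr_powr mult.commute)
      also have "a / (a - 1) * (2 ^ N) powr (p - 1) \<le> a / (a - 1) * u powr (p - 1)"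
        using True p a by (intro mult_left_mono powr_mono2) auto
      finally show ?thesis .
    qed (use Suc in simp)
  qed
  show ?thesis
    unfolding suminf_eq_SUP
  proof (rule SUP_least)
    fix N
    have "(\<Sum>k<N. ennreal (a ^ k * indicator {k. 2 ^ k < u} k))
       = ennreal (\<Sum>k<N. a ^ k * indicator {k. 2 ^ k < u} k)"
      using a by (subst sum_ennreal) auto
    also have "\<dots> \<le> ennreal (a / (a - 1) * u powr (p - 1))"
      by (intro ennreal_leI fin)
    finally show "(\<Sum>k<N. ennreal (a ^ k * indicator {k. 2 ^ k < u} k))
       \<le> ennreal (a / (a - 1) * u powr (p - 1))" .
  qed
qed

text \<open>For \<open>m > 1\<close> the single term with \<open>2 ^ k < m \<le> 2 ^ Suc k\<close> already suffices.\<close>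

lemma dyadic_levels_ge:
  fixes m p :: real
  assumes "0 \<le> p" "0 \<le> m"
  shows "ennreal (m powr p) \<le> 1 + (\<Sum>k. ennreal (2 powr (p * (real k + 1))) * indicator {k. 2 ^ k < m} k)"
proof (cases "m \<le> 1")
  case True
  then have "m powr p \<le> 1" using assms by (metis powr_mono2 powr_one_eq_one)
  then have "ennreal (m powr p) \<le> 1" by simp
  then show ?thesis by (rule order_trans) simp
next
  case False
  define k where "k = (LEAST k. m \<le> 2 ^ Suc k)"
  have ex: "\<exists>k. m \<le> 2 ^ Suc k"
  proof -
    obtain n where "m < 2 ^ n" using real_arch_pow[of 2 m] by auto
    then have "m \<le> 2 ^ Suc n" using power_increasing[of n "Suc n" "2::real"] by linarith
    then show ?thesis by blast
  qed
  have up: "m \<le> 2 ^ Suc k" unfolding k_def using ex by (rule LeastI_ex)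
  have lo: "2 ^ k < m"
  proof (cases k)
    case 0
    then show ?thesis using False by simp
  next
    case (Suc j)
    then have "\<not> m \<le> 2 ^ Suc j" using not_less_Least[of j "\<lambda>k. m \<le> 2 ^ Suc k"] by (simp add: k_def)
    then show ?thesis using Suc by simp
  qed
  have "m powr p \<le> (2 ^ Suc k) powr p" using up assms by (intro powr_mono2) auto
  also have "\<dots> = (2 powr real (Suc k)) powr p" by (subst powr_realpow) auto
  also have "\<dots> = 2 powr (p * (real k + 1))" unfolding powr_powr by (simp add: algebra_simps)
  finally have le: "m powr p \<le> 2 powr (p * (real k + 1))" .
  define f :: "nat \<Rightarrow> ennreal" where "f = (\<lambda>k. ennreal (2 powr (p * (real k + 1))) * indicator {k. 2 ^ k < m} k)"
  have "ennreal (m powr p) \<le> f k" using le lo by (simp add: ennreal_leI f_def)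
  also have "f k = sum f {k}" by simp
  also have "\<dots> \<le> suminf f" by (rule sum_le_suminf) auto
  also have "\<dots> \<le> 1 + suminf f" by simp
  finally show ?thesis unfolding f_def .
qed

text \<open>Marcinkiewicz interpolation: the \<open>p\<close>-th power of the maximal function is decomposed over the dyadic
  levels \<open>1, 2, 4, \<dots>\<close>, and the truncated weak type estimate is summed. The values below 1 are absorbed by the
  measure of \<open>\<Omega>\<close>, which is harmless on a domain of finite measure. The constant is explicit because it must
  be bounded uniformly in \<open>p\<close> later.\<close>

lemma hl_max_strong_type:
  fixes w :: "'a::euclidean_space \<Rightarrow> real" and p :: real
  assumes [measurable]: "w \<in> borel_measurable lebesgue" and w0: "\<And>x. 0 \<le> w x"
    and p: "1 < p" and [measurable]: "\<Omega> \<in> sets lebesgue"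
  defines "\<omega> \<equiv> unit_ball_vol (DIM('a))" and "a \<equiv> 2 powr (p - 1)"
  shows "(\<integral>\<^sup>+x\<in>\<Omega>. ennreal (enn2real (hl_max (\<lambda>y. ennreal (w y)) x) powr p) \<partial>lebesgue)
    \<le> emeasure lebesgue \<Omega> +
      ennreal (2 powr p * 5 ^ DIM('a) * (2 * \<omega>) powr p * (a / (a - 1))) * (\<integral>\<^sup>+x. ennreal (w x powr p) \<partial>lebesgue)"
proof -
  define Mw where "Mw = hl_max (\<lambda>y. ennreal (w y))"
  have [measurable]: "Mw \<in> borel_measurable lebesgue"
    unfolding Mw_def by (rule borel_measurable_hl_max) measurable
  have \<omega>: "0 < \<omega>" by (simp add: \<omega>_def)
  have a: "1 < a" using p by (simp add: a_def)
  define E where "E k = {x. ennreal (2 ^ k) < Mw x}" for k :: nat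
  have [measurable]: "E k \<in> sets lebesgue" for k
  proof -
    have "{x \<in> space lebesgue. ennreal (2 ^ k) < Mw x} \<in> sets lebesgue" by measurable
    then show ?thesis by (simp add: E_def)
  qed
  define c where "c k = 2 powr (p * (real k + 1))" for k :: nat
  have step: "ennreal (enn2real (Mw x) powr p) * indicator \<Omega> x
       \<le> indicator \<Omega> x + (\<Sum>k. ennreal (c k) * indicator (E k) x)" for x
  proof -
    have "ennreal (enn2real (Mw x) powr p) \<le> 1 + (\<Sum>k. ennreal (c k) * indicator {k. 2 ^ k < enn2real (Mw x)} k)"
      unfolding c_def by (rule dyadic_levels_ge) (use p in auto)
    also have "\<dots> \<le> 1 + (\<Sum>k. ennreal (c k) * indicator (E k) x)"
    proof (intro add_left_mono suminf_le mult_left_mono)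
      fix k :: nat
      show "(indicator {k. 2 ^ k < enn2real (Mw x)} k::ennreal) \<le> indicator (E k) x"
        by (cases "Mw x") (auto simp: E_def indicator_def ennreal_less_iff)
    qed auto
    finally show ?thesis by (auto simp: indicator_def)
  qed
  have geom: "(\<Sum>k. ennreal (c k) * (ennreal (2 * \<omega> * 5 ^ DIM('a) / 2 ^ k * w y) * indicator {y. 2 ^ k < 2 * \<omega> * w y} y))
     \<le> ennreal (2 powr p * 5 ^ DIM('a) * (2 * \<omega>) powr p * (a / (a - 1))) * ennreal (w y powr p)" for y
  proof (cases "w y = 0")
    case True
    then show ?thesis by simp
  next
    case False
    then have wy: "0 < w y" using w0[of y] by simp
    define u where "u = 2 * \<omega> * w y"
    have u: "0 < u" using wy \<omega> by (simp add: u_def)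
    have ck: "c k / 2 ^ k = 2 powr p * a ^ k" for k
    proof -
      have "c k = 2 powr p * (2 powr p) ^ k"
        by (simp add: c_def powr_add algebra_simps powr_realpow[symmetric] powr_powr)
      moreover have "2 powr p = 2 * a" by (simp add: a_def powr_diff)
      ultimately show ?thesis by (simp add: power_mult_distrib)
    qed
    have "ennreal (c k) * (ennreal (2 * \<omega> * 5 ^ DIM('a) / 2 ^ k * w y) * indicator {y. 2 ^ k < 2 * \<omega> * w y} y)
       = ennreal (2 powr p * 5 ^ DIM('a) * u) * ennreal (a ^ k * indicator {k. 2 ^ k < u} k)" for k
    proof (cases "2 ^ k < u")
      case True
      have "ennreal (c k) * ennreal (2 * \<omega> * 5 ^ DIM('a) / 2 ^ k * w y)
         = ennreal (c k / 2 ^ k * (5 ^ DIM('a) * u))"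
        using wy \<omega> by (simp add: ennreal_mult'[symmetric] c_def u_def mult_ac)
      also have "\<dots> = ennreal (2 powr p * 5 ^ DIM('a) * u) * ennreal (a ^ k)"
        unfolding ck using u a by (simp add: ennreal_mult'[symmetric] mult_ac)
      finally show ?thesis using True by (simp add: u_def)
    qed (simp add: u_def)
    then have "(\<Sum>k. ennreal (c k) * (ennreal (2 * \<omega> * 5 ^ DIM('a) / 2 ^ k * w y) * indicator {y. 2 ^ k < 2 * \<omega> * w y} y))
      = ennreal (2 powr p * 5 ^ DIM('a) * u) * (\<Sum>k. ennreal (a ^ k * indicator {k. 2 ^ k < u} k))"
      by simp
    also have "\<dots> \<le> ennreal (2 powr p * 5 ^ DIM('a) * u) * ennreal (a / (a - 1) * u powr (p - 1))"
      using dyadic_geometric_sum_le[OF p u] unfolding a_def by (intro mult_left_mono) auto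
    also have "\<dots> = ennreal (2 powr p * 5 ^ DIM('a) * (a / (a - 1)) * (u * u powr (p - 1)))"
      using u a by (simp add: ennreal_mult'[symmetric] mult_ac)
    also have "u * u powr (p - 1) = u powr p"
      using u by (simp add: powr_mult_base)
    also have "u powr p = (2 * \<omega>) powr p * w y powr p"
      using wy \<omega> by (simp add: u_def powr_mult)
    finally show ?thesis using a by (simp add: ennreal_mult'[symmetric] mult_ac)
  qed
  have "(\<integral>\<^sup>+x\<in>\<Omega>. ennreal (enn2real (Mw x) powr p) \<partial>lebesgue)
     \<le> (\<integral>\<^sup>+x. indicator \<Omega> x + (\<Sum>k. ennreal (c k) * indicator (E k) x) \<partial>lebesgue)"
    by (intro nn_integral_mono step)
  also have "\<dots> = emeasure lebesgue \<Omega> + (\<Sum>k. ennreal (c k) * emeasure lebesgue (E k))"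
    by (subst nn_integral_add) (auto simp: nn_integral_suminf nn_integral_cmult)
  also have "(\<Sum>k. ennreal (c k) * emeasure lebesgue (E k)) \<le>
     (\<Sum>k. ennreal (c k) * (\<integral>\<^sup>+y. ennreal (2 * \<omega> * 5 ^ DIM('a) / 2 ^ k * w y) * indicator {y. 2 ^ k < 2 * \<omega> * w y} y \<partial>lebesgue))"
  proof (intro suminf_le mult_left_mono)
    fix k :: nat
    show "emeasure lebesgue (E k) \<le>
      (\<integral>\<^sup>+y. ennreal (2 * \<omega> * 5 ^ DIM('a) / 2 ^ k * w y) * indicator {y. 2 ^ k < 2 * \<omega> * w y} y \<partial>lebesgue)"
      unfolding E_def Mw_def \<omega>_def by (rule hl_max_weak_type_truncated) (use w0 in auto)
  qed auto
  also have "\<dots> = (\<integral>\<^sup>+y. (\<Sum>k. ennreal (c k) * (ennreal (2 * \<omega> * 5 ^ DIM('a) / 2 ^ k * w y) * indicator {y. 2 ^ k < 2 * \<omega> * w y} y)) \<partial>lebesgue)"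
    by (subst nn_integral_suminf) (auto simp: nn_integral_cmult)
  also have "\<dots> \<le> (\<integral>\<^sup>+y. ennreal (2 powr p * 5 ^ DIM('a) * (2 * \<omega>) powr p * (a / (a - 1))) * ennreal (w y powr p) \<partial>lebesgue)"
    by (intro nn_integral_mono geom)
  also have "\<dots> = ennreal (2 powr p * 5 ^ DIM('a) * (2 * \<omega>) powr p * (a / (a - 1))) * (\<integral>\<^sup>+y. ennreal (w y powr p) \<partial>lebesgue)"
    by (rule nn_integral_cmult) measurable
  finally show ?thesis unfolding Mw_def by (simp add: add_left_mono)
qed

section \<open>Lebesgue points\<close>

abbreviation osc :: "('a::euclidean_space \<Rightarrow> real) \<Rightarrow> 'a \<Rightarrow> real \<Rightarrow> ennreal" where
  "osc u x r \<equiv> (\<integral>\<^sup>+y\<in>ball x r. ennreal \<bar>u y - u x\<bar> \<partial>lebesgue)"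

text \<open>The oscillation is compared with multiples of \<open>r ^ n\<close>; this says that its average tends to 0 and avoids
  limits of quotients of extended reals.\<close>

definition lebesgue_point :: "('a::euclidean_space \<Rightarrow> real) \<Rightarrow> 'a \<Rightarrow> bool" where
  "lebesgue_point u x \<longleftrightarrow> (\<forall>e>0. \<forall>\<^sub>F r in at_right 0.
     (\<integral>\<^sup>+y\<in>ball x r. ennreal \<bar>u y - u x\<bar> \<partial>lebesgue) \<le> ennreal (e * r ^ DIM('a)))"

text \<open>Think of \<open>b\<close> as the error of approximating \<open>u\<close> by a function with vanishing oscillation. Where the
  oscillation of \<open>u\<close> does not eventually fall below \<open>3 t r ^ n\<close>, the maximal function of \<open>b\<close> or a multiple of \<open>b\<close> itself
  exceeds \<open>t\<close>. By the weak type and Markov inequalities this happens on a set whose measure is at most a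
  constant times \<open>\<delta> / t\<close>, for every \<open>\<delta>\<close>.\<close>

lemma AE_lebesgue_point_of_approx:
  fixes u :: "'a::euclidean_space \<Rightarrow> real"
  assumes approx: "\<And>\<delta>. 0 < \<delta> \<Longrightarrow> \<exists>b. b \<in> borel_measurable lebesgue \<and> (\<integral>\<^sup>+y. b y \<partial>lebesgue) \<le> ennreal \<delta> \<and>
     (AE x in lebesgue. \<forall>e>0. \<forall>\<^sub>F r in at_right 0.
        (\<integral>\<^sup>+y\<in>ball x r. ennreal \<bar>u y - u x\<bar> \<partial>lebesgue)
          \<le> ennreal (r ^ DIM('a)) * (ennreal e + hl_max b x + ennreal (unit_ball_vol (DIM('a))) * b x))"
  shows "AE x in lebesgue. lebesgue_point u x"
proof -
  define n where "n = DIM('a)"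
  define \<omega> where "\<omega> = unit_ball_vol (real n)"
  have \<omega>: "0 < \<omega>" by (simp add: \<omega>_def)
  have neg: "negligible {x. \<not> (\<forall>\<^sub>F r in at_right 0. osc u x r \<le> ennreal (3 * t * r ^ n))}"
    (is "negligible ?N") if t: "0 < t" for t :: real
    unfolding negligible_outer_le
  proof safe
    fix e :: real assume e: "0 < e"
    \<comment> \<open>This choice makes the weak type bound and the Markov bound add up to \<open>e\<close>.\<close>
    define \<delta> where "\<delta> = e / (\<omega> * 5 ^ n / t + \<omega> / t)"
    have den: "0 < \<omega> * 5 ^ n / t + \<omega> / t" using \<omega> t by (intro add_pos_pos) auto
    then have \<delta>: "0 < \<delta>" using e by (simp add: \<delta>_def)
    obtain b where b[measurable]: "b \<in> borel_measurable lebesgue" and ib: "(\<integral>\<^sup>+y. b y \<partial>lebesgue) \<le> ennreal \<delta>"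
      and ae: "AE x in lebesgue. \<forall>e>0. \<forall>\<^sub>F r in at_right 0.
        osc u x r \<le> ennreal (r ^ n) * (ennreal e + hl_max b x + ennreal \<omega> * b x)"
      using approx[OF \<delta>] unfolding n_def \<omega>_def by auto
    obtain Z where Z: "Z \<in> null_sets lebesgue"
      "{x \<in> space lebesgue. \<not> (\<forall>e>0. \<forall>\<^sub>F r in at_right 0.
        osc u x r \<le> ennreal (r ^ n) * (ennreal e + hl_max b x + ennreal \<omega> * b x))} \<subseteq> Z"
      using AE_E[OF ae] by (metis (no_types, lifting) null_setsI)
    define T1 where "T1 = {x. ennreal t < hl_max b x}"
    define T2 where "T2 = {x \<in> space lebesgue. 1 \<le> ennreal (\<omega> / t) * b x}"
    have T1: "T1 \<in> sets lebesgue" unfolding T1_def using open_hl_max_gt[OF b] by simp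
    have T2: "T2 \<in> sets lebesgue" unfolding T2_def by measurable
    have "emeasure lebesgue (Z \<union> (T1 \<union> T2)) = emeasure lebesgue (T1 \<union> T2)"
      using Z(1) T1 T2 by (metis emeasure_Un_null_set sets.Un sup_commute)
    also have "\<dots> \<le> emeasure lebesgue T1 + emeasure lebesgue T2"
      by (rule emeasure_subadditive) fact+
    also have "emeasure lebesgue T1 \<le> ennreal (\<omega> * 5 ^ n / t) * (\<integral>\<^sup>+y. b y \<partial>lebesgue)"
      unfolding T1_def \<omega>_def n_def by (rule hl_max_weak_type[OF b t])
    also have "\<dots> \<le> ennreal (\<omega> * 5 ^ n / t) * ennreal \<delta>" by (intro mult_left_mono ib) simp
    also have "emeasure lebesgue T2 \<le> ennreal (\<omega> / t) * (\<integral>\<^sup>+y. b y * indicator UNIV y \<partial>lebesgue)"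
      using nn_integral_Markov_inequality[of b UNIV lebesgue "ennreal (\<omega> / t)"] by (simp add: T2_def)
    also have "\<dots> \<le> ennreal (\<omega> / t) * ennreal \<delta>" using ib by (intro mult_left_mono) auto
    also have "ennreal (\<omega> * 5 ^ n / t) * ennreal \<delta> + ennreal (\<omega> / t) * ennreal \<delta> = ennreal e"
    proof -
      have "ennreal (\<omega> * 5 ^ n / t) * ennreal \<delta> + ennreal (\<omega> / t) * ennreal \<delta>
         = ennreal ((\<omega> * 5 ^ n / t + \<omega> / t) * \<delta>)"
        using \<omega> t \<delta> by (simp add: ennreal_mult'[symmetric] ennreal_plus[symmetric] distrib_right del: ennreal_plus)
      then show ?thesis using den by (simp add: \<delta>_def)
    qed
    finally have em: "emeasure lebesgue (Z \<union> (T1 \<union> T2)) \<le> ennreal e" by (simp add: add_mono)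
    have sets: "Z \<union> (T1 \<union> T2) \<in> sets lebesgue" using Z(1) T1 T2 by auto
    have lm: "Z \<union> (T1 \<union> T2) \<in> lmeasurable"
      using sets em by (intro fmeasurableI) (auto simp: less_top[symmetric] top_unique)
    have "?N \<subseteq> Z \<union> (T1 \<union> T2)"
    proof safe
      fix x assume x: "\<not> (\<forall>\<^sub>F r in at_right 0. osc u x r \<le> ennreal (3 * t * r ^ n))" "x \<notin> Z" "x \<notin> T2"
      show "x \<in> T1"
      proof (rule ccontr)
        assume "x \<notin> T1"
        then have hm: "hl_max b x \<le> ennreal t" by (simp add: T1_def not_less)
        have "ennreal (\<omega> / t) * b x \<le> 1" using x(3) by (simp add: T2_def)
        then have "ennreal t * (ennreal (\<omega> / t) * b x) \<le> ennreal t * 1" by (rule mult_left_mono) simp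
        also have "ennreal t * (ennreal (\<omega> / t) * b x) = ennreal \<omega> * b x"
          using t \<omega> by (simp add: mult.assoc[symmetric] ennreal_mult'[symmetric])
        finally have bx: "ennreal \<omega> * b x \<le> ennreal t" by simp
        have "\<forall>\<^sub>F r in at_right 0. osc u x r \<le> ennreal (r ^ n) * (ennreal t + hl_max b x + ennreal \<omega> * b x)"
          using Z(2) x(2) t by auto
        moreover have "\<forall>\<^sub>F r in at_right (0::real). 0 < r" by (simp add: eventually_at_right_less)
        ultimately have "\<forall>\<^sub>F r in at_right 0. osc u x r \<le> ennreal (3 * t * r ^ n)"
        proof eventually_elim
          case (elim r)
          have "osc u x r \<le> ennreal (r ^ n) * (ennreal t + hl_max b x + ennreal \<omega> * b x)" by fact
          also have "\<dots> \<le> ennreal (r ^ n) * (ennreal t + ennreal t + ennreal t)"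
            by (intro mult_left_mono add_mono hm bx) auto
          also have "\<dots> = ennreal (3 * t * r ^ n)"
            using t elim(2) by (simp add: ennreal_plus[symmetric] ennreal_mult'[symmetric] algebra_simps del: ennreal_plus)
          finally show ?case .
        qed
        with x(1) show False by simp
      qed
    qed
    moreover have "measure lebesgue (Z \<union> (T1 \<union> T2)) \<le> e"
      using em e by (simp add: measure_def enn2real_leI)
    ultimately show "\<exists>T. ?N \<subseteq> T \<and> T \<in> lmeasurable \<and> measure lebesgue T \<le> e"
      using lm by blast
  qed
  have "AE x in lebesgue. \<forall>\<^sub>F r in at_right 0. osc u x r \<le> ennreal (3 * inverse (Suc k) * r ^ n)" for k
  proof -
    have "{x. \<not> (\<forall>\<^sub>F r in at_right 0. osc u x r \<le> ennreal (3 * inverse (Suc k) * r ^ n))} \<in> null_sets lebesgue"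
      using neg[of "inverse (Suc k)"] by (simp add: negligible_iff_null_sets)
    from AE_not_in[OF this] show ?thesis by simp
  qed
  then have "AE x in lebesgue. \<forall>k. \<forall>\<^sub>F r in at_right 0. osc u x r \<le> ennreal (3 * inverse (Suc k) * r ^ n)"
    by (simp add: AE_all_countable)
  then show ?thesis
  proof eventually_elim
    case (elim x)
    show ?case unfolding lebesgue_point_def
    proof safe
      fix e :: real assume "0 < e"
      then obtain k where k: "inverse (Suc k) < e / 3" using reals_Archimedean[of "e/3"] by auto
      have "\<forall>\<^sub>F r in at_right (0::real). 0 < r" by (simp add: eventually_at_right_less)
      with spec[OF elim, of k] show "\<forall>\<^sub>F r in at_right 0. (\<integral>\<^sup>+y\<in>ball x r. ennreal \<bar>u y - u x\<bar> \<partial>lebesgue) \<le> ennreal (e * r ^ DIM('a))"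
      proof eventually_elim
        case (elim r)
        have "3 * inverse (Suc k) * r ^ n \<le> e * r ^ n" using k elim(2) by (intro mult_right_mono) auto
        with elim(1) show ?case unfolding n_def by (meson ennreal_leI order_trans)
      qed
    qed
  qed
qed

lemma lebesgue_point_add:
  fixes f g :: "'a::euclidean_space \<Rightarrow> real"
  assumes [measurable]: "f \<in> borel_measurable lebesgue" "g \<in> borel_measurable lebesgue"
    and f: "lebesgue_point f x" and g: "lebesgue_point g x"
  shows "lebesgue_point (\<lambda>y. f y + g y) x"
  unfolding lebesgue_point_def
proof safe
  fix e :: real assume e: "0 < e"
  have "\<forall>\<^sub>F r in at_right (0::real). 0 < r" by (simp add: eventually_at_right_less)
  moreover have "\<forall>\<^sub>F r in at_right 0. (\<integral>\<^sup>+y\<in>ball x r. ennreal \<bar>f y - f x\<bar> \<partial>lebesgue) \<le> ennreal (e/2 * r ^ DIM('a))"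
    using f e unfolding lebesgue_point_def by (meson half_gt_zero)
  moreover have "\<forall>\<^sub>F r in at_right 0. (\<integral>\<^sup>+y\<in>ball x r. ennreal \<bar>g y - g x\<bar> \<partial>lebesgue) \<le> ennreal (e/2 * r ^ DIM('a))"
    using g e unfolding lebesgue_point_def by (meson half_gt_zero)
  ultimately show "\<forall>\<^sub>F r in at_right 0. (\<integral>\<^sup>+y\<in>ball x r. ennreal \<bar>f y + g y - (f x + g x)\<bar> \<partial>lebesgue) \<le> ennreal (e * r ^ DIM('a))"
  proof eventually_elim
    case (elim r)
    have [measurable]: "ball x r \<in> sets lebesgue" by simp
    have "(\<integral>\<^sup>+y\<in>ball x r. ennreal \<bar>f y + g y - (f x + g x)\<bar> \<partial>lebesgue)
      \<le> (\<integral>\<^sup>+y. ennreal \<bar>f y - f x\<bar> * indicator (ball x r) y + ennreal \<bar>g y - g x\<bar> * indicator (ball x r) y \<partial>lebesgue)"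
      by (intro nn_integral_mono)
        (auto simp: indicator_def ennreal_plus[symmetric] simp del: ennreal_plus intro!: ennreal_leI)
    also have "\<dots> = (\<integral>\<^sup>+y\<in>ball x r. ennreal \<bar>f y - f x\<bar> \<partial>lebesgue) + (\<integral>\<^sup>+y\<in>ball x r. ennreal \<bar>g y - g x\<bar> \<partial>lebesgue)"
      by (rule nn_integral_add) measurable
    also have "\<dots> \<le> ennreal (e/2 * r ^ DIM('a)) + ennreal (e/2 * r ^ DIM('a))"
      by (intro add_mono elim)
    also have "\<dots> = ennreal (e * r ^ DIM('a))"
      using e elim by (simp add: ennreal_plus[symmetric] del: ennreal_plus)
    finally show ?case .
  qed
qed

text \<open>With a closed \<open>K\<close> inside \<open>A\<close> and an open \<open>U\<close> around \<open>A\<close>, the indicator is constant near any point up to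
  an error supported in \<open>U - K\<close>, a set of small measure.\<close>

lemma AE_lebesgue_point_indicator:
  fixes A :: "'a::euclidean_space set" and c :: real
  assumes A: "A \<in> sets lebesgue"
  shows "AE x in lebesgue. lebesgue_point (\<lambda>x. indicator A x *\<^sub>R c) x"
proof (rule AE_lebesgue_point_of_approx)
  fix \<delta> :: real assume \<delta>: "0 < \<delta>"
  define e where "e = \<delta> / (2 * (\<bar>c\<bar> + 1))"
  have e: "0 < e" using \<delta> by (simp add: e_def)
  obtain U where U: "open U" "A \<subseteq> U" "U - A \<in> lmeasurable" "emeasure lebesgue (U - A) < ennreal e"
    using sets_lebesgue_outer_open[OF A e] by blast
  obtain K where K: "closed K" "K \<subseteq> A" "A - K \<in> lmeasurable" "emeasure lebesgue (A - K) < ennreal e"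
    using sets_lebesgue_inner_closed[OF A e] by blast
  define b where "b y = ennreal \<bar>c\<bar> * indicator (U - K) y" for y :: 'a
  have UK: "U - K \<in> sets lebesgue" using U(1) K(1) by (auto intro!: borel_open borel_closed)
  then have b: "b \<in> borel_measurable lebesgue" unfolding b_def by measurable
  have "(\<integral>\<^sup>+y. b y \<partial>lebesgue) = ennreal \<bar>c\<bar> * emeasure lebesgue (U - K)"
    unfolding b_def by (rule nn_integral_cmult_indicator[OF UK])
  also have "U - K = (U - A) \<union> (A - K)" using U(2) K(2) by auto
  also have "emeasure lebesgue ((U - A) \<union> (A - K)) \<le> emeasure lebesgue (U - A) + emeasure lebesgue (A - K)"
    using U(3) K(3) by (intro emeasure_subadditive) auto
  also have "\<dots> \<le> ennreal e + ennreal e" by (intro add_mono less_imp_le U K)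
  also have "ennreal \<bar>c\<bar> * (ennreal e + ennreal e) = ennreal (\<bar>c\<bar> * (2 * e))"
    using e by (simp add: ennreal_plus[symmetric] ennreal_mult'[symmetric] del: ennreal_plus)
  also have "\<dots> \<le> ennreal \<delta>"
    using \<delta> by (intro ennreal_leI) (simp add: e_def field_simps)
  finally have ib: "(\<integral>\<^sup>+y. b y \<partial>lebesgue) \<le> ennreal \<delta>" by (simp add: mult_left_mono)
  have "\<forall>\<^sub>F r in at_right 0. osc (\<lambda>y. indicator A y *\<^sub>R c) x r
      \<le> ennreal (r ^ DIM('a)) * hl_max b x" for x
  proof -
    define V where "V = (if x \<in> A then U else - K)"
    have "open V" "x \<in> V" using U K by (auto simp: V_def)
    then obtain d where d: "0 < d" "ball x d \<subseteq> V" by (auto simp: open_contains_ball)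
    have le: "ennreal \<bar>indicator A y *\<^sub>R c - indicator A x *\<^sub>R c\<bar> \<le> b y" if "y \<in> V" for y
      using that U(2) K(2) by (auto simp: V_def b_def indicator_def split: if_splits)
    have "osc (\<lambda>y. indicator A y *\<^sub>R c) x r
        \<le> ennreal (r ^ DIM('a)) * hl_max b x" if "0 < r" "r < d" for r
    proof -
      have "osc (\<lambda>y. indicator A y *\<^sub>R c) x r \<le> (\<integral>\<^sup>+y\<in>ball x r. b y \<partial>lebesgue)"
        using le d that by (intro nn_integral_mono) (auto simp: indicator_def subset_iff)
      also have "\<dots> \<le> ennreal (r ^ DIM('a)) * hl_max b x"
        by (rule nn_integral_ball_le_hl_max[OF that(1)])
      finally show ?thesis .
    qed
    then show ?thesis unfolding eventually_at_right_field using d(1) by blast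
  qed
  then have "\<forall>\<^sub>F r in at_right 0. osc (\<lambda>y. indicator A y *\<^sub>R c) x r
      \<le> ennreal (r ^ DIM('a)) * (ennreal e + hl_max b x + ennreal (unit_ball_vol (DIM('a))) * b x)" for x e
    by (rule eventually_mono) (erule order_trans, intro mult_left_mono, auto simp: add.commute add.left_commute)
  with b ib show "\<exists>b. b \<in> borel_measurable lebesgue \<and> (\<integral>\<^sup>+y. b y \<partial>lebesgue) \<le> ennreal \<delta> \<and>
     (AE x in lebesgue. \<forall>e>0. \<forall>\<^sub>F r in at_right 0.
        osc (\<lambda>y. indicator A y *\<^sub>R c) x r
          \<le> ennreal (r ^ DIM('a)) * (ennreal e + hl_max b x + ennreal (unit_ball_vol (DIM('a))) * b x))"
    by (intro exI[of _ b]) auto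
qed

theorem AE_lebesgue_point_integrable:
  fixes u :: "'a::euclidean_space \<Rightarrow> real"
  assumes "integrable lebesgue u"
  shows "AE x in lebesgue. lebesgue_point u x"
  using assms
proof induction
  case (base A c)
  then show ?case using AE_lebesgue_point_indicator[of A c] by simp
next
  case (add f g)
  then have "f \<in> borel_measurable lebesgue" "g \<in> borel_measurable lebesgue" by auto
  from add.IH show ?case
  proof eventually_elim
    case (elim x)
    with add show ?case by (intro lebesgue_point_add) auto
  qed
next
  case (lim f s)
  have [measurable]: "f \<in> borel_measurable lebesgue" "\<And>i. s i \<in> borel_measurable lebesgue"
    using lim by auto
  show ?case
  proof (rule AE_lebesgue_point_of_approx)
    fix \<delta> :: real assume \<delta>: "0 < \<delta>"
    have "(\<lambda>i. \<integral>\<^sup>+x. norm (f x - s i x) \<partial>lebesgue) \<longlonglongrightarrow> 0"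
    proof (rule nn_integral_dominated_convergence_norm)
      show "AE x in lebesgue. norm (s j x) \<le> 2 * norm (f x)" for j using lim.hyps(3) by simp
      show "(\<integral>\<^sup>+ x. ennreal (2 * norm (f x)) \<partial>lebesgue) < \<infinity>"
        using integrableD(2)[OF integrable_mult_right[OF integrable_norm[OF lim.hyps(4)], of 2]] by (simp add: less_top abs_mult)
      show "AE x in lebesgue. (\<lambda>i. s i x) \<longlonglongrightarrow> f x" using lim.hyps(2) by simp
    qed auto
    then have "\<forall>\<^sub>F i in sequentially. (\<integral>\<^sup>+x. norm (f x - s i x) \<partial>lebesgue) < ennreal \<delta>"
      using \<delta> by (intro order_tendstoD) auto
    then obtain i where i: "(\<integral>\<^sup>+x. norm (f x - s i x) \<partial>lebesgue) < ennreal \<delta>"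
      by (auto simp: eventually_sequentially)
    define b where "b x = ennreal \<bar>f x - s i x\<bar>" for x
    have b[measurable]: "b \<in> borel_measurable lebesgue" unfolding b_def by measurable
    have ib: "(\<integral>\<^sup>+y. b y \<partial>lebesgue) \<le> ennreal \<delta>" using i by (simp add: b_def)
    have "\<forall>\<^sub>F r in at_right 0. (\<integral>\<^sup>+y\<in>ball x r. ennreal \<bar>f y - f x\<bar> \<partial>lebesgue)
          \<le> ennreal (r ^ DIM('a)) * (ennreal e + hl_max b x + ennreal (unit_ball_vol (DIM('a))) * b x)"
      if x: "lebesgue_point (s i) x" and e: "0 < e" for x e
    proof -
      have "\<forall>\<^sub>F r in at_right (0::real). 0 < r" by (simp add: eventually_at_right_less)
      moreover have "\<forall>\<^sub>F r in at_right 0. (\<integral>\<^sup>+y\<in>ball x r. ennreal \<bar>s i y - s i x\<bar> \<partial>lebesgue) \<le> ennreal (e * r ^ DIM('a))"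
        using x e unfolding lebesgue_point_def by blast
      ultimately show ?thesis
      proof eventually_elim
        case (elim r)
        have [measurable]: "ball x r \<in> sets lebesgue" by simp
        have "(\<integral>\<^sup>+y\<in>ball x r. ennreal \<bar>f y - f x\<bar> \<partial>lebesgue)
          \<le> (\<integral>\<^sup>+y. ennreal \<bar>s i y - s i x\<bar> * indicator (ball x r) y + b y * indicator (ball x r) y
              + b x * indicator (ball x r) y \<partial>lebesgue)"
          unfolding b_def
          by (intro nn_integral_mono)
            (auto simp: indicator_def ennreal_plus[symmetric] simp del: ennreal_plus intro!: ennreal_leI)
        also have "\<dots> = (\<integral>\<^sup>+y\<in>ball x r. ennreal \<bar>s i y - s i x\<bar> \<partial>lebesgue) + (\<integral>\<^sup>+y\<in>ball x r. b y \<partial>lebesgue)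
            + b x * emeasure lebesgue (ball x r)"
          by (simp add: nn_integral_add nn_integral_cmult_indicator del: emeasure_completion)
        also have "\<dots> \<le> ennreal (e * r ^ DIM('a)) + ennreal (r ^ DIM('a)) * hl_max b x +
            b x * ennreal (unit_ball_vol (DIM('a)) * r ^ DIM('a))"
          using elim by (intro add_mono elim nn_integral_ball_le_hl_max mult_left_mono)
             (auto simp: emeasure_lebesgue_ball simp del: emeasure_completion)
        also have "\<dots> = ennreal (r ^ DIM('a)) * (ennreal e + hl_max b x + ennreal (unit_ball_vol (DIM('a))) * b x)"
          using e elim(1) by (simp add: ennreal_mult distrib_left mult_ac)
        finally show ?case .
      qed
    qed
    then have "AE x in lebesgue. \<forall>e>0. \<forall>\<^sub>F r in at_right 0.
        (\<integral>\<^sup>+y\<in>ball x r. ennreal \<bar>f y - f x\<bar> \<partial>lebesgue)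
          \<le> ennreal (r ^ DIM('a)) * (ennreal e + hl_max b x + ennreal (unit_ball_vol (DIM('a))) * b x)"
      using lim.IH[of i] by (auto elim: eventually_mono)
    with b ib show "\<exists>b. b \<in> borel_measurable lebesgue \<and> (\<integral>\<^sup>+y. b y \<partial>lebesgue) \<le> ennreal \<delta> \<and>
     (AE x in lebesgue. \<forall>e>0. \<forall>\<^sub>F r in at_right 0.
        (\<integral>\<^sup>+y\<in>ball x r. ennreal \<bar>f y - f x\<bar> \<partial>lebesgue)
          \<le> ennreal (r ^ DIM('a)) * (ennreal e + hl_max b x + ennreal (unit_ball_vol (DIM('a))) * b x))"
      by (intro exI[of _ b]) auto
  qed
qed

lemma lebesgue_point_cong:
  fixes u v :: "'a::euclidean_space \<Rightarrow> real"
  assumes U: "open U" "x \<in> U" and eq: "\<And>y. y \<in> U \<Longrightarrow> u y = v y" and u: "lebesgue_point u x"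
  shows "lebesgue_point v x"
  unfolding lebesgue_point_def
proof safe
  fix e :: real assume e: "0 < e"
  obtain d where d: "0 < d" "ball x d \<subseteq> U" using U by (auto simp: open_contains_ball)
  have "\<forall>\<^sub>F r in at_right (0::real). r < d" using d(1) by (simp add: eventually_at_right_field) blast
  moreover have "\<forall>\<^sub>F r in at_right 0. (\<integral>\<^sup>+y\<in>ball x r. ennreal \<bar>u y - u x\<bar> \<partial>lebesgue) \<le> ennreal (e * r ^ DIM('a))"
    using u e unfolding lebesgue_point_def by blast
  ultimately show "\<forall>\<^sub>F r in at_right 0. (\<integral>\<^sup>+y\<in>ball x r. ennreal \<bar>v y - v x\<bar> \<partial>lebesgue) \<le> ennreal (e * r ^ DIM('a))"
  proof eventually_elim
    case (elim r)
    have "(\<integral>\<^sup>+y\<in>ball x r. ennreal \<bar>v y - v x\<bar> \<partial>lebesgue) = (\<integral>\<^sup>+y\<in>ball x r. ennreal \<bar>u y - u x\<bar> \<partial>lebesgue)"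
      using d(2) elim(1) U(2)
      by (intro nn_integral_cong) (auto simp: indicator_def eq[symmetric] subset_iff)
    then show ?case using elim by simp
  qed
qed

text \<open>Only the values of \<open>u\<close> near the point matter, so an exhaustion of \<open>\<Omega>\<close> by compact sets reduces this to
  integrable functions.\<close>

lemma AE_lebesgue_point:
  fixes u :: "'a::euclidean_space \<Rightarrow> real"
  assumes "open \<Omega>" and u: "locally_integrable_on \<Omega> u"
  shows "AE x in lebesgue. x \<in> \<Omega> \<longrightarrow> lebesgue_point u x"
proof -
  obtain C :: "nat \<Rightarrow> 'a set" where C: "\<And>n. compact (C n)" "\<And>n. C n \<subseteq> \<Omega>"
    "\<And>n. C n \<subseteq> interior (C (Suc n))" "\<Union>(range C) = \<Omega>"
    by (rule open_Union_compact_subsets[OF assms(1)]) (rule that; assumption)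
  have "AE x in lebesgue. lebesgue_point (\<lambda>y. indicator (C n) y * u y) x" for n
  proof (rule AE_lebesgue_point_integrable)
    have "integrable (lebesgue_on (C n)) u"
      using u C(1,2)[of n] unfolding locally_integrable_on_def by simp
    moreover have "C n \<in> sets lebesgue" using C(1)[of n] by (simp add: compact_imp_closed borel_closed)
    ultimately show "integrable lebesgue (\<lambda>y. indicator (C n) y * u y)"
      by (simp add: integrable_restrict_space)
  qed
  then have "AE x in lebesgue. \<forall>n. lebesgue_point (\<lambda>y. indicator (C n) y * u y) x"
    unfolding AE_all_countable by blast
  then show ?thesis
  proof eventually_elim
    case (elim x)
    show ?case
    proof
      assume "x \<in> \<Omega>"
      then obtain n where "x \<in> C n" unfolding C(4)[symmetric] by blast
      then have "x \<in> interior (C (Suc n))" by (rule subsetD[OF C(3)])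
      moreover have "indicator (C (Suc n)) y * u y = u y" if "y \<in> interior (C (Suc n))" for y
        using subsetD[OF interior_subset that] by simp
      ultimately show "lebesgue_point u x"
        using lebesgue_point_cong[OF open_interior _ _ spec[OF elim, of "Suc n"]] by blast
    qed
  qed
qed

lemma integral_lebesgue_affine:
  fixes k :: "'a::euclidean_space \<Rightarrow> real"
  assumes k: "k \<in> borel_measurable borel" and t: "0 < t"
  shows "(LINT w|lebesgue. k ((w - x) /\<^sub>R t)) = t ^ DIM('a) * (LINT z|lebesgue. k z)"
    and "integrable lebesgue k \<Longrightarrow> integrable lebesgue (\<lambda>w. k ((w - x) /\<^sub>R t))"
proof -
  note [measurable] = k
  have eq: "lborel = density (distr lborel borel (\<lambda>z::'a. x + t *\<^sub>R z)) (\<lambda>_. ennreal (\<bar>t\<bar> ^ DIM('a)))"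
    using t by (intro lborel_affine) auto
  have cancel: "k ((x + t *\<^sub>R z - x) /\<^sub>R t) = k z" for z using t by simp
  have m: "(\<lambda>w. k ((w - x) /\<^sub>R t)) \<in> borel_measurable borel" by measurable
  have "(LINT w|lebesgue. k ((w - x) /\<^sub>R t)) = (\<integral>w. k ((w - x) /\<^sub>R t) \<partial>lborel)"
    using m by (simp add: integral_completion)
  also have "\<dots> = (\<integral>w. \<bar>t\<bar> ^ DIM('a) * k ((w - x) /\<^sub>R t) \<partial>distr lborel borel (\<lambda>z::'a. x + t *\<^sub>R z))"
    using t by (subst eq) (simp add: integral_density)
  also have "\<dots> = (\<integral>z. \<bar>t\<bar> ^ DIM('a) * k ((x + t *\<^sub>R z - x) /\<^sub>R t) \<partial>lborel)"
    by (rule integral_distr) measurable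
  also have "\<dots> = t ^ DIM('a) * (\<integral>z. k z \<partial>lborel)" by (simp only: cancel, use t in simp)
  finally show "(LINT w|lebesgue. k ((w - x) /\<^sub>R t)) = t ^ DIM('a) * (LINT z|lebesgue. k z)"
    by (simp add: integral_completion)
  assume "integrable lebesgue k"
  then have "integrable lborel k" using k by (simp add: integrable_completion)
  then have "integrable lborel (\<lambda>z. \<bar>t\<bar> ^ DIM('a) * k ((x + t *\<^sub>R z - x) /\<^sub>R t))"
    by (simp only: cancel integrable_mult_right)
  then have "integrable (distr lborel borel (\<lambda>z::'a. x + t *\<^sub>R z)) (\<lambda>w. \<bar>t\<bar> ^ DIM('a) * k ((w - x) /\<^sub>R t))"
    by (subst integrable_distr_eq) auto
  then have "integrable lborel (\<lambda>w. k ((w - x) /\<^sub>R t))"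
    using t by (subst eq) (simp add: integrable_density)
  then show "integrable lebesgue (\<lambda>w. k ((w - x) /\<^sub>R t))"
    using m by (simp add: integrable_completion)
qed

text \<open>The kernel has integral independent of \<open>t\<close>, is at most \<open>A / t ^ n\<close> and vanishes outside a ball of
  radius \<open>t D\<close>, so the distance to the limit is at most \<open>A / t ^ n\<close> times the oscillation on that ball.\<close>

lemma mollification_tendsto:
  fixes u k :: "'a::euclidean_space \<Rightarrow> real"
  assumes x: "lebesgue_point u x"
    and r0: "0 < r0" and u: "integrable lebesgue (\<lambda>w. indicator (ball x r0) w * u w)"
    and k[measurable]: "k \<in> borel_measurable borel" and kA: "\<And>z. \<bar>k z\<bar> \<le> A"
    and D: "0 < D" and k0: "\<And>z. D \<le> norm z \<Longrightarrow> k z = 0"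
  shows "((\<lambda>t. LINT w|lebesgue. u w * (k ((w - x) /\<^sub>R t) / t ^ DIM('a))) \<longlongrightarrow> u x * (LINT z|lebesgue. k z)) (at_right 0)"
proof (rule tendstoI)
  fix e :: real assume e: "0 < e"
  have A: "0 \<le> A" using kA[of 0] by linarith
  \<comment> \<open>The factor \<open>A + 1\<close> covers the case \<open>A = 0\<close>.\<close>
  define e' where "e' = e / (2 * (A + 1) * D ^ DIM('a))"
  have e': "0 < e'" using e A D by (simp add: e'_def)
  have ik: "integrable lebesgue k"
  proof (rule Bochner_Integration.integrable_bound)
    show "integrable lebesgue (\<lambda>z. A * indicator (ball 0 D) z :: real)"
      by (intro integrable_mult_right) (use lmeasurable_ball in \<open>simp add: lmeasurable_iff_integrable\<close>)
    have "k \<in> borel_measurable lborel" by simp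
    then show "k \<in> borel_measurable lebesgue" by (rule measurable_completion)
    show "AE z in lebesgue. norm (k z) \<le> norm (A * indicator (ball 0 D) z)"
      using kA k0 A by (auto simp: indicator_def)
  qed
  obtain b where b: "0 < b" and ev: "\<And>r. 0 < r \<Longrightarrow> r < b \<Longrightarrow>
      (\<integral>\<^sup>+y\<in>ball x r. ennreal \<bar>u y - u x\<bar> \<partial>lebesgue) \<le> ennreal (e' * r ^ DIM('a))"
    using x[unfolded lebesgue_point_def, rule_format, OF e'] unfolding eventually_at_right_field by auto
  have "dist (LINT w|lebesgue. u w * (k ((w - x) /\<^sub>R t) / t ^ DIM('a))) (u x * (LINT z|lebesgue. k z)) < e"
    if t: "0 < t" "t < min b r0 / D" for t
  proof -
    define r where "r = t * D"
    have r: "0 < r" "r < b" "r < r0" using t D by (auto simp: r_def field_simps)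
    define \<kappa> where "\<kappa> w = k ((w - x) /\<^sub>R t) / t ^ DIM('a)" for w
    have [measurable]: "\<kappa> \<in> borel_measurable lebesgue"
    proof -
      have "\<kappa> \<in> borel_measurable lborel" unfolding \<kappa>_def by measurable
      then show ?thesis by (rule measurable_completion)
    qed
    have \<kappa>A: "\<bar>\<kappa> w\<bar> \<le> A / t ^ DIM('a)" for w
      using kA t by (simp add: \<kappa>_def abs_mult divide_right_mono)
    have \<kappa>0: "\<kappa> w = 0" if "w \<notin> ball x r" for w
    proof -
      have "norm ((w - x) /\<^sub>R t) = norm (w - x) / t" using t(1) by (simp add: divide_inverse)
      then have "D \<le> norm ((w - x) /\<^sub>R t)"
        using that t(1) by (simp add: r_def dist_norm norm_minus_commute pos_le_divide_eq mult.commute)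
      then show ?thesis by (simp add: \<kappa>_def k0)
    qed
    have i\<kappa>: "integrable lebesgue \<kappa>"
      unfolding \<kappa>_def by (intro integrable_divide_zero integral_lebesgue_affine(2)[OF k t(1) ik])
    have int\<kappa>: "(LINT w|lebesgue. \<kappa> w) = (LINT z|lebesgue. k z)"
      unfolding \<kappa>_def using t by (simp add: integral_lebesgue_affine(1)[OF k t(1)])
    \<comment> \<open>The function \<open>u\<close> is controlled only near \<open>x\<close>; the kernel does not see the rest.\<close>
    have eq: "u w * \<kappa> w = (indicator (ball x r0) w * u w) * \<kappa> w" for w
      using \<kappa>0[of w] r by (auto simp: indicator_def)
    have iu\<kappa>: "integrable lebesgue (\<lambda>w. u w * \<kappa> w)"
      unfolding eq
    proof (rule Bochner_Integration.integrable_bound)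
      show "integrable lebesgue (\<lambda>w. (A / t ^ DIM('a)) * (indicator (ball x r0) w * u w))"
        by (intro integrable_mult_right u)
      show "(\<lambda>w. (indicator (ball x r0) w * u w) * \<kappa> w) \<in> borel_measurable lebesgue"
        using borel_measurable_integrable[OF u] by measurable
      show "AE w in lebesgue. norm ((indicator (ball x r0) w * u w) * \<kappa> w) \<le> norm ((A / t ^ DIM('a)) * (indicator (ball x r0) w * u w))"
      proof (intro AE_I2)
        fix w
        have "\<bar>\<kappa> w\<bar> * \<bar>indicator (ball x r0) w * u w\<bar> \<le> A / t ^ DIM('a) * \<bar>indicator (ball x r0) w * u w\<bar>"
          by (rule mult_right_mono[OF \<kappa>A]) simp
        then show "norm ((indicator (ball x r0) w * u w) * \<kappa> w) \<le> norm ((A / t ^ DIM('a)) * (indicator (ball x r0) w * u w))"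
          using A t by (simp add: abs_mult mult.commute)
      qed
    qed
    have "(LINT w|lebesgue. u w * \<kappa> w) - u x * (LINT z|lebesgue. k z) = (LINT w|lebesgue. (u w - u x) * \<kappa> w)"
      unfolding int\<kappa>[symmetric] left_diff_distrib using iu\<kappa> i\<kappa> by simp
    moreover have "\<bar>LINT w|lebesgue. (u w - u x) * \<kappa> w\<bar> \<le> A / t ^ DIM('a) * (e' * r ^ DIM('a))"
    proof -
      have "ennreal (norm (LINT w|lebesgue. (u w - u x) * \<kappa> w)) \<le> (\<integral>\<^sup>+w. norm ((u w - u x) * \<kappa> w) \<partial>lebesgue)"
        using iu\<kappa> i\<kappa> by (intro integral_norm_bound_ennreal) (simp add: left_diff_distrib)
      also have "\<dots> \<le> (\<integral>\<^sup>+w. ennreal (A / t ^ DIM('a)) * (ennreal \<bar>u w - u x\<bar> * indicator (ball x r) w) \<partial>lebesgue)"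
      proof (rule nn_integral_mono)
        fix w
        show "ennreal (norm ((u w - u x) * \<kappa> w)) \<le> ennreal (A / t ^ DIM('a)) * (ennreal \<bar>u w - u x\<bar> * indicator (ball x r) w)"
        proof (cases "w \<in> ball x r")
          case True
          have "\<bar>\<kappa> w\<bar> * \<bar>u w - u x\<bar> \<le> A / t ^ DIM('a) * \<bar>u w - u x\<bar>"
            by (rule mult_right_mono[OF \<kappa>A]) simp
          then have "ennreal (norm ((u w - u x) * \<kappa> w)) \<le> ennreal (A / t ^ DIM('a) * \<bar>u w - u x\<bar>)"
            by (intro ennreal_leI) (simp add: abs_mult mult.commute)
          also have "\<dots> = ennreal (A / t ^ DIM('a)) * ennreal \<bar>u w - u x\<bar>"
            using A t by (intro ennreal_mult) auto
          finally show ?thesis using True by simp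
        qed (simp add: \<kappa>0)
      qed
      also have "\<dots> = ennreal (A / t ^ DIM('a)) * (\<integral>\<^sup>+w\<in>ball x r. ennreal \<bar>u w - u x\<bar> \<partial>lebesgue)"
      proof (rule nn_integral_cmult)
        have [measurable]: "ball x r \<in> sets lebesgue" by simp
        have "(\<lambda>w. ennreal \<bar>u w - u x\<bar> * indicator (ball x r) w)
           = (\<lambda>w. ennreal \<bar>indicator (ball x r0) w * u w - u x\<bar> * indicator (ball x r) w)"
          using r by (auto simp: indicator_def)
        also have "\<dots> \<in> borel_measurable lebesgue"
          using borel_measurable_integrable[OF u] by measurable
        finally show "(\<lambda>w. ennreal \<bar>u w - u x\<bar> * indicator (ball x r) w) \<in> borel_measurable lebesgue" .
      qed
      also have "\<dots> \<le> ennreal (A / t ^ DIM('a)) * ennreal (e' * r ^ DIM('a))"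
        using ev[OF r(1,2)] by (rule mult_left_mono) simp
      also have "\<dots> = ennreal (A / t ^ DIM('a) * (e' * r ^ DIM('a)))"
        using A t e' r by (simp add: ennreal_mult'[symmetric])
      finally show ?thesis using A t e' r by (subst (asm) ennreal_le_iff) auto
    qed
    moreover have "A / t ^ DIM('a) * (e' * r ^ DIM('a)) < e"
    proof -
      have "A / t ^ DIM('a) * (e' * r ^ DIM('a)) = A * e' * D ^ DIM('a)"
        using t by (simp add: r_def power_mult_distrib)
      also have "\<dots> = e * (A / (2 * (A + 1)))" using D by (simp add: e'_def)
      also have "\<dots> < e * 1" using e A by (intro mult_strict_left_mono) (auto simp: field_simps)
      finally show ?thesis by simp
    qed
    ultimately show ?thesis by (simp add: \<kappa>_def dist_real_def)
  qed
  then show "\<forall>\<^sub>F t in at_right 0. dist (LINT w|lebesgue. u w * (k ((w - x) /\<^sub>R t) / t ^ DIM('a))) (u x * (LINT z|lebesgue. k z)) < e"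
    unfolding eventually_at_right_field using b r0 D by (intro exI[of _ "min b r0 / D"]) auto
qed

section \<open>Smooth bumps and test functions\<close>

text \<open>The functions \<open>exp (- 1 / t) / t ^ m\<close>, extended by 0. Differentiation maps each of them to a linear
  combination of two others, so all are smooth although only first derivatives are ever computed.\<close>

definition bump_profile :: "nat \<Rightarrow> real \<Rightarrow> real" where
  "bump_profile m t = (if 0 < t then exp (- inverse t) * inverse t ^ m else 0)"

lemma bump_profile_tendsto_0: "(bump_profile m \<longlongrightarrow> 0) (at 0)"
proof (rule filterlim_split_at)
  have "\<forall>\<^sub>F t in at_left 0. bump_profile m t = 0"
    by (auto simp: bump_profile_def eventually_at_filter)
  then show "(bump_profile m \<longlongrightarrow> 0) (at_left 0)" by (rule tendsto_eventually)
  have "((\<lambda>t. inverse t ^ m / exp (inverse t)) \<longlongrightarrow> (0::real)) (at_right 0)"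
    by (rule filterlim_compose[OF tendsto_power_div_exp_0 filterlim_inverse_at_top_right])
  moreover have "\<forall>\<^sub>F t in at_right 0. inverse t ^ m / exp (inverse t) = bump_profile m t"
    using eventually_at_right_less[of "0::real"]
    by eventually_elim (simp add: bump_profile_def exp_minus divide_inverse mult.commute)
  ultimately show "(bump_profile m \<longlongrightarrow> 0) (at_right 0)"
    by (rule Lim_transform_eventually)
qed

lemma bump_profile_has_field_derivative:
  "(bump_profile m has_field_derivative (bump_profile (m + 2) t - real m * bump_profile (m + 1) t)) (at t)"
proof (cases t "0::real" rule: linorder_cases)
  case less
  have "((\<lambda>t. 0) has_field_derivative 0) (at t)" by simp
  then have "(bump_profile m has_field_derivative 0) (at t)"
    by (rule DERIV_cong_ev[THEN iffD1, rotated -1])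
      (use less in \<open>auto simp: bump_profile_def eventually_nhds intro!: exI[of _ "{..<0}"]\<close>)
  then show ?thesis using less by (simp add: bump_profile_def)
next
  case equal
  have "((\<lambda>h. bump_profile (m + 1) h) \<longlongrightarrow> 0) (at 0)" by (rule bump_profile_tendsto_0)
  moreover have "\<forall>\<^sub>F h in at 0. bump_profile (m + 1) h = (bump_profile m (0 + h) - bump_profile m 0) / h"
    unfolding eventually_at_filter by (auto simp: bump_profile_def divide_inverse)
  ultimately have "((\<lambda>h. (bump_profile m (0 + h) - bump_profile m 0) / h) \<longlongrightarrow> 0) (at 0)"
    by (rule Lim_transform_eventually)
  then show ?thesis unfolding DERIV_def using equal by (simp add: bump_profile_def)
next
  case greater
  have "((\<lambda>t. exp (- inverse t) * inverse t ^ m) has_field_derivative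
      (bump_profile (m + 2) t - real m * bump_profile (m + 1) t)) (at t)"
  proof -
    have inv: "(inverse has_field_derivative - (inverse t ^ Suc (Suc 0))) (at t)"
      using greater by (intro DERIV_inverse) auto
    have pow: "((\<lambda>t. inverse t ^ m) has_field_derivative (- real m * inverse t ^ (m + 1))) (at t)"
      using DERIV_power[OF inv, of m] by (rule DERIV_cong) (cases m; simp add: algebra_simps)
    have "((\<lambda>t. exp (- inverse t)) has_field_derivative (exp (- inverse t) * inverse t ^ 2)) (at t)"
      using greater by (auto intro!: derivative_eq_intros simp: power2_eq_square)
    from DERIV_mult[OF this pow] show ?thesis
      by (rule DERIV_cong) (use greater in \<open>simp add: bump_profile_def algebra_simps power2_eq_square\<close>)
  qed
  then show ?thesis
    by (rule DERIV_cong_ev[THEN iffD1, rotated -1])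
      (use greater in \<open>auto simp: bump_profile_def eventually_nhds intro!: exI[of _ "{0<..}"]\<close>)
qed

text \<open>The span of products of polynomials with a profile of \<open>1 - |x|\<^sup>2\<close>. It is closed under partial derivatives,
  whence every member is infinitely differentiable; and every member vanishes outside the unit ball.\<close>

inductive_set bump_functions :: "('a::euclidean_space \<Rightarrow> real) set" where
  profile: "(\<lambda>x. bump_profile m (1 - x \<bullet> x)) \<in> bump_functions"
| add: "f \<in> bump_functions \<Longrightarrow> g \<in> bump_functions \<Longrightarrow> (\<lambda>x. f x + g x) \<in> bump_functions"
| scale: "f \<in> bump_functions \<Longrightarrow> (\<lambda>x. c * f x) \<in> bump_functions"
| coord: "f \<in> bump_functions \<Longrightarrow> (\<lambda>x. (x \<bullet> i) * f x) \<in> bump_functions"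

text \<open>The four constructors are differentiated by the chain, sum and product rules, and each result is again built
  from the constructors.\<close>

lemma bump_functions_has_derivative:
  assumes "f \<in> bump_functions"
  obtains f' where "\<And>x. (f has_derivative f' x) (at x)" "\<And>h. (\<lambda>x. f' x h) \<in> bump_functions"
proof -
  have "\<exists>f'. (\<forall>x. (f has_derivative f' x) (at x)) \<and> (\<forall>h. (\<lambda>x. f' x h) \<in> bump_functions)"
    using assms
  proof induction
    case (profile m)
    define f' where "f' x h = (x \<bullet> h) * ((-2) * bump_profile (m + 2) (1 - x \<bullet> x) + (2 * real m) * bump_profile (m + 1) (1 - x \<bullet> x))"
      for x h :: 'a
    have "((\<lambda>x. bump_profile m (1 - x \<bullet> x)) has_derivative f' x) (at x)" for x :: 'a
    proof -
      have "((\<lambda>x. 1 - x \<bullet> x) has_derivative (\<lambda>h. - 2 * (x \<bullet> h))) (at x)"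
        by (auto intro!: derivative_eq_intros simp: inner_commute)
      from has_derivative_compose[OF this bump_profile_has_field_derivative[THEN has_field_derivative_imp_has_derivative], of m]
      show ?thesis
        by (rule has_derivative_eq_rhs) (auto simp: f'_def fun_eq_iff algebra_simps)
    qed
    moreover have "(\<lambda>x. f' x h) \<in> bump_functions" for h
      unfolding f'_def by (intro bump_functions.intros)
    ultimately show ?case by blast
  next
    case (add f g)
    then obtain f' g' where "\<And>x. (f has_derivative f' x) (at x)" "\<And>h. (\<lambda>x. f' x h) \<in> bump_functions"
      "\<And>x. (g has_derivative g' x) (at x)" "\<And>h. (\<lambda>x. g' x h) \<in> bump_functions" by blast
    then show ?case
      by (intro exI[of _ "\<lambda>x h. f' x h + g' x h"] conjI allI has_derivative_add bump_functions.add)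
  next
    case (scale f c)
    then obtain f' where "\<And>x. (f has_derivative f' x) (at x)" "\<And>h. (\<lambda>x. f' x h) \<in> bump_functions" by blast
    then show ?case
      by (intro exI[of _ "\<lambda>x h. c * f' x h"] conjI allI has_derivative_mult_right bump_functions.scale)
  next
    case (coord f i)
    then obtain f' where f': "\<And>x. (f has_derivative f' x) (at x)" "\<And>h. (\<lambda>x. f' x h) \<in> bump_functions" by blast
    have "((\<lambda>x. (x \<bullet> i) * f x) has_derivative (\<lambda>h. (x \<bullet> i) * f' x h + (h \<bullet> i) * f x)) (at x)" for x
      by (auto intro!: derivative_eq_intros f'(1))
    moreover have "(\<lambda>x. (x \<bullet> i) * f' x h + (h \<bullet> i) * f x) \<in> bump_functions" for h
      by (intro bump_functions.intros f'(2) coord.hyps)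
    ultimately show ?case
      by (intro exI[of _ "\<lambda>x h. (x \<bullet> i) * f' x h + (h \<bullet> i) * f x"]) blast
  qed
  then show thesis using that by blast
qed

lemma bump_functions_eq_0:
  assumes "f \<in> bump_functions" "1 \<le> norm x"
  shows "f x = 0"
  using assms
proof induction
  case (profile m)
  then have "1 \<le> x \<bullet> x" by (simp add: dot_square_norm)
  then show ?case by (simp add: bump_profile_def)
qed auto

lemma bump_functions_continuous_on: "f \<in> bump_functions \<Longrightarrow> continuous_on S f"
  by (metis bump_functions_has_derivative continuous_at_imp_continuous_on has_derivative_continuous)

lemma bump_functions_rescaled_has_derivative:
  assumes "f \<in> bump_functions" "\<rho> \<noteq> 0"
  obtains f' where "\<And>w. ((\<lambda>w. f ((w - a) /\<^sub>R \<rho>)) has_derivative (\<lambda>h. f' h ((w - a) /\<^sub>R \<rho>))) (at w)"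
    "\<And>h. f' h \<in> bump_functions"
proof -
  obtain f' where f': "\<And>x. (f has_derivative f' x) (at x)" "\<And>h. (\<lambda>x. f' x h) \<in> bump_functions"
    using bump_functions_has_derivative[OF assms(1)] by blast
  have "((\<lambda>w. f ((w - a) /\<^sub>R \<rho>)) has_derivative (\<lambda>h. f' ((w - a) /\<^sub>R \<rho>) (h /\<^sub>R \<rho>))) (at w)" for w
    by (rule has_derivative_compose[OF _ f'(1)]) (auto intro!: derivative_eq_intros)
  moreover have "f' z (h /\<^sub>R \<rho>) = inverse \<rho> * f' z h" for z h
    using f'(1)[of z] by (simp add: linear_cmul[OF has_derivative_linear])
  ultimately show thesis
    by (intro that[of "\<lambda>h z. inverse \<rho> * f' z h"] bump_functions.scale f'(2)) simp
qed

lemma Ck_bump_functions: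
  assumes "f \<in> bump_functions" "\<rho> \<noteq> 0"
  shows "Ck k (\<lambda>w. f ((w - a) /\<^sub>R \<rho>))"
  using assms(1)
proof (induction k arbitrary: f)
  case 0
  then show ?case
    by (simp, intro continuous_on_compose2[OF bump_functions_continuous_on[of f UNIV]] continuous_intros) auto
next
  case (Suc k)
  obtain f' where f': "\<And>w. ((\<lambda>w. f ((w - a) /\<^sub>R \<rho>)) has_derivative (\<lambda>h. f' h ((w - a) /\<^sub>R \<rho>))) (at w)"
    "\<And>h. f' h \<in> bump_functions"
    using bump_functions_rescaled_has_derivative[OF Suc.prems assms(2), of a] by metis
  have "frechet_derivative (\<lambda>w. f ((w - a) /\<^sub>R \<rho>)) (at x) = (\<lambda>h. f' h ((x - a) /\<^sub>R \<rho>))" for x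
    using frechet_derivative_at[OF f'(1)] by simp
  then show ?case using f' Suc.IH[OF f'(2)] by (auto simp: differentiable_def)
qed

lemma test_function_bump:
  assumes f: "f \<in> bump_functions" and \<rho>: "0 < \<rho>" and sub: "cball a \<rho> \<subseteq> \<Omega>"
  shows "test_function \<Omega> (\<lambda>w. f ((w - a) /\<^sub>R \<rho>))"
proof -
  have "{w. f ((w - a) /\<^sub>R \<rho>) \<noteq> 0} \<subseteq> cball a \<rho>"
  proof safe
    fix w assume "f ((w - a) /\<^sub>R \<rho>) \<noteq> 0"
    then have "norm ((w - a) /\<^sub>R \<rho>) < 1" using bump_functions_eq_0[OF f] not_less by blast
    moreover have "norm ((w - a) /\<^sub>R \<rho>) = norm (w - a) / \<rho>" using \<rho> by (simp add: divide_inverse)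
    ultimately show "w \<in> cball a \<rho>" using \<rho> by (simp add: dist_norm norm_minus_commute)
  qed
  then have sub': "closure {w. f ((w - a) /\<^sub>R \<rho>) \<noteq> 0} \<subseteq> cball a \<rho>"
    by (rule closure_minimal) simp
  then have "compact (closure {w. f ((w - a) /\<^sub>R \<rho>) \<noteq> 0})"
    by (meson bounded_cball bounded_subset closed_closure compact_eq_bounded_closed)
  with sub' sub show ?thesis
    unfolding test_function_def using Ck_bump_functions[OF f] \<rho> by fastforce
qed

lemma test_function_has_derivative:
  assumes "test_function \<Omega> \<phi>"
  shows "(\<phi> has_derivative frechet_derivative \<phi> (at x)) (at x)"
proof -
  have "Ck (Suc 0) \<phi>" using assms unfolding test_function_def by blast
  then show ?thesis by (simp add: frechet_derivative_works[symmetric])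
qed

lemma Ck_add: "Ck k f \<Longrightarrow> Ck k g \<Longrightarrow> Ck k (\<lambda>x. f x + g x)"
proof (induction k arbitrary: f g)
  case 0
  then show ?case by (auto intro: continuous_on_add)
next
  case (Suc k)
  have "frechet_derivative (\<lambda>x. f x + g x) (at x) i = frechet_derivative f (at x) i + frechet_derivative g (at x) i" for x i
  proof -
    have "f differentiable (at x)" "g differentiable (at x)" using Suc.prems by simp_all
    then have "((\<lambda>x. f x + g x) has_derivative (\<lambda>h. frechet_derivative f (at x) h + frechet_derivative g (at x) h)) (at x)"
      by (intro has_derivative_add) (simp_all add: frechet_derivative_works[symmetric])
    from frechet_derivative_at[OF this] show ?thesis by metis
  qed
  then show ?case using Suc by (auto intro: differentiable_add)
qed

lemma Ck_cmult: "Ck k f \<Longrightarrow> Ck k (\<lambda>x. c * f x)"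
proof (induction k arbitrary: f)
  case 0
  then show ?case by (auto intro: continuous_intros)
next
  case (Suc k)
  have "frechet_derivative (\<lambda>x. c * f x) (at x) i = c * frechet_derivative f (at x) i" for x i
  proof -
    have "f differentiable (at x)" using Suc.prems by simp
    then have "((\<lambda>x. c * f x) has_derivative (\<lambda>h. c * frechet_derivative f (at x) h)) (at x)"
      by (intro has_derivative_mult_right) (simp add: frechet_derivative_works[symmetric])
    from frechet_derivative_at[OF this] show ?thesis by metis
  qed
  then show ?case using Suc by (auto intro: differentiable_mult)
qed

lemma test_function_add:
  assumes "test_function \<Omega> \<phi>" "test_function \<Omega> \<psi>"
  shows "test_function \<Omega> (\<lambda>x. \<phi> x + \<psi> x)"
proof -
  have "{x. \<phi> x + \<psi> x \<noteq> 0} \<subseteq> {x. \<phi> x \<noteq> 0} \<union> {x. \<psi> x \<noteq> 0}" by auto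
  then have *: "closure {x. \<phi> x + \<psi> x \<noteq> 0} \<subseteq> closure {x. \<phi> x \<noteq> 0} \<union> closure {x. \<psi> x \<noteq> 0}"
    unfolding closure_Un[symmetric] by (rule closure_mono)
  then have "compact (closure {x. \<phi> x + \<psi> x \<noteq> 0})"
    using assms unfolding test_function_def
    by (meson bounded_subset closed_closure compact_Un compact_eq_bounded_closed)
  then show ?thesis using * assms Ck_add unfolding test_function_def by blast
qed

lemma test_function_cmult:
  assumes "test_function \<Omega> \<phi>"
  shows "test_function \<Omega> (\<lambda>x. c * \<phi> x)"
proof -
  have "{x. c * \<phi> x \<noteq> 0} \<subseteq> {x. \<phi> x \<noteq> 0}" by auto
  then have *: "closure {x. c * \<phi> x \<noteq> 0} \<subseteq> closure {x. \<phi> x \<noteq> 0}" by (rule closure_mono)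
  then have "compact (closure {x. c * \<phi> x \<noteq> 0})"
    using assms unfolding test_function_def
    by (meson bounded_subset closed_closure compact_eq_bounded_closed)
  then show ?thesis using * assms Ck_cmult unfolding test_function_def by blast
qed

lemma test_function_continuous_on:
  assumes "test_function \<Omega> \<phi>"
  shows "continuous_on S \<phi>"
proof -
  have "Ck 0 \<phi>" using assms unfolding test_function_def by blast
  then show ?thesis by (auto intro: continuous_on_subset)
qed

lemma test_function_derivative_continuous_on:
  assumes "test_function \<Omega> \<phi>" "i \<in> Basis"
  shows "continuous_on S (\<lambda>x. frechet_derivative \<phi> (at x) i)"
proof -
  have "Ck (Suc 0) \<phi>" using assms unfolding test_function_def by blast
  then show ?thesis using assms(2) by (auto intro: continuous_on_subset)
qed

lemma test_function_support:
  assumes "test_function \<Omega> \<phi>"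
  obtains K where "compact K" "K \<subseteq> \<Omega>" "\<And>x. x \<notin> K \<Longrightarrow> \<phi> x = 0"
    "\<And>x i. x \<notin> K \<Longrightarrow> frechet_derivative \<phi> (at x) i = 0"
proof
  let ?K = "closure {x. \<phi> x \<noteq> 0}"
  show "compact ?K" "?K \<subseteq> \<Omega>" using assms unfolding test_function_def by auto
  show 0: "\<phi> x = 0" if "x \<notin> ?K" for x
    using that closure_subset[of "{x. \<phi> x \<noteq> 0}"] by auto
  show "frechet_derivative \<phi> (at x) i = 0" if "x \<notin> ?K" for x i
  proof -
    have "((\<lambda>x. 0) has_derivative (\<lambda>h. 0)) (at x)" by simp
    then have "(\<phi> has_derivative (\<lambda>h. 0)) (at x)"
    proof (rule has_derivative_transform_within_open)
      show "open (- ?K)" by (intro open_Compl closed_closure)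
      show "x \<in> - ?K" using that unfolding Compl_iff .
      show "0 = \<phi> y" if "y \<in> - ?K" for y using 0[OF ComplD[OF that]] by (rule sym)
    qed
    from frechet_derivative_at[OF this] show ?thesis by metis
  qed
qed

lemma borel_measurable_lebesgue_continuous:
  fixes \<psi> :: "'a::euclidean_space \<Rightarrow> real"
  assumes "continuous_on UNIV \<psi>"
  shows "\<psi> \<in> borel_measurable lebesgue"
proof -
  have "\<psi> \<in> borel_measurable lborel" using borel_measurable_continuous_onI[OF assms] by simp
  then show ?thesis by (rule measurable_completion)
qed

lemma integrable_times_bounded_continuous:
  fixes u \<psi> :: "'a::euclidean_space \<Rightarrow> real"
  assumes u: "integrable lebesgue u" and \<psi>: "continuous_on UNIV \<psi>" and B: "\<And>x. \<bar>\<psi> x\<bar> \<le> B"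
  shows "integrable lebesgue (\<lambda>x. u x * \<psi> x)"
proof (rule Bochner_Integration.integrable_bound)
  show "integrable lebesgue (\<lambda>x. B * u x)" by (intro integrable_mult_right u)
  note [measurable] = borel_measurable_lebesgue_continuous[OF \<psi>]
  show "(\<lambda>x. u x * \<psi> x) \<in> borel_measurable lebesgue"
    using borel_measurable_integrable[OF u] by measurable
  show "AE x in lebesgue. norm (u x * \<psi> x) \<le> norm (B * u x)"
  proof (intro AE_I2)
    fix x
    have "\<bar>\<psi> x\<bar> * \<bar>u x\<bar> \<le> \<bar>B\<bar> * \<bar>u x\<bar>"
      using B[of x] by (intro mult_right_mono) auto
    then show "norm (u x * \<psi> x) \<le> norm (B * u x)" by (simp add: abs_mult mult.commute)
  qed
qed

lemma bounded_of_compact_support: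
  fixes \<psi> :: "'a::euclidean_space \<Rightarrow> real"
  assumes "compact K" "continuous_on K \<psi>" "\<And>x. x \<notin> K \<Longrightarrow> \<psi> x = 0"
  obtains B where "0 \<le> B" "\<And>x. \<bar>\<psi> x\<bar> \<le> B"
proof -
  have "bounded (\<psi> ` K)"
    by (intro compact_imp_bounded compact_continuous_image assms)
  then obtain B where "\<forall>y\<in>\<psi> ` K. norm y \<le> B" unfolding bounded_iff by blast
  then have B: "\<bar>\<psi> x\<bar> \<le> B" if "x \<in> K" for x using that by simp
  show thesis
  proof (rule that[of "max B 0"])
    show "\<bar>\<psi> x\<bar> \<le> max B 0" for x using B[of x] assms(3)[of x] by (cases "x \<in> K") auto
  qed simp
qed

text \<open>Multiplication by \<open>\<psi>\<close> restricts \<open>u\<close> to the compact set \<open>K\<close>, where it is integrable.\<close>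

lemma integrable_times_continuous:
  fixes u \<psi> :: "'a::euclidean_space \<Rightarrow> real"
  assumes u: "locally_integrable_on \<Omega> u" and K: "compact K" "K \<subseteq> \<Omega>"
    and \<psi>: "continuous_on UNIV \<psi>" and \<psi>0: "\<And>x. x \<notin> K \<Longrightarrow> \<psi> x = 0"
  shows "integrable lebesgue (\<lambda>x. u x * \<psi> x)"
proof -
  have Ks: "K \<in> sets lebesgue" using K(1) by (simp add: compact_imp_closed borel_closed)
  have "integrable (lebesgue_on K) u" using u K unfolding locally_integrable_on_def by blast
  then have iu: "integrable lebesgue (\<lambda>x. indicator K x * u x)"
    using Ks by (simp add: integrable_restrict_space)
  obtain B where "\<And>x. \<bar>\<psi> x\<bar> \<le> B"
    using bounded_of_compact_support[OF K(1) continuous_on_subset[OF \<psi> subset_UNIV] \<psi>0] by metis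
  from integrable_times_bounded_continuous[OF iu \<psi> this]
  have "integrable lebesgue (\<lambda>x. (indicator K x * u x) * \<psi> x)" .
  moreover have "u x * \<psi> x = (indicator K x * u x) * \<psi> x" for x
    using \<psi>0[of x] by (auto simp: indicator_def)
  ultimately show ?thesis by (simp only:)
qed

lemma integrable_times_test_function:
  assumes "locally_integrable_on \<Omega> u" "test_function \<Omega> \<phi>"
  shows "integrable lebesgue (\<lambda>x. u x * \<phi> x)" "integrable lebesgue (\<lambda>x. u x * \<bar>\<phi> x\<bar>)"
    "i \<in> Basis \<Longrightarrow> integrable lebesgue (\<lambda>x. u x * frechet_derivative \<phi> (at x) i)"
proof -
  obtain K where K: "compact K" "K \<subseteq> \<Omega>" "\<And>x. x \<notin> K \<Longrightarrow> \<phi> x = 0"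
    "\<And>x i. x \<notin> K \<Longrightarrow> frechet_derivative \<phi> (at x) i = 0"
    using test_function_support[OF assms(2)] by metis
  show "integrable lebesgue (\<lambda>x. u x * \<phi> x)"
    using K test_function_continuous_on[OF assms(2)] by (intro integrable_times_continuous[OF assms(1)]) auto
  show "integrable lebesgue (\<lambda>x. u x * \<bar>\<phi> x\<bar>)"
    using K test_function_continuous_on[OF assms(2)]
    by (intro integrable_times_continuous[OF assms(1) K(1,2)] continuous_intros) auto
  show "integrable lebesgue (\<lambda>x. u x * frechet_derivative \<phi> (at x) i)" if "i \<in> Basis"
    using K test_function_derivative_continuous_on[OF assms(2) that]
    by (intro integrable_times_continuous[OF assms(1)]) auto
qed

definition mollifier :: "'a::euclidean_space \<Rightarrow> real" where
  "mollifier z = inverse (\<integral>x. bump_profile 0 (1 - x \<bullet> x) \<partial>(lebesgue :: 'a measure)) * bump_profile 0 (1 - z \<bullet> z)"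

lemma mollifier_bump: "mollifier \<in> bump_functions"
  unfolding mollifier_def[abs_def] by (intro bump_functions.intros)

lemma mollifier_nonneg: "0 \<le> mollifier z"
  unfolding mollifier_def bump_profile_def by (auto intro!: integral_nonneg)

lemma bump_functions_bounded:
  assumes "f \<in> bump_functions"
  obtains A where "\<And>z. \<bar>f z\<bar> \<le> A"
proof -
  have "bounded (f ` cball 0 1)"
    by (intro compact_imp_bounded compact_continuous_image bump_functions_continuous_on assms compact_cball)
  then obtain A where "\<forall>z\<in>f ` cball 0 1. norm z \<le> A" unfolding bounded_iff by blast
  then have A: "\<bar>f z\<bar> \<le> A" if "z \<in> cball 0 1" for z using that by simp
  have "0 \<le> A" using A[of 0] by simp
  then have "\<bar>f z\<bar> \<le> A" for z
    using A[of z] bump_functions_eq_0[OF assms, of z] by (cases "norm z \<le> 1") auto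
  then show thesis by (rule that)
qed

lemma bump_functions_borel: "f \<in> bump_functions \<Longrightarrow> f \<in> borel_measurable borel"
  by (intro borel_measurable_continuous_onI bump_functions_continuous_on)

lemma bump_functions_integrable:
  assumes "f \<in> bump_functions"
  shows "integrable lebesgue f"
proof -
  have "integrable lebesgue (\<lambda>x. 1 * f x)"
  proof (rule integrable_times_continuous[of UNIV _ "cball 0 1"])
    show "locally_integrable_on UNIV (\<lambda>x. 1)"
      unfolding locally_integrable_on_def by (auto simp: compact_imp_closed borel_closed integrable_restrict_space
          lmeasurable_iff_integrable[symmetric] lmeasurable_compact)
  qed (use bump_functions_eq_0[OF assms] bump_functions_continuous_on[OF assms] in auto)
  then show ?thesis by simp
qed

lemma integral_mollifier: "(\<integral>z. mollifier z \<partial>(lebesgue :: 'a::euclidean_space measure)) = 1"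
proof -
  define b where "b x = bump_profile 0 (1 - x \<bullet> x)" for x :: 'a
  have b: "b \<in> bump_functions" unfolding b_def[abs_def] by (rule bump_functions.profile)
  have pos: "0 < b x" if "x \<in> ball 0 1" for x
  proof -
    have "x \<bullet> x < 1" using that by (simp add: dot_square_norm power_less_one_iff)
    then show ?thesis by (simp add: b_def bump_profile_def)
  qed
  have "(LINT x|lebesgue. b x) \<noteq> 0"
  proof
    assume "(LINT x|lebesgue. b x) = 0"
    then have "AE x in lebesgue. b x = 0"
      using bump_functions_integrable[OF b] by (subst (asm) integral_nonneg_eq_0_iff_AE) (auto simp: b_def bump_profile_def)
    then have "AE x in lebesgue. x \<notin> ball (0::'a) 1"
      by (rule eventually_mono) (use pos in force)
    then have "ball (0::'a) 1 \<in> null_sets lebesgue"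
      by (subst (asm) AE_iff_null_sets[symmetric]) auto
    then have "negligible (ball (0::'a) 1)" by (simp add: negligible_iff_null_sets)
    then show False using open_not_negligible[of "ball (0::'a) 1"] by simp
  qed
  then show ?thesis unfolding mollifier_def b_def by simp
qed

section \<open>Test functions determine locally integrable functions\<close>

lemma locally_integrable_on_ball:
  fixes u :: "'a::euclidean_space \<Rightarrow> real"
  assumes "locally_integrable_on \<Omega> u" "cball x r \<subseteq> \<Omega>"
  shows "integrable lebesgue (\<lambda>w. indicator (ball x r) w * u w)"
proof -
  have "integrable (lebesgue_on (cball x r)) u"
    using assms unfolding locally_integrable_on_def by simp
  then have "integrable lebesgue (\<lambda>w. indicator (cball x r) w * u w)"
    by (simp add: integrable_restrict_space)
  from integrable_mult_indicator[OF _ this, of "ball x r"]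
  have "integrable lebesgue (\<lambda>w. indicator (ball x r) w *\<^sub>R (indicator (cball x r) w * u w))" by simp
  moreover have "indicator (ball x r) w *\<^sub>R (indicator (cball x r) w * u w) = indicator (ball x r) w * u w" for w
    by (auto simp: indicator_def)
  ultimately show ?thesis by (simp only:)
qed

text \<open>Testing with mollifiers that concentrate at a common Lebesgue point of \<open>u\<close> and \<open>G\<close> turns the integrated
  inequality into the pointwise one. With \<open>G = 0\<close> this is the fundamental lemma of the calculus of variations.\<close>

lemma AE_abs_le_of_test_bound:
  fixes u G :: "'a::euclidean_space \<Rightarrow> real"
  assumes "open \<Omega>" and u: "locally_integrable_on \<Omega> u" and G: "locally_integrable_on \<Omega> G"
    and le: "\<And>\<phi>. test_function \<Omega> \<phi> \<Longrightarrow> \<bar>LINT x|lebesgue. u x * \<phi> x\<bar> \<le> (LINT x|lebesgue. G x * \<bar>\<phi> x\<bar>)"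
  shows "AE x in lebesgue. x \<in> \<Omega> \<longrightarrow> \<bar>u x\<bar> \<le> G x"
  using AE_lebesgue_point[OF assms(1) u] AE_lebesgue_point[OF assms(1) G]
proof eventually_elim
  case (elim x)
  show ?case
  proof
    assume x: "x \<in> \<Omega>"
    then obtain r0 where r0: "0 < r0" "cball x r0 \<subseteq> \<Omega>" using assms(1) open_contains_cball by blast
    obtain A where A: "\<And>z::'a. \<bar>mollifier z\<bar> \<le> A" using bump_functions_bounded[OF mollifier_bump] by blast
    have lim: "((\<lambda>t. LINT w|lebesgue. g w * (mollifier ((w - x) /\<^sub>R t) / t ^ DIM('a))) \<longlongrightarrow> g x) (at_right 0)"
      if "lebesgue_point g x" "locally_integrable_on \<Omega> g" for g
      using mollification_tendsto[OF that(1) r0(1) locally_integrable_on_ball[OF that(2) r0(2)]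
          bump_functions_borel[OF mollifier_bump] A zero_less_one bump_functions_eq_0[OF mollifier_bump]]
      by (simp add: integral_mollifier)
    have "\<bar>LINT w|lebesgue. u w * (mollifier ((w - x) /\<^sub>R t) / t ^ DIM('a))\<bar>
        \<le> (LINT w|lebesgue. G w * (mollifier ((w - x) /\<^sub>R t) / t ^ DIM('a)))" if t: "0 < t" "t < r0" for t
    proof -
      have "cball x t \<subseteq> \<Omega>" using r0(2) t by (meson order_trans less_imp_le subset_cball)
      then have "test_function \<Omega> (\<lambda>w. inverse (t ^ DIM('a)) * mollifier ((w - x) /\<^sub>R t))"
        by (intro test_function_cmult test_function_bump mollifier_bump t)
      then have "test_function \<Omega> (\<lambda>w. mollifier ((w - x) /\<^sub>R t) / t ^ DIM('a))"
        by (simp add: divide_inverse mult.commute)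
      from le[OF this] show ?thesis using t by (simp add: mollifier_nonneg)
    qed
    then have "\<forall>\<^sub>F t in at_right 0. \<bar>LINT w|lebesgue. u w * (mollifier ((w - x) /\<^sub>R t) / t ^ DIM('a))\<bar>
        \<le> (LINT w|lebesgue. G w * (mollifier ((w - x) /\<^sub>R t) / t ^ DIM('a)))"
      unfolding eventually_at_right_field using r0(1) by blast
    from tendsto_le[OF _ lim tendsto_rabs[OF lim] this] elim x u G
    show "\<bar>u x\<bar> \<le> G x" by simp
  qed
qed

lemma integral_lebesgue_on_eq:
  fixes F :: "'a::euclidean_space \<Rightarrow> real"
  assumes "open \<Omega>" "\<And>x. x \<notin> \<Omega> \<Longrightarrow> F x = 0"
  shows "(LINT x|lebesgue_on \<Omega>. F x) = (LINT x|lebesgue. F x)"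
proof -
  have "(LINT x|lebesgue_on \<Omega>. F x) = (LINT x|lebesgue. indicator \<Omega> x *\<^sub>R F x)"
    using assms(1) by (intro integral_restrict_space) simp
  also have "\<dots> = (LINT x|lebesgue. F x)"
    using assms(2) by (intro Bochner_Integration.integral_cong) (auto simp: indicator_def)
  finally show ?thesis .
qed

text \<open>Test functions and their derivatives vanish outside \<open>\<Omega>\<close>, so the integrals may be taken over the whole
  space.\<close>

lemma has_weak_gradient_test:
  assumes "open \<Omega>" "has_weak_gradient \<Omega> f v" "test_function \<Omega> \<phi>" "i \<in> Basis"
  shows "(LINT x|lebesgue. f x * frechet_derivative \<phi> (at x) i) = - (LINT x|lebesgue. (v x \<bullet> i) * \<phi> x)"
proof -
  obtain K where K: "K \<subseteq> \<Omega>" "\<And>x. x \<notin> K \<Longrightarrow> \<phi> x = 0"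
    "\<And>x i. x \<notin> K \<Longrightarrow> frechet_derivative \<phi> (at x) i = 0"
    using test_function_support[OF assms(3)] by metis
  have "(LINT x|lebesgue_on \<Omega>. f x * frechet_derivative \<phi> (at x) i) = (LINT x|lebesgue. f x * frechet_derivative \<phi> (at x) i)"
    by (rule integral_lebesgue_on_eq[OF assms(1)]) (use K in auto)
  moreover have "(LINT x|lebesgue_on \<Omega>. (v x \<bullet> i) * \<phi> x) = (LINT x|lebesgue. (v x \<bullet> i) * \<phi> x)"
    by (rule integral_lebesgue_on_eq[OF assms(1)]) (use K in auto)
  ultimately show ?thesis using assms unfolding has_weak_gradient_def by auto
qed

lemma locally_integrable_on_inner:
  "locally_integrable_on \<Omega> v \<Longrightarrow> locally_integrable_on \<Omega> (\<lambda>x. v x \<bullet> i)"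
  unfolding locally_integrable_on_def by auto

lemma weak_gradient_unique:
  fixes \<Omega> :: "'a::euclidean_space set"
  assumes \<Omega>: "open \<Omega>" and v: "has_weak_gradient \<Omega> f v" and v': "has_weak_gradient \<Omega> f v'"
  shows "AE x in lebesgue. x \<in> \<Omega> \<longrightarrow> v x = v' x"
proof -
  have lv: "locally_integrable_on \<Omega> v" and lv': "locally_integrable_on \<Omega> v'"
    using v v' unfolding has_weak_gradient_def by auto
  have "AE x in lebesgue. x \<in> \<Omega> \<longrightarrow> \<bar>v x \<bullet> i - v' x \<bullet> i\<bar> \<le> 0" if i: "i \<in> Basis" for i
  proof (rule AE_abs_le_of_test_bound[OF \<Omega>])
    show "locally_integrable_on \<Omega> (\<lambda>x. v x \<bullet> i - v' x \<bullet> i)"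
      using lv lv' unfolding locally_integrable_on_def by auto
    show "locally_integrable_on \<Omega> (\<lambda>x. 0 :: real)" unfolding locally_integrable_on_def by simp
    fix \<phi> assume \<phi>: "test_function \<Omega> \<phi>"
    have "(LINT x|lebesgue. (v x \<bullet> i - v' x \<bullet> i) * \<phi> x) = (LINT x|lebesgue. (v x \<bullet> i) * \<phi> x) - (LINT x|lebesgue. (v' x \<bullet> i) * \<phi> x)"
      unfolding left_diff_distrib
      using integrable_times_test_function(1)[OF locally_integrable_on_inner \<phi>] lv lv' by (intro Bochner_Integration.integral_diff) auto
    also have "\<dots> = 0"
      using has_weak_gradient_test[OF \<Omega> v \<phi> i] has_weak_gradient_test[OF \<Omega> v' \<phi> i] by simp
    finally show "\<bar>LINT x|lebesgue. (v x \<bullet> i - v' x \<bullet> i) * \<phi> x\<bar> \<le> (LINT x|lebesgue. 0 * \<bar>\<phi> x\<bar>)" by simp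
  qed
  then have "\<forall>i\<in>Basis. AE x in lebesgue. x \<in> \<Omega> \<longrightarrow> \<bar>v x \<bullet> i - v' x \<bullet> i\<bar> \<le> 0" by blast
  then have "AE x in lebesgue. \<forall>i\<in>Basis. x \<in> \<Omega> \<longrightarrow> \<bar>v x \<bullet> i - v' x \<bullet> i\<bar> \<le> 0"
    by (intro AE_finite_allI) auto
  then show ?thesis by (rule eventually_mono) (auto intro: euclidean_eqI)
qed

section \<open>Averages against contracting bumps\<close>

text \<open>By the mean value theorem the bound on the derivatives also bounds the difference quotients, and dominated
  convergence applies along every sequence.\<close>

lemma has_field_derivative_integral_dominated:
  fixes \<phi> \<phi>' :: "real \<Rightarrow> 'a \<Rightarrow> real"
  assumes S: "open S" "convex S" "t \<in> S"
    and int: "\<And>\<tau>. \<tau> \<in> S \<Longrightarrow> integrable M (\<phi> \<tau>)"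
    and der: "\<And>\<tau> w. \<tau> \<in> S \<Longrightarrow> ((\<lambda>\<tau>. \<phi> \<tau> w) has_field_derivative \<phi>' \<tau> w) (at \<tau>)"
    and bound: "\<And>\<tau> w. \<tau> \<in> S \<Longrightarrow> \<bar>\<phi>' \<tau> w\<bar> \<le> H w" and H: "integrable M H"
    and meas: "\<phi>' t \<in> borel_measurable M"
  shows "((\<lambda>\<tau>. \<integral>w. \<phi> \<tau> w \<partial>M) has_field_derivative (\<integral>w. \<phi>' t w \<partial>M)) (at t)"
proof -
  have "((\<lambda>y. ((\<integral>w. \<phi> y w \<partial>M) - (\<integral>w. \<phi> t w \<partial>M)) / (y - t)) \<longlongrightarrow> (\<integral>w. \<phi>' t w \<partial>M)) (at t within S)"
    unfolding tendsto_at_iff_sequentially comp_def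
  proof (intro allI impI)
    fix X :: "nat \<Rightarrow> real" assume X: "\<forall>i. X i \<in> S - {t}" and lim: "X \<longlonglongrightarrow> t"
    have eq: "((\<integral>w. \<phi> (X i) w \<partial>M) - (\<integral>w. \<phi> t w \<partial>M)) / (X i - t) = (\<integral>w. (\<phi> (X i) w - \<phi> t w) / (X i - t) \<partial>M)" for i
    proof -
      have "X i \<in> S" using X by blast
      then show ?thesis using int S(3) by simp
    qed
    show "(\<lambda>i. ((\<integral>w. \<phi> (X i) w \<partial>M) - (\<integral>w. \<phi> t w \<partial>M)) / (X i - t)) \<longlonglongrightarrow> (\<integral>w. \<phi>' t w \<partial>M)"
      unfolding eq
    proof (rule integral_dominated_convergence[OF meas _ H])
      show "(\<lambda>w. (\<phi> (X i) w - \<phi> t w) / (X i - t)) \<in> borel_measurable M" for i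
      proof -
        have "X i \<in> S" using X by blast
        then have [measurable]: "\<phi> (X i) \<in> borel_measurable M" "\<phi> t \<in> borel_measurable M"
          using int S(3) by (auto intro: borel_measurable_integrable)
        show ?thesis by measurable
      qed
      show "AE w in M. (\<lambda>i. (\<phi> (X i) w - \<phi> t w) / (X i - t)) \<longlonglongrightarrow> \<phi>' t w"
      proof (intro AE_I2)
        fix w
        have "((\<lambda>y. (\<phi> y w - \<phi> t w) / (y - t)) \<longlongrightarrow> \<phi>' t w) (at t within S)"
          using der[OF S(3), of w] by (auto simp: has_field_derivative_iff intro: tendsto_within_subset)
        then show "(\<lambda>i. (\<phi> (X i) w - \<phi> t w) / (X i - t)) \<longlonglongrightarrow> \<phi>' t w"
          using X lim unfolding tendsto_at_iff_sequentially comp_def by blast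
      qed
      show "AE w in M. norm ((\<phi> (X i) w - \<phi> t w) / (X i - t)) \<le> H w" for i
      proof (intro AE_I2)
        fix w
        have "norm (\<phi> (X i) w - \<phi> t w) \<le> H w * norm (X i - t)"
          by (rule field_differentiable_bound[OF S(2)])
            (use X S(3) der bound in \<open>auto intro: has_field_derivative_at_within\<close>)
        moreover have "0 < norm (X i - t)" using X by auto
        ultimately show "norm ((\<phi> (X i) w - \<phi> t w) / (X i - t)) \<le> H w"
          unfolding norm_divide by (simp add: pos_divide_le_eq)
      qed
    qed
  qed
  then show ?thesis unfolding has_field_derivative_iff at_within_open[OF S(3,1)] .
qed

text \<open>Bumps centred at \<open>b\<close> with radius \<open>R\<close>. An off-centre bump is needed because the bump around the midpoint of
  two points is contracted towards one of them.\<close>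

definition bumps_at :: "'a::euclidean_space \<Rightarrow> real \<Rightarrow> ('a \<Rightarrow> real) set" where
  "bumps_at b R = (\<lambda>s z. s ((z - b) /\<^sub>R R)) ` bump_functions"

lemma bumps_atI: "s \<in> bump_functions \<Longrightarrow> (\<lambda>z. s ((z - b) /\<^sub>R R)) \<in> bumps_at b R"
  unfolding bumps_at_def by blast

lemma bumps_at_add:
  assumes "f \<in> bumps_at b R" "g \<in> bumps_at b R"
  shows "(\<lambda>x. f x + g x) \<in> bumps_at b R"
proof -
  obtain s s' where s: "s \<in> bump_functions" "f = (\<lambda>z. s ((z - b) /\<^sub>R R))"
    and s': "s' \<in> bump_functions" "g = (\<lambda>z. s' ((z - b) /\<^sub>R R))"
    using assms unfolding bumps_at_def by blast
  show ?thesis unfolding s(2) s'(2) by (rule bumps_atI[OF bump_functions.add[OF s(1) s'(1)]])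
qed

lemma bumps_at_scale:
  assumes "f \<in> bumps_at b R"
  shows "(\<lambda>x. c * f x) \<in> bumps_at b R"
proof -
  obtain s where s: "s \<in> bump_functions" "f = (\<lambda>z. s ((z - b) /\<^sub>R R))"
    using assms unfolding bumps_at_def by blast
  show ?thesis unfolding s(2) by (rule bumps_atI[OF bump_functions.scale[OF s(1)]])
qed

text \<open>The coordinate \<open>z \<bullet> i\<close> is an affine function of the rescaled variable \<open>(z - b) / R\<close>.\<close>

lemma bumps_at_coord:
  assumes f: "f \<in> bumps_at b R" and R: "0 < R"
  shows "(\<lambda>x. (x \<bullet> i) * f x) \<in> bumps_at b R"
proof -
  obtain s where s: "s \<in> bump_functions" "f = (\<lambda>z. s ((z - b) /\<^sub>R R))"
    using f unfolding bumps_at_def by blast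
  have "(\<lambda>\<zeta>. R * ((\<zeta> \<bullet> i) * s \<zeta>) + (b \<bullet> i) * s \<zeta>) \<in> bump_functions"
    by (intro bump_functions.intros s)
  from bumps_atI[OF this, where b = b and R = R]
  have "(\<lambda>z. R * ((((z - b) /\<^sub>R R) \<bullet> i) * s ((z - b) /\<^sub>R R)) + (b \<bullet> i) * s ((z - b) /\<^sub>R R)) \<in> bumps_at b R" .
  moreover have "R * ((((z - b) /\<^sub>R R) \<bullet> i) * c) + (b \<bullet> i) * c = (z \<bullet> i) * c" for z c
  proof -
    have "R * ((((z - b) /\<^sub>R R) \<bullet> i) * c) = ((z - b) \<bullet> i) * c" using R by simp
    then show ?thesis by (simp add: inner_diff_left left_diff_distrib)
  qed
  ultimately show ?thesis by (simp only: s(2))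
qed

lemma bumps_at_sum:
  assumes "finite I" "I \<noteq> {}" "\<And>i. i \<in> I \<Longrightarrow> f i \<in> bumps_at b R"
  shows "(\<lambda>x. \<Sum>i\<in>I. f i x) \<in> bumps_at b R"
  using assms by (induction rule: finite_ne_induct) (auto intro: bumps_at_add)

lemma bumps_at_has_derivative:
  assumes "f \<in> bumps_at b R" "0 < R"
  obtains f' where "\<And>w. (f has_derivative (\<lambda>h. f' h w)) (at w)" "\<And>h. f' h \<in> bumps_at b R"
proof -
  obtain s where s: "s \<in> bump_functions" "f = (\<lambda>z. s ((z - b) /\<^sub>R R))"
    using assms unfolding bumps_at_def by blast
  obtain s' where s': "\<And>w. ((\<lambda>w. s ((w - b) /\<^sub>R R)) has_derivative (\<lambda>h. s' h ((w - b) /\<^sub>R R))) (at w)"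
    "\<And>h. s' h \<in> bump_functions"
    using bump_functions_rescaled_has_derivative[OF s(1), of R b] assms(2) by auto
  show thesis
    by (rule that[of "\<lambda>h w. s' h ((w - b) /\<^sub>R R)"]) (use s(2) s'(1) bumps_atI[OF s'(2)] in auto)
qed

lemma bumps_at_eq_0:
  assumes "f \<in> bumps_at b R" "0 < R" "R \<le> norm (z - b)"
  shows "f z = 0"
proof -
  obtain s where s: "s \<in> bump_functions" "f = (\<lambda>z. s ((z - b) /\<^sub>R R))"
    using assms unfolding bumps_at_def by blast
  have "norm ((z - b) /\<^sub>R R) = norm (z - b) / R" using assms by (simp add: divide_inverse)
  then have "1 \<le> norm ((z - b) /\<^sub>R R)" using assms by simp
  then show ?thesis unfolding s(2) by (rule bump_functions_eq_0[OF s(1)])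
qed

lemma bumps_at_bounded:
  assumes "f \<in> bumps_at b R"
  obtains A where "\<And>z. \<bar>f z\<bar> \<le> A"
proof -
  obtain s where s: "s \<in> bump_functions" "f = (\<lambda>z. s ((z - b) /\<^sub>R R))"
    using assms unfolding bumps_at_def by blast
  obtain A where "\<And>z. \<bar>s z\<bar> \<le> A" using bump_functions_bounded[OF s(1)] by blast
  then show thesis by (intro that[of A]) (simp add: s(2))
qed

lemma bumps_at_borel:
  assumes "f \<in> bumps_at b R"
  shows "f \<in> borel_measurable borel"
proof -
  obtain s where s: "s \<in> bump_functions" "f = (\<lambda>z. s ((z - b) /\<^sub>R R))"
    using assms unfolding bumps_at_def by blast
  note [measurable] = bump_functions_borel[OF s(1)]
  show ?thesis unfolding s(2) by measurable
qed

lemma bumps_at_rescale: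
  fixes f :: "'a::euclidean_space \<Rightarrow> real"
  assumes f: "f \<in> bumps_at b R" and t: "0 < t"
  shows "(\<lambda>w. f ((w - x) /\<^sub>R t)) \<in> bumps_at (x + t *\<^sub>R b) (t * R)"
proof -
  obtain s where s: "s \<in> bump_functions" "f = (\<lambda>z. s ((z - b) /\<^sub>R R))"
    using assms unfolding bumps_at_def by blast
  have "((w - x) /\<^sub>R t - b) /\<^sub>R R = (w - (x + t *\<^sub>R b)) /\<^sub>R (t * R)" for w
    using t by (simp add: algebra_simps)
  then show ?thesis using bumps_atI[OF s(1), where b = "x + t *\<^sub>R b" and R = "t * R"] by (simp add: s(2))
qed

lemma test_function_bumps_at:
  assumes "f \<in> bumps_at b R" "0 < R" "cball b R \<subseteq> \<Omega>"
  shows "test_function \<Omega> f"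
proof -
  obtain s where s: "s \<in> bump_functions" "f = (\<lambda>z. s ((z - b) /\<^sub>R R))"
    using assms unfolding bumps_at_def by blast
  show ?thesis unfolding s(2) by (rule test_function_bump[OF s(1) assms(2,3)])
qed

text \<open>By the chain rule: \<open>(w - x) / t\<close> is homogeneous of degree -1 in \<open>t\<close>, so the radial derivative of \<open>k\<close>
  appears; the sum over \<open>Basis\<close> is its expansion in partial derivatives.\<close>

lemma bumps_at_dilated_has_field_derivative:
  fixes k :: "'a::euclidean_space \<Rightarrow> real"
  assumes k': "\<And>z. (k has_derivative (\<lambda>h. k' h z)) (at z)" and t: "0 < t"
  shows "((\<lambda>t. k ((w - x) /\<^sub>R t) / t ^ DIM('a)) has_field_derivative
    - (real DIM('a) * k ((w - x) /\<^sub>R t) + (\<Sum>i\<in>Basis. (((w - x) /\<^sub>R t) \<bullet> i) * k' i ((w - x) /\<^sub>R t))) / t ^ Suc DIM('a)) (at t)"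
proof -
  define z where "z = (w - x) /\<^sub>R t"
  have lin: "k' z z = (\<Sum>i\<in>Basis. (z \<bullet> i) * k' i z)"
  proof -
    interpret linear "\<lambda>h. k' h z" using k' by (rule has_derivative_linear)
    have "k' z z = k' (\<Sum>i\<in>Basis. (z \<bullet> i) *\<^sub>R i) z" by (simp only: euclidean_representation)
    also have "\<dots> = (\<Sum>i\<in>Basis. (z \<bullet> i) * k' i z)" by (simp only: sum scale real_scaleR_def)
    finally show ?thesis .
  qed
  have "((\<lambda>t. (w - x) /\<^sub>R t) has_derivative (\<lambda>h. (- h / t) *\<^sub>R z)) (at t)"
    using t by (auto intro!: derivative_eq_intros simp: z_def divide_inverse)
  from has_derivative_compose[OF this k']
  have "((\<lambda>t. k ((w - x) /\<^sub>R t)) has_derivative (\<lambda>h. k' ((- h / t) *\<^sub>R z) z)) (at t)" by (simp add: z_def)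
  moreover have "(\<lambda>h. k' ((- h / t) *\<^sub>R z) z) = (*) (- (k' z z / t))"
  proof
    fix h
    interpret linear "\<lambda>h. k' h z" using k' by (rule has_derivative_linear)
    show "k' ((- h / t) *\<^sub>R z) z = (- (k' z z / t)) * h" unfolding scale by simp
  qed
  ultimately have 1: "((\<lambda>t. k ((w - x) /\<^sub>R t)) has_field_derivative - (k' z z / t)) (at t)"
    by (simp add: has_field_derivative_def)
  have 2: "((\<lambda>t. t ^ DIM('a)) has_field_derivative (real DIM('a) * t ^ (DIM('a) - 1))) (at t)"
    by (auto intro!: derivative_eq_intros)
  have n: "DIM('a) = Suc (DIM('a) - 1)" by simp
  from DERIV_divide[OF 1 2] t have
    "((\<lambda>t. k ((w - x) /\<^sub>R t) / t ^ DIM('a)) has_field_derivative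
      (- (k' z z / t) * t ^ DIM('a) - k z * (real DIM('a) * t ^ (DIM('a) - 1))) / (t ^ DIM('a) * t ^ DIM('a))) (at t)"
    by (simp add: z_def)
  moreover have "(- (k' z z / t) * t ^ DIM('a) - k z * (real DIM('a) * t ^ (DIM('a) - 1))) / (t ^ DIM('a) * t ^ DIM('a))
     = - (real DIM('a) * k z + k' z z) / t ^ Suc DIM('a)"
  proof -
    have "t ^ DIM('a) = t * t ^ (DIM('a) - 1)" by (metis n power_Suc)
    then have "(- (k' z z / t) * t ^ DIM('a) - k z * (real DIM('a) * t ^ (DIM('a) - 1)))
       = t ^ DIM('a) * (- (real DIM('a) * k z + k' z z) / t)"
      using t by (simp add: field_simps)
    then show ?thesis using t by (simp add: field_simps)
  qed
  ultimately have "((\<lambda>t. k ((w - x) /\<^sub>R t) / t ^ DIM('a)) has_field_derivative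
      - (real DIM('a) * k z + k' z z) / t ^ Suc DIM('a)) (at t)"
    by (simp only:)
  then show ?thesis unfolding lin unfolding z_def .
qed

text \<open>Summed over \<open>i\<close> this is the divergence in \<open>w\<close> of the vector field \<open>z k z / t ^ n\<close> with
  \<open>z = (w - x) / t\<close>. It is the negative of the derivative in \<open>t\<close> of \<open>k z / t ^ n\<close>.\<close>

lemma dilated_divergence:
  fixes k :: "'a::euclidean_space \<Rightarrow> real"
  assumes k': "\<And>z. (k has_derivative (\<lambda>h. k' h z)) (at z)" and t: "0 < t" and i: "i \<in> Basis"
  shows "frechet_derivative (\<lambda>w. (((w - x) /\<^sub>R t) \<bullet> i) * k ((w - x) /\<^sub>R t) / t ^ DIM('a)) (at w) i
    = (k ((w - x) /\<^sub>R t) + (((w - x) /\<^sub>R t) \<bullet> i) * k' i ((w - x) /\<^sub>R t)) / t ^ Suc DIM('a)"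
proof -
  define z where "z = (w - x) /\<^sub>R t"
  have 1: "((\<lambda>w. (w - x) /\<^sub>R t) has_derivative (\<lambda>h. h /\<^sub>R t)) (at w)"
    by (auto intro!: derivative_eq_intros)
  have 2: "((\<lambda>w. k ((w - x) /\<^sub>R t)) has_derivative (\<lambda>h. k' (h /\<^sub>R t) z)) (at w)"
    using has_derivative_compose[OF 1 k'] by (simp add: z_def)
  have "((\<lambda>w. (((w - x) /\<^sub>R t) \<bullet> i) * k ((w - x) /\<^sub>R t) / t ^ DIM('a)) has_derivative
     (\<lambda>h. ((z \<bullet> i) * k' (h /\<^sub>R t) z + ((h /\<^sub>R t) \<bullet> i) * k z) / t ^ DIM('a))) (at w)"
    using has_derivative_mult_left[OF has_derivative_mult[OF has_derivative_inner_left[OF 1, of i] 2], of "inverse (t ^ DIM('a))"]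
    by (simp only: divide_inverse[symmetric] z_def)
  from fun_cong[OF frechet_derivative_at[OF this], of i]
  have "frechet_derivative (\<lambda>w. (((w - x) /\<^sub>R t) \<bullet> i) * k ((w - x) /\<^sub>R t) / t ^ DIM('a)) (at w) i =
     ((z \<bullet> i) * k' (i /\<^sub>R t) z + ((i /\<^sub>R t) \<bullet> i) * k z) / t ^ DIM('a)" by (rule sym)
  also have "k' (i /\<^sub>R t) z = k' i z / t"
  proof -
    interpret linear "\<lambda>h. k' h z" using k' by (rule has_derivative_linear)
    show ?thesis unfolding scale by (simp add: divide_inverse mult.commute)
  qed
  also have "((z \<bullet> i) * (k' i z / t) + ((i /\<^sub>R t) \<bullet> i) * k z) / t ^ DIM('a) = (k z + (z \<bullet> i) * k' i z) / t ^ Suc DIM('a)"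
    using i t by (simp add: field_simps)
  finally show ?thesis by (simp only: z_def)
qed

text \<open>Differentiation under the integral produces minus the divergence of the vector field \<open>z k z / t ^ n\<close>, whose
  components are test functions. The definition of the weak gradient moves the derivatives to \<open>f\<close>. The closed ball
  has radius \<open>2 d\<close> so that \<open>t = 1\<close> is an interior point of the range of parameters.\<close>

lemma dilated_average_has_field_derivative:
  fixes f :: "'a::euclidean_space \<Rightarrow> real" and v :: "'a \<Rightarrow> 'a"
  assumes \<Omega>: "open \<Omega>" and fv: "has_weak_gradient \<Omega> f v"
    and k: "k \<in> bumps_at b R" and R: "0 < R" and d: "norm b + R \<le> d" and sub: "cball x (2 * d) \<subseteq> \<Omega>"
    and t: "t \<in> {0<..<2}"
  shows "((\<lambda>t. LINT w|lebesgue. f w * (k ((w - x) /\<^sub>R t) / t ^ DIM('a))) has_field_derivative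
     (LINT w|lebesgue. (v w \<bullet> ((w - x) /\<^sub>R t)) * k ((w - x) /\<^sub>R t) / t ^ DIM('a))) (at t)"
proof -
  have d0: "0 < d" using R d norm_ge_zero[of b] by linarith
  have lf: "locally_integrable_on \<Omega> f" and lv: "locally_integrable_on \<Omega> v"
    using fv unfolding has_weak_gradient_def by auto
  have test: "test_function \<Omega> (\<lambda>w. g ((w - x) /\<^sub>R \<tau>) / \<tau> ^ DIM('a))"
    if g: "g \<in> bumps_at b R" and \<tau>: "\<tau> \<in> {0<..<2}" for g \<tau>
  proof -
    have "cball (x + \<tau> *\<^sub>R b) (\<tau> * R) \<subseteq> cball x (2 * d)"
    proof
      fix w assume "w \<in> cball (x + \<tau> *\<^sub>R b) (\<tau> * R)"
      then have "norm (x + \<tau> *\<^sub>R b - w) \<le> \<tau> * R" by (simp add: dist_norm)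
      moreover have "norm (x - w) \<le> norm (x + \<tau> *\<^sub>R b - w) + norm (\<tau> *\<^sub>R b)"
        using norm_triangle_ineq4[of "x + \<tau> *\<^sub>R b - w" "\<tau> *\<^sub>R b"] by simp
      moreover have "norm (\<tau> *\<^sub>R b) = \<tau> * norm b" using \<tau> by simp
      ultimately have "norm (x - w) \<le> \<tau> * (norm b + R)" unfolding distrib_left by linarith
      also have "\<dots> \<le> 2 * d" using \<tau> d d0 R by (intro mult_mono) auto
      finally show "w \<in> cball x (2 * d)" by (simp add: dist_norm)
    qed
    then have "test_function \<Omega> (\<lambda>w. g ((w - x) /\<^sub>R \<tau>))"
      using sub R \<tau> by (intro test_function_bumps_at[OF bumps_at_rescale[OF g]]) auto
    from test_function_cmult[OF this, of "inverse (\<tau> ^ DIM('a))"] show ?thesis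
      by (simp add: divide_inverse mult.commute)
  qed
  obtain k' where k': "\<And>w. (k has_derivative (\<lambda>h. k' h w)) (at w)" "\<And>h. k' h \<in> bumps_at b R"
    using bumps_at_has_derivative[OF k R] by blast
  define B where "B z = real DIM('a) * k z + (\<Sum>i\<in>Basis. (z \<bullet> i) * k' i z)" for z
  have B: "B \<in> bumps_at b R"
    unfolding B_def
    by (intro bumps_at_add bumps_at_sum bumps_at_scale bumps_at_coord k k' R) auto
  obtain A where A: "\<And>z. \<bar>B z\<bar> \<le> A" using bumps_at_bounded[OF B] by blast
  have zero: "g ((w - x) /\<^sub>R \<tau>) = 0" if g: "g \<in> bumps_at b R" and \<tau>: "\<tau> \<in> {0<..<2}" and w: "w \<notin> ball x (2 * d)" for g w \<tau>
  proof (rule bumps_at_eq_0[OF g R])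
    have nw: "norm ((w - x) /\<^sub>R \<tau>) = norm (w - x) / \<tau>" using \<tau> by (simp add: divide_inverse)
    have "2 * d \<le> norm (w - x)" using w by (simp add: dist_norm norm_minus_commute)
    moreover have "\<tau> * d \<le> 2 * d" using \<tau> d0 by simp
    ultimately have "d \<le> norm ((w - x) /\<^sub>R \<tau>)" unfolding nw using \<tau> by (simp add: pos_le_divide_eq mult.commute)
    then show "R \<le> norm ((w - x) /\<^sub>R \<tau> - b)"
      using norm_triangle_ineq2[of "(w - x) /\<^sub>R \<tau>" b] d by linarith
  qed
  \<comment> \<open>The dominating function takes the worst case \<open>\<tau> = t / 2\<close> of the interval used below.\<close>
  define H where "H w = A / (t / 2) ^ Suc DIM('a) * \<bar>indicator (ball x (2 * d)) w * f w\<bar>" for w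
  have H: "integrable lebesgue H"
    unfolding H_def by (intro integrable_mult_right integrable_abs locally_integrable_on_ball[OF lf sub])
  have "((\<lambda>t. LINT w|lebesgue. f w * (k ((w - x) /\<^sub>R t) / t ^ DIM('a))) has_field_derivative
     (LINT w|lebesgue. f w * (- B ((w - x) /\<^sub>R t) / t ^ Suc DIM('a)))) (at t)"
  proof (rule has_field_derivative_integral_dominated[of "{t/2<..<2}" _ _ _ "\<lambda>t w. f w * (- B ((w - x) /\<^sub>R t) / t ^ Suc DIM('a))" H])
    show "t \<in> {t/2<..<2}" using t by auto
    show "integrable lebesgue (\<lambda>w. f w * (k ((w - x) /\<^sub>R \<tau>) / \<tau> ^ DIM('a)))" if "\<tau> \<in> {t/2<..<2}" for \<tau>
      using that t by (intro integrable_times_test_function(1)[OF lf test] k) auto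
    show "((\<lambda>\<tau>. f w * (k ((w - x) /\<^sub>R \<tau>) / \<tau> ^ DIM('a))) has_field_derivative f w * (- B ((w - x) /\<^sub>R \<tau>) / \<tau> ^ Suc DIM('a))) (at \<tau>)"
      if "\<tau> \<in> {t/2<..<2}" for \<tau> w
      unfolding B_def using that t
      by (intro DERIV_cmult bumps_at_dilated_has_field_derivative k'(1)) auto
    show "\<bar>f w * (- B ((w - x) /\<^sub>R \<tau>) / \<tau> ^ Suc DIM('a))\<bar> \<le> H w" if \<tau>: "\<tau> \<in> {t/2<..<2}" for \<tau> w
    proof (cases "w \<in> ball x (2 * d)")
      case True
      have "(t/2) ^ Suc DIM('a) \<le> \<tau> ^ Suc DIM('a)" using \<tau> t by (intro power_mono) auto
      then have "\<bar>B ((w - x) /\<^sub>R \<tau>)\<bar> / \<tau> ^ Suc DIM('a) \<le> A / (t / 2) ^ Suc DIM('a)"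
        using A t by (intro frac_le) (auto intro: order_trans[OF abs_ge_zero A])
      then have "\<bar>f w\<bar> * (\<bar>B ((w - x) /\<^sub>R \<tau>)\<bar> / \<tau> ^ Suc DIM('a)) \<le> \<bar>f w\<bar> * (A / (t / 2) ^ Suc DIM('a))"
        by (rule mult_left_mono) simp
      then show ?thesis using True \<tau> t by (simp add: H_def abs_mult mult.commute)
    next
      case False
      then show ?thesis using zero[OF B, of \<tau> w] \<tau> t by (simp add: H_def)
    qed
    show "integrable lebesgue H" by (rule H)
    have "integrable lebesgue (\<lambda>w. f w * (B ((w - x) /\<^sub>R t) / t ^ DIM('a)))"
      using t by (intro integrable_times_test_function(1)[OF lf test] B) auto
    then have "integrable lebesgue (\<lambda>w. - inverse t * (f w * (B ((w - x) /\<^sub>R t) / t ^ DIM('a))))"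
      by (rule integrable_mult_right)
    then have "(\<lambda>w. - inverse t * (f w * (B ((w - x) /\<^sub>R t) / t ^ DIM('a)))) \<in> borel_measurable lebesgue"
      by (rule borel_measurable_integrable)
    then show "(\<lambda>w. f w * (- B ((w - x) /\<^sub>R t) / t ^ Suc DIM('a))) \<in> borel_measurable lebesgue"
      by (simp add: divide_inverse mult_ac)
  qed auto
  moreover have "(LINT w|lebesgue. f w * (- B ((w - x) /\<^sub>R t) / t ^ Suc DIM('a)))
     = (LINT w|lebesgue. (v w \<bullet> ((w - x) /\<^sub>R t)) * k ((w - x) /\<^sub>R t) / t ^ DIM('a))"
  proof -
    define \<psi> where "\<psi> i w = (((w - x) /\<^sub>R t) \<bullet> i) * k ((w - x) /\<^sub>R t) / t ^ DIM('a)" for i w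
    have \<psi>: "test_function \<Omega> (\<psi> i)" for i
      unfolding \<psi>_def[abs_def] by (rule test[OF bumps_at_coord[OF k R] t])
    have "(LINT w|lebesgue. f w * (- B ((w - x) /\<^sub>R t) / t ^ Suc DIM('a)))
       = (LINT w|lebesgue. (\<Sum>i\<in>Basis. - (f w * frechet_derivative (\<psi> i) (at w) i)))"
    proof (rule Bochner_Integration.integral_cong[OF refl])
      fix w
      have "(\<Sum>i\<in>Basis. - (f w * frechet_derivative (\<psi> i) (at w) i)) =
         (\<Sum>i\<in>Basis. - (f w * ((k ((w - x) /\<^sub>R t) + (((w - x) /\<^sub>R t) \<bullet> i) * k' i ((w - x) /\<^sub>R t)) / t ^ Suc DIM('a))))"
        unfolding \<psi>_def using t by (intro sum.cong refl) (simp only: dilated_divergence[OF k'(1)] greaterThanLessThan_iff)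
      also have "\<dots> = - (f w * ((\<Sum>i\<in>Basis. k ((w - x) /\<^sub>R t) + (((w - x) /\<^sub>R t) \<bullet> i) * k' i ((w - x) /\<^sub>R t)) / t ^ Suc DIM('a)))"
        by (simp only: sum_negf sum_distrib_left sum_divide_distrib)
      also have "(\<Sum>i\<in>Basis. k ((w - x) /\<^sub>R t) + (((w - x) /\<^sub>R t) \<bullet> i) * k' i ((w - x) /\<^sub>R t)) = B ((w - x) /\<^sub>R t)"
        by (simp only: B_def sum.distrib sum_constant)
      finally show "f w * (- B ((w - x) /\<^sub>R t) / t ^ Suc DIM('a)) = (\<Sum>i\<in>Basis. - (f w * frechet_derivative (\<psi> i) (at w) i))"
        by simp
    qed
    also have "\<dots> = (\<Sum>i\<in>Basis. - (LINT w|lebesgue. f w * frechet_derivative (\<psi> i) (at w) i))"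
      using integrable_times_test_function(3)[OF lf \<psi>]
      by (subst Bochner_Integration.integral_sum) auto
    also have "\<dots> = (\<Sum>i\<in>Basis. (LINT w|lebesgue. (v w \<bullet> i) * \<psi> i w))"
      using has_weak_gradient_test[OF \<Omega> fv \<psi>] by simp
    also have "\<dots> = (LINT w|lebesgue. (\<Sum>i\<in>Basis. (v w \<bullet> i) * \<psi> i w))"
      using integrable_times_test_function(1)[OF locally_integrable_on_inner[OF lv] \<psi>]
      by (subst Bochner_Integration.integral_sum) auto
    also have "\<dots> = (LINT w|lebesgue. (v w \<bullet> ((w - x) /\<^sub>R t)) * k ((w - x) /\<^sub>R t) / t ^ DIM('a))"
    proof (rule Bochner_Integration.integral_cong[OF refl])
      fix w
      have "(\<Sum>i\<in>Basis. (v w \<bullet> i) * \<psi> i w) = (\<Sum>i\<in>Basis. (v w \<bullet> i) * (((w - x) /\<^sub>R t) \<bullet> i)) * (k ((w - x) /\<^sub>R t) / t ^ DIM('a))"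
        unfolding \<psi>_def sum_distrib_right by (intro sum.cong) (auto simp: mult_ac)
      then show "(\<Sum>i\<in>Basis. (v w \<bullet> i) * \<psi> i w) = (v w \<bullet> ((w - x) /\<^sub>R t)) * k ((w - x) /\<^sub>R t) / t ^ DIM('a)"
        by (simp only: euclidean_inner[symmetric] times_divide_eq_right)
    qed
    finally show ?thesis .
  qed
  ultimately show ?thesis by simp
qed

section \<open>From the weak gradient to the pointwise estimate\<close>

text \<open>On the support of the dilated kernel \<open>|w - x| / t < d\<close>, and the support is contained in the ball of radius
  \<open>t d\<close> around \<open>x\<close>. So the derivative of the average in \<open>t\<close> is at most
  \<open>d A / t ^ n\<close> times the integral of \<open>|v|\<close> over that ball, and the powers of \<open>t\<close> cancel. The mean value
  theorem on the interval from \<open>t\<close> to 1 and the limit \<open>t \<rightarrow> 0\<close> finish the proof.\<close>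

lemma average_dist_le_hl_max:
  fixes f :: "'a::euclidean_space \<Rightarrow> real" and v :: "'a \<Rightarrow> 'a"
  assumes \<Omega>: "open \<Omega>" and fv: "has_weak_gradient \<Omega> f v"
    and k: "k \<in> bumps_at b R" and R: "0 < R" and d: "norm b + R \<le> d" and sub: "cball x (2 * d) \<subseteq> \<Omega>"
    and x: "lebesgue_point f x" and A: "\<And>z. \<bar>k z\<bar> \<le> A" and k1: "(LINT z|lebesgue. k z) = 1"
    and h[measurable]: "(\<lambda>w. indicator \<Omega> w * norm (v w)) \<in> borel_measurable lebesgue"
    and m: "hl_max (\<lambda>w. ennreal (indicator \<Omega> w * norm (v w))) x \<le> ennreal m" and m0: "0 \<le> m"
  shows "\<bar>f x - (LINT w|lebesgue. f w * k (w - x))\<bar> \<le> d * A * d ^ DIM('a) * m"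
proof -
  have d0: "0 < d" using R d norm_ge_zero[of b] by linarith
  have A0: "0 \<le> A" using A[of 0] by linarith
  define F where "F t = (LINT w|lebesgue. f w * (k ((w - x) /\<^sub>R t) / t ^ DIM('a)))" for t
  define F' where "F' t = (LINT w|lebesgue. (v w \<bullet> ((w - x) /\<^sub>R t)) * k ((w - x) /\<^sub>R t) / t ^ DIM('a))" for t
  define L where "L = d * A * d ^ DIM('a) * m"
  have kz: "k z = 0" if "d \<le> norm z" for z
  proof (rule bumps_at_eq_0[OF k R])
    show "R \<le> norm (z - b)" using norm_triangle_ineq2[of z b] d that by linarith
  qed
  have F: "(F has_field_derivative F' t) (at t)" if "t \<in> {0<..<2}" for t
    unfolding F_def[abs_def] F'_def
    by (rule dilated_average_has_field_derivative[OF \<Omega> fv k R d sub that])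
  have F': "norm (F' t) \<le> L" if t: "t \<in> {0<..<2}" for t
  \<comment> \<open>If the integrand were not integrable, the integral would be 0 by convention and the bound trivial.\<close>
  proof (cases "integrable lebesgue (\<lambda>w. (v w \<bullet> ((w - x) /\<^sub>R t)) * k ((w - x) /\<^sub>R t) / t ^ DIM('a))")
    case False
    show ?thesis unfolding F'_def not_integrable_integral_eq[OF False] using d0 A0 m0 by (simp add: L_def)
  next
    case True
    have "ennreal (norm (F' t)) \<le> (\<integral>\<^sup>+w. norm ((v w \<bullet> ((w - x) /\<^sub>R t)) * k ((w - x) /\<^sub>R t) / t ^ DIM('a)) \<partial>lebesgue)"
      unfolding F'_def by (rule integral_norm_bound_ennreal[OF True])
    also have "\<dots> \<le> (\<integral>\<^sup>+w. ennreal (d * A / t ^ DIM('a)) * (ennreal (indicator \<Omega> w * norm (v w)) * indicator (ball x (t * d)) w) \<partial>lebesgue)"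
    proof (rule nn_integral_mono)
      fix w
      define z where "z = (w - x) /\<^sub>R t"
      have nz: "norm z = norm (w - x) / t" using t by (simp add: z_def divide_inverse)
      show "ennreal (norm ((v w \<bullet> ((w - x) /\<^sub>R t)) * k ((w - x) /\<^sub>R t) / t ^ DIM('a)))
        \<le> ennreal (d * A / t ^ DIM('a)) * (ennreal (indicator \<Omega> w * norm (v w)) * indicator (ball x (t * d)) w)"
      proof (cases "norm z < d")
        case True
        then have nw: "norm (w - x) < t * d" using t by (simp add: nz pos_divide_less_eq mult.commute)
        then have wb: "w \<in> ball x (t * d)" by (simp add: dist_norm norm_minus_commute)
        have "t * d \<le> 2 * d" using t d0 by simp
        then have "w \<in> cball x (2 * d)" using nw by (simp add: dist_norm norm_minus_commute)
        then have w\<Omega>: "w \<in> \<Omega>" using sub by blast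
        have "\<bar>v w \<bullet> z\<bar> * \<bar>k z\<bar> \<le> (norm (v w) * d) * A"
          using Cauchy_Schwarz_ineq2[of "v w" z] True A[of z]
          by (intro mult_mono order_trans[OF Cauchy_Schwarz_ineq2] mult_left_mono) (auto simp: d0 less_imp_le)
        then have "\<bar>v w \<bullet> z\<bar> * \<bar>k z\<bar> / t ^ DIM('a) \<le> (norm (v w) * d) * A / t ^ DIM('a)"
          using t by (intro divide_right_mono) auto
        then have "norm ((v w \<bullet> z) * k z / t ^ DIM('a)) \<le> d * A / t ^ DIM('a) * norm (v w)"
          using t by (simp add: abs_mult mult_ac)
        then have "ennreal (norm ((v w \<bullet> z) * k z / t ^ DIM('a))) \<le> ennreal (d * A / t ^ DIM('a)) * ennreal (norm (v w))"
          using t d0 A0 by (subst ennreal_mult[symmetric]) (auto intro!: ennreal_leI)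
        then show ?thesis using wb w\<Omega> by (simp add: z_def)
      next
        case False
        then have "k z = 0" by (intro kz) simp
        then show ?thesis by (simp add: z_def)
      qed
    qed
    also have "\<dots> = ennreal (d * A / t ^ DIM('a)) * (\<integral>\<^sup>+w\<in>ball x (t * d). ennreal (indicator \<Omega> w * norm (v w)) \<partial>lebesgue)"
    proof (rule nn_integral_cmult)
      have [measurable]: "ball x (t * d) \<in> sets lebesgue" by simp
      show "(\<lambda>w. ennreal (indicator \<Omega> w * norm (v w)) * indicator (ball x (t * d)) w) \<in> borel_measurable lebesgue" by measurable
    qed
    also have "\<dots> \<le> ennreal (d * A / t ^ DIM('a)) * (ennreal ((t * d) ^ DIM('a)) * ennreal m)"
    proof (rule mult_left_mono)
      have "(\<integral>\<^sup>+w\<in>ball x (t * d). ennreal (indicator \<Omega> w * norm (v w)) \<partial>lebesgue)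
        \<le> ennreal ((t * d) ^ DIM('a)) * hl_max (\<lambda>w. ennreal (indicator \<Omega> w * norm (v w))) x"
        using t d0 by (intro nn_integral_ball_le_hl_max) simp
      also have "\<dots> \<le> ennreal ((t * d) ^ DIM('a)) * ennreal m" by (rule mult_left_mono[OF m]) simp
      finally show "(\<integral>\<^sup>+w\<in>ball x (t * d). ennreal (indicator \<Omega> w * norm (v w)) \<partial>lebesgue) \<le> ennreal ((t * d) ^ DIM('a)) * ennreal m" .
    qed simp
    also have "\<dots> = ennreal (d * A / t ^ DIM('a) * ((t * d) ^ DIM('a) * m))"
      using t d0 A0 m0 by (simp add: ennreal_mult'[symmetric])
    also have "d * A / t ^ DIM('a) * ((t * d) ^ DIM('a) * m) = L"
      using t by (simp add: L_def power_mult_distrib)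
    finally have "ennreal (norm (F' t)) \<le> ennreal L" .
    moreover have "0 \<le> L" using d0 A0 m0 by (simp add: L_def)
    ultimately show ?thesis by simp
  qed
  have bound: "\<bar>F t - F 1\<bar> \<le> L" if t: "0 < t" "t < 1" for t
  proof -
    have "norm (F t - F 1) \<le> L * norm (t - 1)"
    proof (rule field_differentiable_bound[of "{0<..<2}"])
      show "(F has_field_derivative F' z) (at z within {0<..<2})" if "z \<in> {0<..<2}" for z
        by (rule has_field_derivative_at_within[OF F[OF that]])
    qed (use t F' in auto)
    also have "\<dots> \<le> L * 1"
      using t d0 A0 m0 by (intro mult_left_mono) (auto simp: L_def)
    finally show ?thesis by simp
  qed
  have lf: "locally_integrable_on \<Omega> f" using fv unfolding has_weak_gradient_def by auto
  have "(F \<longlongrightarrow> f x * (LINT z|lebesgue. k z)) (at_right 0)"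
    unfolding F_def[abs_def]
    by (rule mollification_tendsto[OF x _ locally_integrable_on_ball[OF lf sub] bumps_at_borel[OF k] A d0 kz])
      (use d0 in auto)
  then have "((\<lambda>t. \<bar>F t - F 1\<bar>) \<longlongrightarrow> \<bar>f x - F 1\<bar>) (at_right 0)"
    unfolding k1 by (intro tendsto_intros) simp
  moreover have "\<forall>\<^sub>F t in at_right 0. \<bar>F t - F 1\<bar> \<le> L"
    unfolding eventually_at_right_field using bound by (intro exI[of _ 1]) auto
  ultimately have "\<bar>f x - F 1\<bar> \<le> L"
    by (rule tendsto_upperbound) simp
  then show ?thesis by (simp add: F_def L_def)
qed

text \<open>The constant in the pointwise estimate must be the same for all points, hence a fixed bound for the
  mollifier.\<close>

definition mollifier_bound :: "'a::euclidean_space itself \<Rightarrow> real" where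
  "mollifier_bound _ = (SUP z::'a. \<bar>mollifier z\<bar>)"

lemma abs_mollifier_le: "\<bar>mollifier (z::'a::euclidean_space)\<bar> \<le> mollifier_bound TYPE('a)"
proof -
  obtain A where A: "\<And>z::'a. \<bar>mollifier z\<bar> \<le> A" using bump_functions_bounded[OF mollifier_bump] by blast
  then have "bdd_above (range (\<lambda>z::'a. \<bar>mollifier z\<bar>))" by (intro bdd_aboveI2[of _ _ A])
  then show ?thesis unfolding mollifier_bound_def by (intro cSUP_upper) auto
qed

text \<open>Both \<open>f x\<close> and \<open>f y\<close> are compared with the average of \<open>f\<close> against one bump around the midpoint.\<close>

theorem weak_gradient_pointwise_estimate:
  fixes f :: "'a::euclidean_space \<Rightarrow> real" and v :: "'a \<Rightarrow> 'a"
  assumes \<Omega>: "open \<Omega>" and fv: "has_weak_gradient \<Omega> f v"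
    and h: "(\<lambda>w. indicator \<Omega> w * norm (v w)) \<in> borel_measurable lebesgue"
    and x: "lebesgue_point f x" and y: "lebesgue_point f y"
    and Mx: "hl_max (\<lambda>w. ennreal (indicator \<Omega> w * norm (v w))) x = ennreal mx" "0 \<le> mx"
    and My: "hl_max (\<lambda>w. ennreal (indicator \<Omega> w * norm (v w))) y = ennreal my" "0 \<le> my"
    and sub: "ball x (3 * norm (x - y)) \<subseteq> \<Omega>"
  shows "\<bar>f x - f y\<bar> \<le> 3 ^ Suc DIM('a) * mollifier_bound TYPE('a) * norm (x - y) * (mx + my)"
proof (cases "x = y")
  case False
  define n where "n = DIM('a)"
  define A0 where "A0 = mollifier_bound TYPE('a)"
  have A0: "0 \<le> A0" using abs_mollifier_le[of "0::'a"] unfolding A0_def by linarith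
  define d where "d = norm (x - y)"
  have d: "0 < d" using False by (simp add: d_def)
  define c where "c = midpoint x y"
  \<comment> \<open>The bump around the midpoint reaches points at distance \<open>3/4 d\<close> from \<open>x\<close> and from \<open>y\<close>. Twice this distance,
    measured from \<open>y\<close>, stays within \<open>5/2 d < 3 d\<close> from \<open>x\<close>.\<close>
  define R where "R = d / 4"
  have R: "0 < R" using d by (simp add: R_def)
  define avg where "avg = (LINT w|lebesgue. f w * (mollifier ((w - c) /\<^sub>R R) / R ^ n))"
  have half: "\<bar>f p - avg\<bar> \<le> 3 ^ Suc n * A0 * d * m"
    if p: "lebesgue_point f p" and m: "hl_max (\<lambda>w. ennreal (indicator \<Omega> w * norm (v w))) p = ennreal m" "0 \<le> m"
      and cp: "norm (c - p) = d / 2" and psub: "cball p (2 * (3/4 * d)) \<subseteq> \<Omega>" for p m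
  proof -
    define k where "k z = inverse (R ^ n) * mollifier ((z - (c - p)) /\<^sub>R R)" for z
    have k: "k \<in> bumps_at (c - p) R"
      unfolding k_def[abs_def] by (intro bumps_at_scale bumps_atI mollifier_bump)
    have kA: "\<bar>k z\<bar> \<le> A0 / R ^ n" for z
    proof -
      have "\<bar>mollifier ((z - (c - p)) /\<^sub>R R)\<bar> / R ^ n \<le> A0 / R ^ n"
        using R unfolding A0_def by (intro divide_right_mono abs_mollifier_le) auto
      then show ?thesis using R by (simp add: k_def abs_mult divide_inverse mult.commute)
    qed
    have k1: "(LINT z|lebesgue. k z) = 1"
      using integral_lebesgue_affine(1)[OF bump_functions_borel[OF mollifier_bump] R, of "c - p"] R
      by (simp add: k_def integral_mollifier n_def)
    have "\<bar>f p - (LINT w|lebesgue. f w * k (w - p))\<bar> \<le> (3/4 * d) * (A0 / R ^ n) * (3/4 * d) ^ DIM('a) * m"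
      by (rule average_dist_le_hl_max[OF \<Omega> fv k R _ psub p kA k1 h _ m(2)]) (use m cp in \<open>auto simp: R_def\<close>)
    also have "(LINT w|lebesgue. f w * k (w - p)) = avg"
      unfolding avg_def k_def by (simp add: divide_inverse mult_ac)
    also have "(3/4 * d) * (A0 / R ^ n) * (3/4 * d) ^ DIM('a) * m = 3 ^ Suc n / 4 * A0 * d * m"
    proof -
      have "3/4 * d = 3 * R" by (simp add: R_def)
      then have "(A0 / R ^ n) * (3/4 * d) ^ DIM('a) = A0 * 3 ^ n"
        using R by (simp add: n_def power_mult_distrib)
      then have "(3/4 * d) * ((A0 / R ^ n) * (3/4 * d) ^ DIM('a)) * m = (3/4 * d) * (A0 * 3 ^ n) * m" by (simp only:)
      then show ?thesis by (simp add: mult_ac)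
    qed
    also have "\<dots> \<le> 3 ^ Suc n * A0 * d * m"
      using A0 d m(2) by (simp add: field_simps)
    finally show ?thesis .
  qed
  have c: "norm (c - x) = d / 2" "norm (c - y) = d / 2"
    using dist_midpoint(3,4)[of x y] unfolding c_def d_def dist_norm by simp_all
  have "cball x (2 * (3/4 * d)) \<subseteq> \<Omega>"
    using sub d by (auto simp: d_def[symmetric] subset_iff)
  moreover have "cball y (2 * (3/4 * d)) \<subseteq> \<Omega>"
  proof
    fix w assume "w \<in> cball y (2 * (3/4 * d))"
    then have "dist x w < 3 * d"
      using dist_triangle[of x w y] d by (simp add: d_def[symmetric] dist_norm[of x y])
    then show "w \<in> \<Omega>" using sub by (auto simp: d_def)
  qed
  ultimately have "\<bar>f x - avg\<bar> \<le> 3 ^ Suc n * A0 * d * mx" "\<bar>f y - avg\<bar> \<le> 3 ^ Suc n * A0 * d * my"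
    using half[OF x Mx c(1)] half[OF y My c(2)] by auto
  then have "\<bar>f x - f y\<bar> \<le> 3 ^ Suc n * A0 * d * mx + 3 ^ Suc n * A0 * d * my" by linarith
  also have "\<dots> = 3 ^ Suc n * A0 * d * (mx + my)" by (simp only: distrib_left)
  finally show ?thesis by (simp only: n_def A0_def d_def)
qed simp

section \<open>Functionals dominated by a weighted integral\<close>

lemma locally_integrable_on_of_integrable:
  fixes u :: "'a::euclidean_space \<Rightarrow> real"
  assumes "integrable lebesgue u"
  shows "locally_integrable_on \<Omega> u"
  unfolding locally_integrable_on_def
proof (intro allI impI)
  fix K assume "compact K \<and> K \<subseteq> \<Omega>"
  then have K: "K \<in> sets lebesgue" by (simp add: compact_imp_closed borel_closed)
  then have "integrable lebesgue (\<lambda>x. indicator K x *\<^sub>R u x)"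
    using assms by (rule integrable_mult_indicator)
  then show "integrable (lebesgue_on K) u" using K by (simp add: integrable_restrict_space)
qed

lemma integrable_times_test_functions:
  assumes "locally_integrable_on \<Omega> W" "test_function \<Omega> \<phi>" "test_function \<Omega> \<psi>"
  shows "integrable lebesgue (\<lambda>x. W x * (\<phi> x * \<psi> x))"
proof -
  obtain K where K: "compact K" "K \<subseteq> \<Omega>" "\<And>x. x \<notin> K \<Longrightarrow> \<phi> x = 0"
    using test_function_support[OF assms(2)] by metis
  show ?thesis
    using K(3) test_function_continuous_on assms(2,3)
    by (intro integrable_times_continuous[OF assms(1) K(1,2)] continuous_on_mult) auto
qed

lemma test_function_bounded:
  assumes "test_function \<Omega> \<phi>"
  obtains B where "0 \<le> B" "\<And>x. \<bar>\<phi> x\<bar> \<le> B"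
proof -
  obtain K where K: "compact K" "\<And>x. x \<notin> K \<Longrightarrow> \<phi> x = 0"
    using test_function_support[OF assms] by metis
  show thesis by (rule bounded_of_compact_support[OF K(1) test_function_continuous_on[OF assms] K(2)]) (assumption, rule that)
qed

lemma test_function_derivative_bounded:
  assumes "test_function \<Omega> \<phi>" "i \<in> Basis"
  obtains B where "0 \<le> B" "\<And>x. \<bar>frechet_derivative \<phi> (at x) i\<bar> \<le> B"
proof -
  obtain K where K: "compact K" "\<And>x i. x \<notin> K \<Longrightarrow> frechet_derivative \<phi> (at x) i = 0"
    using test_function_support[OF assms(1)] by metis
  show thesis
    by (rule bounded_of_compact_support[OF K(1) test_function_derivative_continuous_on[OF assms] K(2)]) (assumption, rule that)
qed

lemma AE_summable_of_summable_integral: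
  fixes f :: "nat \<Rightarrow> 'a \<Rightarrow> real"
  assumes int: "\<And>i. integrable M (f i)" and sum: "summable (\<lambda>i. \<integral>x. \<bar>f i x\<bar> \<partial>M)"
  shows "AE x in M. summable (\<lambda>i. \<bar>f i x\<bar>)"
proof -
  have [measurable]: "f i \<in> borel_measurable M" for i using int by auto
  have "(\<integral>\<^sup>+x. (\<Sum>i. ennreal \<bar>f i x\<bar>) \<partial>M) = (\<Sum>i. \<integral>\<^sup>+x. ennreal \<bar>f i x\<bar> \<partial>M)"
    by (rule nn_integral_suminf) measurable
  also have "\<dots> = (\<Sum>i. ennreal (\<integral>x. \<bar>f i x\<bar> \<partial>M))"
    using int by (intro suminf_cong nn_integral_eq_integral) auto
  also have "\<dots> \<noteq> \<infinity>"
    using sum by (simp add: ennreal_suminf_neq_top integral_nonneg)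
  finally have "AE x in M. (\<Sum>i. ennreal \<bar>f i x\<bar>) \<noteq> \<infinity>"
    by (intro nn_integral_PInf_AE) measurable
  then show ?thesis by (rule eventually_mono) (auto intro: summable_suminf_not_top)
qed

text \<open>The functional \<open>J \<phi> = \<integral> W \<phi>\<^sup>2 - 2 T \<phi>\<close> is bounded below because of the bound on \<open>T\<close>. Almost
  minimizers are close to each other in the weighted \<open>L\<^sup>2\<close> norm, since the midpoint of two of them cannot do
  much better (parallelogram law), and the variation of \<open>J\<close> in any direction \<open>\<psi>\<close> is almost nonnegative. The rate
  \<open>(1/4) ^ k\<close> makes the square roots of the distances summable.\<close>

lemma test_functional_almost_minimizers:
  fixes T :: "('a::euclidean_space \<Rightarrow> real) \<Rightarrow> real" and W :: "'a \<Rightarrow> real"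
  assumes W: "integrable lebesgue W" and W0: "\<And>x. 0 \<le> W x"
    and T_add: "\<And>\<phi> \<psi>. test_function \<Omega> \<phi> \<Longrightarrow> test_function \<Omega> \<psi> \<Longrightarrow> T (\<lambda>x. \<phi> x + \<psi> x) = T \<phi> + T \<psi>"
    and T_scale: "\<And>\<phi> c. test_function \<Omega> \<phi> \<Longrightarrow> T (\<lambda>x. c * \<phi> x) = c * T \<phi>"
    and T_le: "\<And>\<phi>. test_function \<Omega> \<phi> \<Longrightarrow> \<bar>T \<phi>\<bar> \<le> (LINT x|lebesgue. W x * \<bar>\<phi> x\<bar>)"
  obtains \<phi> :: "nat \<Rightarrow> 'a \<Rightarrow> real" where "\<And>k. test_function \<Omega> (\<phi> k)"
    "\<And>k. (LINT x|lebesgue. W x * (\<phi> (Suc k) x - \<phi> k x)\<^sup>2) \<le> 4 * (1/4) ^ k"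
    "\<And>k s \<psi>. test_function \<Omega> \<psi> \<Longrightarrow>
       - ((1/4) ^ k) \<le> 2 * s * ((LINT x|lebesgue. W x * (\<phi> k x * \<psi> x)) - T \<psi>) + s\<^sup>2 * (LINT x|lebesgue. W x * (\<psi> x * \<psi> x))"
proof -
  have lW: "locally_integrable_on \<Omega> W" by (rule locally_integrable_on_of_integrable[OF W])
  define ip where "ip \<phi> \<psi> = (LINT x|lebesgue. W x * (\<phi> x * \<psi> x))" for \<phi> \<psi> :: "'a \<Rightarrow> real"
  note int = integrable_times_test_functions[OF lW]
  have ip_add: "ip (\<lambda>x. \<phi> x + s * \<psi> x) (\<lambda>x. \<phi> x + s * \<psi> x) = ip \<phi> \<phi> + 2 * s * ip \<phi> \<psi> + s\<^sup>2 * ip \<psi> \<psi>"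
    if t: "test_function \<Omega> \<phi>" "test_function \<Omega> \<psi>" for \<phi> \<psi> s
  proof -
    have "ip (\<lambda>x. \<phi> x + s * \<psi> x) (\<lambda>x. \<phi> x + s * \<psi> x)
       = (LINT x|lebesgue. W x * (\<phi> x * \<phi> x) + 2 * s * (W x * (\<phi> x * \<psi> x)) + s\<^sup>2 * (W x * (\<psi> x * \<psi> x)))"
      unfolding ip_def by (intro Bochner_Integration.integral_cong refl) (simp add: algebra_simps power2_eq_square)
    also have "\<dots> = ip \<phi> \<phi> + 2 * s * ip \<phi> \<psi> + s\<^sup>2 * ip \<psi> \<psi>"
      unfolding ip_def using int[OF t(1) t(1)] int[OF t] int[OF t(2) t(2)] by simp
    finally show ?thesis .
  qed
  define J where "J \<phi> = ip \<phi> \<phi> - 2 * T \<phi>" for \<phi>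
  have J_add: "J (\<lambda>x. \<phi> x + s * \<psi> x) = J \<phi> + 2 * s * (ip \<phi> \<psi> - T \<psi>) + s\<^sup>2 * ip \<psi> \<psi>"
    if t: "test_function \<Omega> \<phi>" "test_function \<Omega> \<psi>" for \<phi> \<psi> s
    unfolding J_def ip_add[OF t] using T_add[OF t(1) test_function_cmult[OF t(2)]] T_scale[OF t(2)]
    by (simp add: algebra_simps)
  define I where "I = Inf (J ` {\<phi>. test_function \<Omega> \<phi>})"
  define IW where "IW = (LINT x|lebesgue. W x)"
  have bdd: "bdd_below (J ` {\<phi>. test_function \<Omega> \<phi>})"
  proof (rule bdd_belowI2)
    fix \<phi> assume "\<phi> \<in> {\<phi>. test_function \<Omega> \<phi>}"
    then have t: "test_function \<Omega> \<phi>" by simp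
    have "(LINT x|lebesgue. W x * \<bar>\<phi> x\<bar>) \<le> (LINT x|lebesgue. (W x + W x * (\<phi> x * \<phi> x)) / 2)"
    proof (rule integral_mono)
      show "integrable lebesgue (\<lambda>x. W x * \<bar>\<phi> x\<bar>)" by (rule integrable_times_test_function(2)[OF lW t])
      show "integrable lebesgue (\<lambda>x. (W x + W x * (\<phi> x * \<phi> x)) / 2)" using int[OF t t] W by simp
      fix x
      \<comment> \<open>\<open>|\<phi>| \<le> (1 + \<phi>\<^sup>2) / 2\<close>\<close>
      have "0 \<le> W x * (1 - \<bar>\<phi> x\<bar>)\<^sup>2" using W0 by simp
      also have "\<dots> = W x + W x * (\<phi> x * \<phi> x) - 2 * (W x * \<bar>\<phi> x\<bar>)"
        by (simp add: power2_eq_square algebra_simps abs_mult_self_eq)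
      finally show "W x * \<bar>\<phi> x\<bar> \<le> (W x + W x * (\<phi> x * \<phi> x)) / 2" by simp
    qed
    also have "\<dots> = (IW + ip \<phi> \<phi>) / 2"
      unfolding ip_def IW_def using int[OF t t] W by simp
    finally have "T \<phi> \<le> (IW + ip \<phi> \<phi>) / 2"
      using T_le[OF t] by (meson abs_ge_self order_trans)
    then show "- IW \<le> J \<phi>" by (simp add: J_def field_simps)
  qed
  have I_le: "I \<le> J \<phi>" if "test_function \<Omega> \<phi>" for \<phi>
    unfolding I_def by (rule cInf_lower[OF _ bdd]) (use that in simp)
  have zero: "test_function \<Omega> (\<lambda>x. 0)"
  proof -
    have "Ck k (\<lambda>x::'a. 0)" for k by (induction k) (auto simp: frechet_derivative_const)
    then show ?thesis by (simp add: test_function_def)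
  qed
  have "\<exists>\<phi>. test_function \<Omega> \<phi> \<and> J \<phi> < I + (1/4) ^ k" for k :: nat
  proof -
    have ne: "J ` {\<phi>. test_function \<Omega> \<phi>} \<noteq> {}" using zero by blast
    have "Inf (J ` {\<phi>. test_function \<Omega> \<phi>}) < I + (1/4) ^ k" by (simp add: I_def)
    from cInf_lessD[OF ne this] show ?thesis by auto
  qed
  then have "\<forall>k. \<exists>\<phi>. test_function \<Omega> \<phi> \<and> J \<phi> < I + (1/4) ^ k" by blast
  from choice[OF this] obtain \<phi> where "\<forall>k. test_function \<Omega> (\<phi> k) \<and> J (\<phi> k) < I + (1/4) ^ k" ..
  then have \<phi>: "\<And>k. test_function \<Omega> (\<phi> k)" "\<And>k. J (\<phi> k) < I + (1/4) ^ k" by auto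
  show thesis
  proof (rule that[of \<phi>])
    show "test_function \<Omega> (\<phi> k)" for k by (rule \<phi>)
    show "- ((1/4) ^ k) \<le> 2 * s * ((LINT x|lebesgue. W x * (\<phi> k x * \<psi> x)) - T \<psi>) + s\<^sup>2 * (LINT x|lebesgue. W x * (\<psi> x * \<psi> x))"
      if \<psi>: "test_function \<Omega> \<psi>" for k s \<psi>
    proof -
      have "I \<le> J (\<lambda>x. \<phi> k x + s * \<psi> x)"
        by (intro I_le test_function_add test_function_cmult \<phi> \<psi>)
      then show ?thesis using J_add[OF \<phi>(1) \<psi>, of k s] \<phi>(2)[of k] unfolding ip_def by linarith
    qed
    show "(LINT x|lebesgue. W x * (\<phi> (Suc k) x - \<phi> k x)\<^sup>2) \<le> 4 * (1/4) ^ k" for k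
    proof -
      \<comment> \<open>The inequality \<open>I \<le> J\<close> at the midpoint of \<open>\<phi> k\<close> and \<open>\<phi> (Suc k)\<close> bounds the norm of their difference.\<close>
      define \<delta> where "\<delta> x = \<phi> (Suc k) x + (-1) * \<phi> k x" for x
      have \<delta>: "test_function \<Omega> \<delta>"
        unfolding \<delta>_def[abs_def] by (intro test_function_add test_function_cmult \<phi>)
      have "I \<le> J (\<lambda>x. \<phi> k x + (1/2) * \<delta> x)"
        by (intro I_le test_function_add test_function_cmult \<phi> \<delta>)
      also have "\<dots> = J (\<phi> k) + (ip (\<phi> k) \<delta> - T \<delta>) + ip \<delta> \<delta> / 4"
        by (subst J_add[OF \<phi>(1) \<delta>]) (simp add: power2_eq_square)
      finally have 1: "I \<le> J (\<phi> k) + (ip (\<phi> k) \<delta> - T \<delta>) + ip \<delta> \<delta> / 4" .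
      have "\<phi> (Suc k) = (\<lambda>x. \<phi> k x + 1 * \<delta> x)" by (simp add: \<delta>_def)
      then have "J (\<phi> (Suc k)) = J (\<lambda>x. \<phi> k x + 1 * \<delta> x)" by simp
      also have "\<dots> = J (\<phi> k) + 2 * (ip (\<phi> k) \<delta> - T \<delta>) + ip \<delta> \<delta>"
        by (subst J_add[OF \<phi>(1) \<delta>]) simp
      finally have 2: "J (\<phi> (Suc k)) = J (\<phi> k) + 2 * (ip (\<phi> k) \<delta> - T \<delta>) + ip \<delta> \<delta>" .
      have "ip \<delta> \<delta> \<le> 2 * (J (\<phi> (Suc k)) - I) + 2 * (J (\<phi> k) - I)" using 1 2 by argo
      also have "\<dots> \<le> 2 * (1/4) ^ Suc k + 2 * (1/4) ^ k" using \<phi>(2)[of k] \<phi>(2)[of "Suc k"] by argo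
      also have "\<dots> \<le> 4 * (1/4) ^ k" by simp
      finally show ?thesis by (simp add: ip_def \<delta>_def power2_eq_square)
    qed
  qed
qed

lemma eq_0_of_quadratic_nonneg:
  fixes a N :: real
  assumes "\<And>s. 0 \<le> 2 * s * a + s\<^sup>2 * N" "0 \<le> N"
  shows "a = 0"
proof -
  \<comment> \<open>Close to the minimum of the parabola; the shift by 1 avoids a division by 0.\<close>
  have "0 \<le> 2 * (- a / (N + 1)) * a + (- a / (N + 1))\<^sup>2 * N" by (rule assms(1))
  also have "\<dots> = - (a\<^sup>2 * (N + 2)) / (N + 1)\<^sup>2"
    using assms(2) by (simp add: divide_simps power2_eq_square) (simp add: algebra_simps)
  finally have "a\<^sup>2 * (N + 2) \<le> 0" using assms(2) by (auto simp: divide_le_0_iff)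
  then show ?thesis using assms(2) by (smt (verit) mult_pos_pos zero_less_power2)
qed

text \<open>The almost minimizers \<open>\<phi> k\<close>, multiplied by the weight \<open>G\<close>, form a sequence whose increments have summable
  \<open>L\<^sup>1\<close> norms. Its almost everywhere limit \<open>u\<close> represents \<open>T\<close>, because the variation of the quadratic functional
  vanishes in the limit. This is the Riesz representation for the scalar product with weight \<open>G\<close>. The bound on
  \<open>u\<close> is then inherited from the bound on \<open>T\<close>.\<close>

theorem test_functional_density:
  fixes T :: "('a::euclidean_space \<Rightarrow> real) \<Rightarrow> real" and G :: "'a \<Rightarrow> real"
  assumes \<Omega>: "open \<Omega>"
    and G: "integrable lebesgue G" and G0: "\<And>x. 0 \<le> G x"
    and T_add: "\<And>\<phi> \<psi>. test_function \<Omega> \<phi> \<Longrightarrow> test_function \<Omega> \<psi> \<Longrightarrow> T (\<lambda>x. \<phi> x + \<psi> x) = T \<phi> + T \<psi>"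
    and T_scale: "\<And>\<phi> c. test_function \<Omega> \<phi> \<Longrightarrow> T (\<lambda>x. c * \<phi> x) = c * T \<phi>"
    and T_le: "\<And>\<phi>. test_function \<Omega> \<phi> \<Longrightarrow> \<bar>T \<phi>\<bar> \<le> (LINT x|lebesgue. G x * \<bar>\<phi> x\<bar>)"
  obtains u where "integrable lebesgue u" "\<And>\<phi>. test_function \<Omega> \<phi> \<Longrightarrow> T \<phi> = (LINT x|lebesgue. u x * \<phi> x)"
    "AE x in lebesgue. x \<in> \<Omega> \<longrightarrow> \<bar>u x\<bar> \<le> G x"
proof -
  have lG: "locally_integrable_on \<Omega> G" by (rule locally_integrable_on_of_integrable[OF G])
  obtain \<phi> :: "nat \<Rightarrow> 'a \<Rightarrow> real" where \<phi>: "\<And>k. test_function \<Omega> (\<phi> k)"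
    and close: "\<And>k. (LINT x|lebesgue. G x * (\<phi> (Suc k) x - \<phi> k x)\<^sup>2) \<le> 4 * (1/4) ^ k"
    and quad: "\<And>k s \<psi>. test_function \<Omega> \<psi> \<Longrightarrow>
       - ((1/4) ^ k) \<le> 2 * s * ((LINT x|lebesgue. G x * (\<phi> k x * \<psi> x)) - T \<psi>) + s\<^sup>2 * (LINT x|lebesgue. G x * (\<psi> x * \<psi> x))"
    using test_functional_almost_minimizers[of G \<Omega> T, OF G G0 T_add T_scale T_le] by blast
  define \<delta> where "\<delta> k x = \<phi> (Suc k) x + (-1) * \<phi> k x" for k x
  have \<delta>: "test_function \<Omega> (\<delta> k)" for k
    unfolding \<delta>_def[abs_def] by (intro test_function_add test_function_cmult \<phi>)
  define D where "D k x = G x * \<delta> k x" for k x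
  have iD: "integrable lebesgue (D k)" for k
    unfolding D_def[abs_def] by (rule integrable_times_test_function(1)[OF lG \<delta>])
  define C where "C = ((LINT x|lebesgue. G x) + 4) / 2"
  have D_le: "(LINT x|lebesgue. \<bar>D k x\<bar>) \<le> C * (1/2) ^ k" for k
  proof -
    define s :: real where "s = (1/2) ^ k"
    have s: "0 < s" by (simp add: s_def)
    have i2: "integrable lebesgue (\<lambda>x. G x * (\<delta> k x * \<delta> k x))" by (rule integrable_times_test_functions[OF lG \<delta> \<delta>])
    have "(LINT x|lebesgue. \<bar>D k x\<bar>) \<le> (LINT x|lebesgue. (s * G x + (G x * (\<delta> k x * \<delta> k x)) / s) / 2)"
    proof (rule integral_mono)
      show "integrable lebesgue (\<lambda>x. \<bar>D k x\<bar>)" by (intro integrable_abs iD)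
      show "integrable lebesgue (\<lambda>x. (s * G x + (G x * (\<delta> k x * \<delta> k x)) / s) / 2)" using i2 G by simp
      fix x
      \<comment> \<open>\<open>|\<delta>| \<le> (s + \<delta>\<^sup>2 / s) / 2\<close>, and both terms have size \<open>(1/2) ^ k\<close> after integration.\<close>
      have "0 \<le> G x * (s - \<bar>\<delta> k x\<bar>)\<^sup>2 / s" using G0 s by simp
      also have "\<dots> = s * G x + (G x * (\<delta> k x * \<delta> k x)) / s - 2 * \<bar>D k x\<bar>"
        using s G0[of x] by (simp add: D_def abs_mult power2_eq_square field_simps)
      finally show "\<bar>D k x\<bar> \<le> (s * G x + (G x * (\<delta> k x * \<delta> k x)) / s) / 2" by simp
    qed
    also have "\<dots> = (s * (LINT x|lebesgue. G x) + (LINT x|lebesgue. G x * (\<delta> k x * \<delta> k x)) / s) / 2"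
      using i2 G by simp
    also have "\<dots> \<le> (s * (LINT x|lebesgue. G x) + (4 * (1/4) ^ k) / s) / 2"
    proof -
      have "(LINT x|lebesgue. G x * (\<delta> k x * \<delta> k x)) \<le> 4 * (1/4) ^ k"
        using close[of k] by (simp add: \<delta>_def power2_eq_square)
      then show ?thesis using s by (intro divide_right_mono add_left_mono) auto
    qed
    also have "(1/4) ^ k = s * s" by (simp add: s_def power_mult_distrib[symmetric])
    also have "(s * (LINT x|lebesgue. G x) + (4 * (s * s)) / s) / 2 = C * s"
      using s by (simp add: C_def field_simps)
    finally show ?thesis by (simp add: s_def)
  qed
  have sumD: "summable (\<lambda>k. LINT x|lebesgue. \<bar>D k x\<bar>)"
  proof (rule summable_comparison_test')
    show "summable (\<lambda>k. C * (1/2) ^ k)" by (intro summable_mult summable_geometric) simp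
    show "norm (LINT x|lebesgue. \<bar>D k x\<bar>) \<le> C * (1/2) ^ k" if "k \<ge> 0" for k using D_le[of k] by simp
  qed
  have aeD: "AE x in lebesgue. summable (\<lambda>k. norm (D k x))"
    using AE_summable_of_summable_integral[OF iD sumD] by simp
  define u where "u x = G x * \<phi> 0 x + (\<Sum>k. D k x)" for x
  have u: "integrable lebesgue u"
    unfolding u_def[abs_def]
    using integrable_suminf[OF iD aeD] sumD integrable_times_test_function(1)[OF lG \<phi>] by auto
  have rep: "T \<psi> = (LINT x|lebesgue. u x * \<psi> x)" if \<psi>: "test_function \<Omega> \<psi>" for \<psi>
  proof -
    obtain B where B: "0 \<le> B" "\<And>x. \<bar>\<psi> x\<bar> \<le> B" using test_function_bounded[OF \<psi>] by blast
    have iD\<psi>: "integrable lebesgue (\<lambda>x. D k x * \<psi> x)" for k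
      by (intro integrable_times_test_function(1)[OF locally_integrable_on_of_integrable \<psi>] iD)
    have ae: "AE x in lebesgue. summable (\<lambda>k. norm (D k x * \<psi> x))"
      using aeD by (rule eventually_mono) (auto simp: abs_mult intro: summable_mult2)
    have sm: "summable (\<lambda>k. LINT x|lebesgue. norm (D k x * \<psi> x))"
    proof (rule summable_comparison_test')
      show "summable (\<lambda>k. B * (LINT x|lebesgue. \<bar>D k x\<bar>))" by (intro summable_mult sumD)
      show "norm (LINT x|lebesgue. norm (D k x * \<psi> x)) \<le> B * (LINT x|lebesgue. \<bar>D k x\<bar>)" if "k \<ge> 0" for k
      proof -
        have "(LINT x|lebesgue. norm (D k x * \<psi> x)) \<le> (LINT x|lebesgue. B * \<bar>D k x\<bar>)"
          using iD\<psi> iD B by (intro integral_mono integrable_norm integrable_mult_right integrable_abs)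
            (auto simp: abs_mult mult.commute intro: mult_right_mono)
        then show ?thesis by simp
      qed
    qed
    have "(\<lambda>k. LINT x|lebesgue. D k x * \<psi> x) sums (LINT x|lebesgue. (\<Sum>k. D k x * \<psi> x))"
      by (rule sums_integral[OF iD\<psi> ae sm])
    then have "(\<lambda>n. (LINT x|lebesgue. G x * (\<phi> 0 x * \<psi> x)) + (\<Sum>k<n. LINT x|lebesgue. D k x * \<psi> x))
       \<longlonglongrightarrow> (LINT x|lebesgue. G x * (\<phi> 0 x * \<psi> x)) + (LINT x|lebesgue. (\<Sum>k. D k x * \<psi> x))"
      unfolding sums_def by (intro tendsto_add tendsto_const)
    moreover have "(LINT x|lebesgue. G x * (\<phi> 0 x * \<psi> x)) + (\<Sum>k<n. LINT x|lebesgue. D k x * \<psi> x) = (LINT x|lebesgue. G x * (\<phi> n x * \<psi> x))" for n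
    proof (induction n)
      case (Suc n)
      have "(LINT x|lebesgue. D n x * \<psi> x) = (LINT x|lebesgue. G x * (\<phi> (Suc n) x * \<psi> x) - G x * (\<phi> n x * \<psi> x))"
        by (intro Bochner_Integration.integral_cong refl) (simp add: D_def \<delta>_def algebra_simps)
      also have "\<dots> = (LINT x|lebesgue. G x * (\<phi> (Suc n) x * \<psi> x)) - (LINT x|lebesgue. G x * (\<phi> n x * \<psi> x))"
        by (intro Bochner_Integration.integral_diff integrable_times_test_functions[OF lG] \<phi> \<psi>)
      finally show ?case using Suc by simp
    qed simp
    moreover have "(LINT x|lebesgue. G x * (\<phi> 0 x * \<psi> x)) + (LINT x|lebesgue. (\<Sum>k. D k x * \<psi> x)) = (LINT x|lebesgue. u x * \<psi> x)"
    proof -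
      have "(LINT x|lebesgue. G x * (\<phi> 0 x * \<psi> x)) + (LINT x|lebesgue. (\<Sum>k. D k x * \<psi> x))
         = (LINT x|lebesgue. G x * (\<phi> 0 x * \<psi> x) + (\<Sum>k. D k x * \<psi> x))"
        using integrable_suminf[OF iD\<psi> ae sm] integrable_times_test_functions[OF lG \<phi> \<psi>] by simp
      also have "\<dots> = (LINT x|lebesgue. u x * \<psi> x)"
      proof (rule integral_cong_AE)
        show "(\<lambda>x. G x * (\<phi> 0 x * \<psi> x) + (\<Sum>k. D k x * \<psi> x)) \<in> borel_measurable lebesgue"
          using integrable_suminf[OF iD\<psi> ae sm] integrable_times_test_functions[OF lG \<phi> \<psi>] 
          by (intro borel_measurable_add) auto
        show "(\<lambda>x. u x * \<psi> x) \<in> borel_measurable lebesgue"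
          using integrable_times_test_function(1)[OF locally_integrable_on_of_integrable[OF u] \<psi>] by auto
        show "AE x in lebesgue. G x * (\<phi> 0 x * \<psi> x) + (\<Sum>k. D k x * \<psi> x) = u x * \<psi> x"
          using aeD
        proof (rule eventually_mono)
          fix x assume "summable (\<lambda>k. norm (D k x))"
          then have "summable (\<lambda>k. D k x)" by (rule summable_norm_cancel)
          from suminf_mult2[OF this, of "\<psi> x"]
          show "G x * (\<phi> 0 x * \<psi> x) + (\<Sum>k. D k x * \<psi> x) = u x * \<psi> x" by (simp add: u_def algebra_simps)
        qed
      qed
      finally show ?thesis .
    qed
    ultimately have lim: "(\<lambda>n. LINT x|lebesgue. G x * (\<phi> n x * \<psi> x)) \<longlonglongrightarrow> (LINT x|lebesgue. u x * \<psi> x)"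
      by simp
    have "(LINT x|lebesgue. u x * \<psi> x) - T \<psi> = 0"
    proof (rule eq_0_of_quadratic_nonneg)
      show "0 \<le> (LINT x|lebesgue. G x * (\<psi> x * \<psi> x))" by (intro Bochner_Integration.integral_nonneg mult_nonneg_nonneg G0 zero_le_square)
      fix s
      have lim1: "(\<lambda>k. 2 * s * ((LINT x|lebesgue. G x * (\<phi> k x * \<psi> x)) - T \<psi>) + s\<^sup>2 * (LINT x|lebesgue. G x * (\<psi> x * \<psi> x)))
        \<longlonglongrightarrow> 2 * s * ((LINT x|lebesgue. u x * \<psi> x) - T \<psi>) + s\<^sup>2 * (LINT x|lebesgue. G x * (\<psi> x * \<psi> x))"
        by (intro tendsto_intros lim)
      have lim2: "(\<lambda>k. - ((1/4) ^ k) :: real) \<longlonglongrightarrow> - 0"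
        by (intro tendsto_minus LIMSEQ_power_zero) simp
      have "- 0 \<le> 2 * s * ((LINT x|lebesgue. u x * \<psi> x) - T \<psi>) + s\<^sup>2 * (LINT x|lebesgue. G x * (\<psi> x * \<psi> x))"
        by (rule LIMSEQ_le[OF lim2 lim1]) (intro exI[of _ 0] allI impI quad[OF \<psi>])
      then show "0 \<le> 2 * s * ((LINT x|lebesgue. u x * \<psi> x) - T \<psi>) + s\<^sup>2 * (LINT x|lebesgue. G x * (\<psi> x * \<psi> x))"
        by simp
    qed
    then show ?thesis by simp
  qed
  have "AE x in lebesgue. x \<in> \<Omega> \<longrightarrow> \<bar>u x\<bar> \<le> G x"
    by (rule AE_abs_le_of_test_bound[OF \<Omega> locally_integrable_on_of_integrable[OF u] locally_integrable_on_of_integrable[OF G]])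
      (use rep T_le in auto)
  then show thesis using that[of u] u rep by blast
qed

section \<open>From the pointwise estimate to the weak gradient\<close>

lemma distr_lebesgue_translation:
  fixes c :: "'a::euclidean_space"
  shows "distr lebesgue lebesgue ((+) c) = lebesgue" and "(+) c \<in> lebesgue \<rightarrow>\<^sub>M lebesgue"
proof -
  have T: "(\<lambda>x. c + (\<Sum>j\<in>Basis. (1 * (x \<bullet> j)) *\<^sub>R j)) = (+) c"
    by (simp add: euclidean_representation fun_eq_iff)
  show m: "(+) c \<in> lebesgue \<rightarrow>\<^sub>M lebesgue"
    using lebesgue_affine_measurable[of "\<lambda>_. 1" c] unfolding T by simp
  have "lebesgue = density (distr lebesgue lebesgue ((+) c)) (\<lambda>_. 1)"
    using lebesgue_affine_euclidean[of "\<lambda>_. 1" c] unfolding T by simp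
  then show "distr lebesgue lebesgue ((+) c) = lebesgue" by (simp add: density_1)
qed

lemma lebesgue_integral_translation:
  fixes F :: "'a::euclidean_space \<Rightarrow> real"
  assumes F: "integrable lebesgue F"
  shows "integrable lebesgue (\<lambda>x. F (c + x))" "(LINT x|lebesgue. F (c + x)) = (LINT x|lebesgue. F x)"
proof -
  have Fm: "F \<in> borel_measurable lebesgue" using F by auto
  have "integrable (distr lebesgue lebesgue ((+) c)) F" using F by (simp only: distr_lebesgue_translation(1))
  then show "integrable lebesgue (\<lambda>x. F (c + x))"
    using Fm by (simp add: integrable_distr_eq distr_lebesgue_translation(2))
  have "(LINT x|lebesgue. F (c + x)) = (\<integral>x. F x \<partial>distr lebesgue lebesgue ((+) c))"
    by (rule integral_distr[OF distr_lebesgue_translation(2) Fm, symmetric])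
  then show "(LINT x|lebesgue. F (c + x)) = (LINT x|lebesgue. F x)" by (simp only: distr_lebesgue_translation(1))
qed

lemma test_function_has_directional_derivative:
  assumes "test_function \<Omega> \<phi>"
  shows "((\<lambda>s. \<phi> (x + s *\<^sub>R i)) has_field_derivative frechet_derivative \<phi> (at (x + s *\<^sub>R i)) i) (at s)"
proof -
  let ?D = "frechet_derivative \<phi> (at (x + s *\<^sub>R i))"
  note D = test_function_has_derivative[OF assms, of "x + s *\<^sub>R i"]
  interpret linear ?D using D by (rule has_derivative_linear)
  have "((\<lambda>s. x + s *\<^sub>R i) has_derivative (\<lambda>h. h *\<^sub>R i)) (at s)"
    by (auto intro!: derivative_eq_intros)
  from has_derivative_compose[OF this D]
  have "((\<lambda>s. \<phi> (x + s *\<^sub>R i)) has_derivative (\<lambda>h. ?D (h *\<^sub>R i))) (at s)" .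
  moreover have "(\<lambda>h. ?D (h *\<^sub>R i)) = (*) (?D i)" by (simp add: fun_eq_iff scale)
  ultimately show ?thesis by (simp only: has_field_derivative_def)
qed

lemma test_function_translate_continuous_on:
  assumes "test_function \<Omega> \<phi>"
  shows "continuous_on S (\<lambda>x. \<phi> (x + c))"
  by (rule continuous_on_compose2[OF test_function_continuous_on[OF assms, of UNIV]]) (auto intro: continuous_intros)

text \<open>The derivative of \<open>\<phi>\<close> is the limit of difference quotients with step \<open>h\<close>. A translation moves the difference
  quotient to \<open>f\<close>, where the hypothesis bounds it by \<open>g x + g (x - h i)\<close>; translating back, both summands
  contribute the integral of \<open>g |\<phi>|\<close> in the limit. The ball condition holds for small \<open>h\<close> because \<open>\<phi>\<close> has
  compact support.\<close>

lemma pointwise_estimate_imp_test_bound: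
  fixes f g :: "'a::euclidean_space \<Rightarrow> real"
  assumes \<Omega>: "open \<Omega>" and f: "integrable lebesgue f" and g: "integrable lebesgue g"
    and S: "S \<in> null_sets lebesgue"
    and est: "\<And>x y. x \<in> \<Omega> - S \<Longrightarrow> y \<in> \<Omega> - S \<Longrightarrow> ball x (3 * norm (x - y)) \<subseteq> \<Omega> \<Longrightarrow>
      \<bar>f x - f y\<bar> \<le> norm (x - y) * (g x + g y)"
    and \<phi>: "test_function \<Omega> \<phi>" and i: "i \<in> Basis"
  shows "\<bar>LINT x|lebesgue. f x * frechet_derivative \<phi> (at x) i\<bar> \<le> (LINT x|lebesgue. 2 * g x * \<bar>\<phi> x\<bar>)"
proof -
  define h :: "nat \<Rightarrow> real" where "h n = inverse (Suc n)" for n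
  have h: "0 < h n" for n by (simp add: h_def)
  have h_lim: "h \<longlonglongrightarrow> 0" unfolding h_def[abs_def] by (rule LIMSEQ_inverse_real_of_nat)
  obtain B where B: "0 \<le> B" "\<And>x. \<bar>\<phi> x\<bar> \<le> B" using test_function_bounded[OF \<phi>] by blast
  obtain B' where B': "0 \<le> B'" "\<And>x. \<bar>frechet_derivative \<phi> (at x) i\<bar> \<le> B'"
    using test_function_derivative_bounded[OF \<phi> i] by blast
  have cont: "continuous_on UNIV \<phi>" "\<And>c. continuous_on UNIV (\<lambda>x. \<phi> (x + c))"
    using test_function_continuous_on[OF \<phi>] test_function_translate_continuous_on[OF \<phi>] by auto
  define q where "q n x = (\<phi> (x + h n *\<^sub>R i) - \<phi> x) / h n" for n x
  have q_cont: "continuous_on UNIV (q n)" for n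
    unfolding q_def[abs_def] using h[of n] by (intro continuous_intros cont) auto
  have q_bound: "\<bar>q n x\<bar> \<le> B'" for n x
  proof -
    have "norm (\<phi> (x + h n *\<^sub>R i) - \<phi> (x + 0 *\<^sub>R i)) \<le> B' * norm (h n - 0)"
    proof (rule field_differentiable_bound[of UNIV])
      show "((\<lambda>s. \<phi> (x + s *\<^sub>R i)) has_field_derivative frechet_derivative \<phi> (at (x + s *\<^sub>R i)) i) (at s within UNIV)" for s
        by (rule has_field_derivative_at_within[OF test_function_has_directional_derivative[OF \<phi>]])
    qed (use B' in auto)
    then show ?thesis using h[of n] by (simp add: q_def pos_divide_le_eq)
  qed
  have q_lim: "(\<lambda>n. q n x) \<longlonglongrightarrow> frechet_derivative \<phi> (at x) i" for x
  proof -
    have "((\<lambda>s. \<phi> (x + s *\<^sub>R i)) has_field_derivative frechet_derivative \<phi> (at x) i) (at 0)"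
      using test_function_has_directional_derivative[OF \<phi>, of x i 0] by simp
    then have "((\<lambda>s. (\<phi> (x + s *\<^sub>R i) - \<phi> x) / s) \<longlongrightarrow> frechet_derivative \<phi> (at x) i) (at 0)"
      by (simp add: DERIV_def)
    moreover have "filterlim h (at 0) sequentially"
      unfolding filterlim_at using h h_lim by (auto simp: less_imp_neq[symmetric] dest: less_imp_neq)
    ultimately show ?thesis unfolding q_def by (rule filterlim_compose)
  qed
  have D_lim: "(\<lambda>n. LINT x|lebesgue. f x * q n x) \<longlonglongrightarrow> (LINT x|lebesgue. f x * frechet_derivative \<phi> (at x) i)"
  proof (rule integral_dominated_convergence)
    show "(\<lambda>x. f x * frechet_derivative \<phi> (at x) i) \<in> borel_measurable lebesgue"
      using integrable_times_test_function(3)[OF locally_integrable_on_of_integrable[OF f] \<phi> i] by auto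
    show "(\<lambda>x. f x * q n x) \<in> borel_measurable lebesgue" for n
      using integrable_times_bounded_continuous[OF f q_cont q_bound] by auto
    show "integrable lebesgue (\<lambda>x. B' * \<bar>f x\<bar>)" by (intro integrable_mult_right integrable_abs f)
    show "AE x in lebesgue. (\<lambda>n. f x * q n x) \<longlonglongrightarrow> f x * frechet_derivative \<phi> (at x) i"
      by (intro AE_I2 tendsto_mult_left q_lim)
    show "AE x in lebesgue. norm (f x * q n x) \<le> B' * \<bar>f x\<bar>" for n
    proof (intro AE_I2)
      fix x
      show "norm (f x * q n x) \<le> B' * \<bar>f x\<bar>"
        using mult_left_mono[OF q_bound[of n x] abs_ge_zero[of "f x"]] by (simp add: abs_mult mult.commute)
    qed
  qed
  have shift: "integrable lebesgue (\<lambda>x. u (x - c) * \<psi> x)"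
    "(LINT x|lebesgue. u x * \<psi> (x + c)) = (LINT x|lebesgue. u (x - c) * \<psi> x)"
    if u: "integrable lebesgue u" and \<psi>: "continuous_on UNIV \<psi>" "\<And>x. \<bar>\<psi> x\<bar> \<le> B" for u \<psi> c
  proof -
    have "integrable lebesgue (\<lambda>x. u (- c + x))" by (rule lebesgue_integral_translation(1)[OF u])
    then have "integrable lebesgue (\<lambda>x. u (x - c))" by simp
    then show 1: "integrable lebesgue (\<lambda>x. u (x - c) * \<psi> x)"
      by (rule integrable_times_bounded_continuous[OF _ \<psi>])
    from lebesgue_integral_translation(2)[OF 1, of c]
    show "(LINT x|lebesgue. u x * \<psi> (x + c)) = (LINT x|lebesgue. u (x - c) * \<psi> x)" by (simp add: add.commute)
  qed
  have abs_cont: "continuous_on UNIV (\<lambda>x. \<bar>\<phi> x\<bar>)" "\<And>x. \<bar>\<bar>\<phi> x\<bar>\<bar> \<le> B" 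
    using cont(1) B by (auto intro: continuous_on_rabs)
  obtain K where K: "compact K" "K \<subseteq> \<Omega>" "\<And>x. x \<notin> K \<Longrightarrow> \<phi> x = 0"
    using test_function_support[OF \<phi>] by metis
  obtain \<epsilon> where \<epsilon>: "0 < \<epsilon>" "(\<Union>x\<in>K. ball x \<epsilon>) \<subseteq> \<Omega>"
    using compact_subset_open_imp_ball_epsilon_subset[OF K(1) \<Omega> K(2)] by blast
  have D_bound: "\<bar>LINT x|lebesgue. f x * q n x\<bar> \<le> (LINT x|lebesgue. g x * \<bar>\<phi> x\<bar>) + (LINT x|lebesgue. g x * \<bar>\<phi> (x + h n *\<^sub>R i)\<bar>)"
    if n: "3 * h n \<le> \<epsilon>" for n
  proof -
    define c where "c = h n *\<^sub>R i"
    have nc: "norm c = h n" using h[of n] i by (simp add: c_def)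
    have i1: "integrable lebesgue (\<lambda>x. f (x - c) * \<phi> x)" by (rule shift(1)[OF f cont(1) B(2)])
    have i2: "integrable lebesgue (\<lambda>x. f x * \<phi> x)" by (rule integrable_times_bounded_continuous[OF f cont(1) B(2)])
    have i3: "integrable lebesgue (\<lambda>x. f x * \<phi> (x + c))"
      by (rule integrable_times_bounded_continuous[OF f cont(2) B(2)])
    have "(LINT x|lebesgue. f x * q n x) = (LINT x|lebesgue. (f x * \<phi> (x + c) - f x * \<phi> x) / h n)"
      by (intro Bochner_Integration.integral_cong refl) (simp add: q_def c_def algebra_simps)
    also have "\<dots> = ((LINT x|lebesgue. f x * \<phi> (x + c)) - (LINT x|lebesgue. f x * \<phi> x)) / h n"
      using i2 i3 by simp
    also have "\<dots> = ((LINT x|lebesgue. f (x - c) * \<phi> x) - (LINT x|lebesgue. f x * \<phi> x)) / h n"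
      by (simp only: shift(2)[OF f cont(1) B(2)])
    also have "\<dots> = (LINT x|lebesgue. (f (x - c) * \<phi> x - f x * \<phi> x) / h n)"
      using i1 i2 by simp
    finally have eq: "(LINT x|lebesgue. f x * q n x) = (LINT x|lebesgue. (f (x - c) * \<phi> x - f x * \<phi> x) / h n)" .
    have g1: "integrable lebesgue (\<lambda>x. g x * \<bar>\<phi> x\<bar>)" by (rule integrable_times_bounded_continuous[OF g abs_cont])
    have g2: "integrable lebesgue (\<lambda>x. g (x - c) * \<bar>\<phi> x\<bar>)" by (rule shift(1)[OF g abs_cont])
    have "\<bar>LINT x|lebesgue. f x * q n x\<bar> \<le> (LINT x|lebesgue. \<bar>(f (x - c) * \<phi> x - f x * \<phi> x) / h n\<bar>)"
      unfolding eq by (rule integral_abs_bound)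
    also have "\<dots> \<le> (LINT x|lebesgue. g x * \<bar>\<phi> x\<bar> + g (x - c) * \<bar>\<phi> x\<bar>)"
    proof (rule integral_mono_AE)
      show "integrable lebesgue (\<lambda>x. \<bar>(f (x - c) * \<phi> x - f x * \<phi> x) / h n\<bar>)" using i1 i2 by simp
      show "integrable lebesgue (\<lambda>x. g x * \<bar>\<phi> x\<bar> + g (x - c) * \<bar>\<phi> x\<bar>)" using g1 g2 by simp
      have "negligible S" using S by (simp add: negligible_iff_null_sets)
      then have "negligible ((+) c ` S)" by (rule negligible_translation)
      then have S': "(+) c ` S \<in> null_sets lebesgue" by (simp add: negligible_iff_null_sets)
      show "AE x in lebesgue. \<bar>(f (x - c) * \<phi> x - f x * \<phi> x) / h n\<bar> \<le> g x * \<bar>\<phi> x\<bar> + g (x - c) * \<bar>\<phi> x\<bar>"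
        using AE_not_in[OF S] AE_not_in[OF S']
      proof eventually_elim
        case (elim x)
        show ?case
        proof (cases "x \<in> K")
          case False
          then show ?thesis using K(3) by simp
        next
          case True
          have "ball x (3 * norm (x - (x - c))) \<subseteq> ball x \<epsilon>" using n by (intro subset_ball) (simp add: nc)
          then have sub: "ball x (3 * norm (x - (x - c))) \<subseteq> \<Omega>" using \<epsilon>(2) True by blast
          have "x - c \<in> ball x (3 * norm (x - (x - c)))" using h[of n] by (simp add: dist_norm nc)
          then have "x - c \<in> \<Omega>" using sub by blast
          moreover have "x - c \<notin> S"
          proof
            assume "x - c \<in> S"
            then have "c + (x - c) \<in> (+) c ` S" by (rule imageI)
            then show False using elim(2) by simp
          qed
          ultimately have "\<bar>f x - f (x - c)\<bar> \<le> h n * (g x + g (x - c))"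
            using est[of x "x - c"] sub elim(1) True K(2) nc by auto
          then have "\<bar>f x - f (x - c)\<bar> / h n \<le> g x + g (x - c)" using h[of n] by (simp add: pos_divide_le_eq mult.commute)
          then have "\<bar>f x - f (x - c)\<bar> / h n * \<bar>\<phi> x\<bar> \<le> (g x + g (x - c)) * \<bar>\<phi> x\<bar>" by (rule mult_right_mono) simp
          moreover have "\<bar>(f (x - c) * \<phi> x - f x * \<phi> x) / h n\<bar> = \<bar>f x - f (x - c)\<bar> / h n * \<bar>\<phi> x\<bar>"
          proof -
            have "\<bar>f (x - c) * \<phi> x - f x * \<phi> x\<bar> = \<bar>f x - f (x - c)\<bar> * \<bar>\<phi> x\<bar>"
              by (simp only: left_diff_distrib[symmetric] abs_mult abs_minus_commute)
            then show ?thesis using h[of n] by simp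
          qed
          ultimately show ?thesis by (simp only: distrib_right)
        qed
      qed
    qed
    also have "\<dots> = (LINT x|lebesgue. g x * \<bar>\<phi> x\<bar>) + (LINT x|lebesgue. g (x - c) * \<bar>\<phi> x\<bar>)" using g1 g2 by simp
    also have "(LINT x|lebesgue. g (x - c) * \<bar>\<phi> x\<bar>) = (LINT x|lebesgue. g x * \<bar>\<phi> (x + c)\<bar>)"
      by (rule shift(2)[OF g abs_cont, symmetric])
    finally show ?thesis by (simp only: c_def)
  qed
  have G_lim: "(\<lambda>n. LINT x|lebesgue. g x * \<bar>\<phi> (x + h n *\<^sub>R i)\<bar>) \<longlonglongrightarrow> (LINT x|lebesgue. g x * \<bar>\<phi> x\<bar>)"
  proof (rule integral_dominated_convergence)
    show "(\<lambda>x. g x * \<bar>\<phi> x\<bar>) \<in> borel_measurable lebesgue"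
      using integrable_times_bounded_continuous[OF g abs_cont] by auto
    show "(\<lambda>x. g x * \<bar>\<phi> (x + h n *\<^sub>R i)\<bar>) \<in> borel_measurable lebesgue" for n
      using B(2) by (intro borel_measurable_integrable integrable_times_bounded_continuous[OF g, of _ B] continuous_on_rabs cont) simp
    show "integrable lebesgue (\<lambda>x. B * \<bar>g x\<bar>)" by (intro integrable_mult_right integrable_abs g)
    show "AE x in lebesgue. (\<lambda>n. g x * \<bar>\<phi> (x + h n *\<^sub>R i)\<bar>) \<longlonglongrightarrow> g x * \<bar>\<phi> x\<bar>"
    proof (intro AE_I2 tendsto_mult_left tendsto_rabs)
      fix x
      have "(\<lambda>n. x + h n *\<^sub>R i) \<longlonglongrightarrow> x + 0 *\<^sub>R i" by (intro tendsto_intros h_lim)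
      then have "(\<lambda>n. x + h n *\<^sub>R i) \<longlonglongrightarrow> x" by simp
      moreover have "isCont \<phi> x" using cont(1) by (simp add: continuous_on_eq_continuous_at)
      ultimately show "(\<lambda>n. \<phi> (x + h n *\<^sub>R i)) \<longlonglongrightarrow> \<phi> x" by (rule isCont_tendsto_compose[rotated])
    qed
    show "AE x in lebesgue. norm (g x * \<bar>\<phi> (x + h n *\<^sub>R i)\<bar>) \<le> B * \<bar>g x\<bar>" for n
    proof (intro AE_I2)
      fix x
      show "norm (g x * \<bar>\<phi> (x + h n *\<^sub>R i)\<bar>) \<le> B * \<bar>g x\<bar>"
        using mult_left_mono[OF B(2)[of "x + h n *\<^sub>R i"] abs_ge_zero[of "g x"]] by (simp add: abs_mult mult.commute)
    qed
  qed
  have "\<forall>\<^sub>F n in sequentially. 3 * h n \<le> \<epsilon>"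
  proof -
    have "\<forall>\<^sub>F n in sequentially. h n < \<epsilon> / 3" using h_lim \<epsilon>(1) by (intro order_tendstoD(2)[OF h_lim]) simp
    then show ?thesis by (rule eventually_mono) simp
  qed
  then have "\<forall>\<^sub>F n in sequentially. \<bar>LINT x|lebesgue. f x * q n x\<bar>
      \<le> (LINT x|lebesgue. g x * \<bar>\<phi> x\<bar>) + (LINT x|lebesgue. g x * \<bar>\<phi> (x + h n *\<^sub>R i)\<bar>)"
    by (rule eventually_mono) (rule D_bound)
  from tendsto_le[OF _ tendsto_add[OF tendsto_const G_lim] tendsto_rabs[OF D_lim] this]
  have "\<bar>LINT x|lebesgue. f x * frechet_derivative \<phi> (at x) i\<bar> \<le> (LINT x|lebesgue. g x * \<bar>\<phi> x\<bar>) + (LINT x|lebesgue. g x * \<bar>\<phi> x\<bar>)"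
    by simp
  also have "\<dots> = (LINT x|lebesgue. 2 * (g x * \<bar>\<phi> x\<bar>))" by simp
  finally show ?thesis by (simp only: mult.assoc)
qed

lemma integrable_lebesgue_on_iff:
  fixes f :: "'a::euclidean_space \<Rightarrow> 'b::{banach, second_countable_topology}"
  assumes "\<Omega> \<in> sets lebesgue"
  shows "integrable (lebesgue_on \<Omega>) f \<longleftrightarrow> integrable lebesgue (\<lambda>x. indicator \<Omega> x *\<^sub>R f x)"
  using assms by (simp add: integrable_restrict_space)

text \<open>Each component of the gradient is the density of a functional as above; the components are bounded by \<open>2 g\<close>.\<close>

theorem pointwise_estimate_imp_weak_gradient:
  fixes f g :: "'a::euclidean_space \<Rightarrow> real"
  assumes \<Omega>: "open \<Omega>" and f: "integrable (lebesgue_on \<Omega>) f" and g: "integrable (lebesgue_on \<Omega>) g"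
    and g0: "\<And>x. x \<in> \<Omega> \<Longrightarrow> 0 \<le> g x" and S: "S \<in> null_sets lebesgue"
    and est: "\<And>x y. x \<in> \<Omega> - S \<Longrightarrow> y \<in> \<Omega> - S \<Longrightarrow> ball x (3 * norm (x - y)) \<subseteq> \<Omega> \<Longrightarrow>
      \<bar>f x - f y\<bar> \<le> norm (x - y) * (g x + g y)"
  obtains v where "integrable lebesgue v" "has_weak_gradient \<Omega> f v"
    "AE x in lebesgue. x \<in> \<Omega> \<longrightarrow> norm (v x) \<le> 2 * DIM('a) * g x"
proof -
  have \<Omega>s: "\<Omega> \<in> sets lebesgue" using \<Omega> by simp
  define F where "F x = indicator \<Omega> x * f x" for x
  define G where "G x = 2 * (indicator \<Omega> x * g x)" for x
  have F: "integrable lebesgue F" using f by (simp add: F_def[abs_def] integrable_lebesgue_on_iff[OF \<Omega>s])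
  have g': "integrable lebesgue (\<lambda>x. indicator \<Omega> x * g x)" using g by (simp add: integrable_lebesgue_on_iff[OF \<Omega>s])
  then have G: "integrable lebesgue G" unfolding G_def[abs_def] by (rule integrable_mult_right)
  have G0: "0 \<le> G x" for x using g0[of x] by (simp add: G_def indicator_def)
  have lF: "locally_integrable_on \<Omega> F" by (rule locally_integrable_on_of_integrable[OF F])
  define T where "T i \<phi> = - (LINT x|lebesgue. F x * frechet_derivative \<phi> (at x) i)" for i \<phi>
  have "\<exists>u. integrable lebesgue u \<and> (\<forall>\<phi>. test_function \<Omega> \<phi> \<longrightarrow> T i \<phi> = (LINT x|lebesgue. u x * \<phi> x)) \<and>
    (AE x in lebesgue. x \<in> \<Omega> \<longrightarrow> \<bar>u x\<bar> \<le> G x)" if i: "i \<in> Basis" for i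
  proof (rule test_functional_density[OF \<Omega> G G0, of "T i"])
    fix \<phi> \<psi> assume \<phi>: "test_function \<Omega> \<phi>" and \<psi>: "test_function \<Omega> \<psi>"
    have eq: "frechet_derivative (\<lambda>x. \<phi> x + \<psi> x) (at x) i = frechet_derivative \<phi> (at x) i + frechet_derivative \<psi> (at x) i" for x
      using fun_cong[OF frechet_derivative_at[OF has_derivative_add[OF test_function_has_derivative[OF \<phi>] test_function_has_derivative[OF \<psi>]]], of x i]
      by simp
    show "T i (\<lambda>x. \<phi> x + \<psi> x) = T i \<phi> + T i \<psi>"
      unfolding T_def eq distrib_left
      using integrable_times_test_function(3)[OF lF \<phi> i] integrable_times_test_function(3)[OF lF \<psi> i] by simp
  next
    fix \<phi> c assume \<phi>: "test_function \<Omega> \<phi>"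
    have eq: "frechet_derivative (\<lambda>x. c * \<phi> x) (at x) i = c * frechet_derivative \<phi> (at x) i" for x
      using fun_cong[OF frechet_derivative_at[OF has_derivative_mult_right[OF test_function_has_derivative[OF \<phi>]]], of c x i]
      by simp
    show "T i (\<lambda>x. c * \<phi> x) = c * T i \<phi>"
      unfolding T_def eq by (simp add: mult.left_commute)
  next
    fix \<phi> assume \<phi>: "test_function \<Omega> \<phi>"
    have "\<bar>LINT x|lebesgue. F x * frechet_derivative \<phi> (at x) i\<bar> \<le> (LINT x|lebesgue. 2 * (indicator \<Omega> x * g x) * \<bar>\<phi> x\<bar>)"
    proof (rule pointwise_estimate_imp_test_bound[OF \<Omega> F g' S _ \<phi> i])
      fix x y assume "x \<in> \<Omega> - S" "y \<in> \<Omega> - S" "ball x (3 * norm (x - y)) \<subseteq> \<Omega>"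
      then show "\<bar>F x - F y\<bar> \<le> norm (x - y) * (indicator \<Omega> x * g x + indicator \<Omega> y * g y)"
        using est[of x y] by (simp add: F_def)
    qed
    then show "\<bar>T i \<phi>\<bar> \<le> (LINT x|lebesgue. G x * \<bar>\<phi> x\<bar>)" by (simp add: T_def G_def)
  next
    fix u assume "integrable lebesgue u" "\<And>\<phi>. test_function \<Omega> \<phi> \<Longrightarrow> T i \<phi> = (LINT x|lebesgue. u x * \<phi> x)"
      "AE x in lebesgue. x \<in> \<Omega> \<longrightarrow> \<bar>u x\<bar> \<le> G x"
    then show ?thesis by blast
  qed
  then have "\<forall>i\<in>Basis. \<exists>u. integrable lebesgue u \<and> (\<forall>\<phi>. test_function \<Omega> \<phi> \<longrightarrow> T i \<phi> = (LINT x|lebesgue. u x * \<phi> x)) \<and>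
    (AE x in lebesgue. x \<in> \<Omega> \<longrightarrow> \<bar>u x\<bar> \<le> G x)" by blast
  from bchoice[OF this] obtain u where u: "\<forall>i\<in>Basis. integrable lebesgue (u i) \<and> (\<forall>\<phi>. test_function \<Omega> \<phi> \<longrightarrow> T i \<phi> = (LINT x|lebesgue. u i x * \<phi> x)) \<and>
    (AE x in lebesgue. x \<in> \<Omega> \<longrightarrow> \<bar>u i x\<bar> \<le> G x)" ..
  define v where "v x = (\<Sum>i\<in>Basis. u i x *\<^sub>R i)" for x
  have vi: "v x \<bullet> i = u i x" if "i \<in> Basis" for x i
    using that by (simp add: v_def inner_sum_left_Basis)
  have iv: "integrable lebesgue v"
    unfolding v_def[abs_def] using u by (intro Bochner_Integration.integrable_sum integrable_scaleR_left) auto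
  have "has_weak_gradient \<Omega> f v"
    unfolding has_weak_gradient_def
  proof (intro conjI allI impI ballI)
    show "locally_integrable_on \<Omega> f"
      unfolding locally_integrable_on_def
    proof (intro allI impI)
      fix K assume K: "compact K \<and> K \<subseteq> \<Omega>"
      then have Ks: "K \<in> sets lebesgue" by (simp add: compact_imp_closed borel_closed)
      have "integrable (lebesgue_on K) F" using lF K unfolding locally_integrable_on_def by blast
      then have "integrable lebesgue (\<lambda>x. indicator K x *\<^sub>R F x)" by (simp only: integrable_lebesgue_on_iff[OF Ks])
      moreover have "indicator K x *\<^sub>R F x = indicator K x *\<^sub>R f x" for x
        using K by (auto simp: F_def indicator_def)
      ultimately show "integrable (lebesgue_on K) f" by (simp only: integrable_lebesgue_on_iff[OF Ks])
    qed
    show "locally_integrable_on \<Omega> v"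
      unfolding locally_integrable_on_def
    proof (intro allI impI)
      fix K assume "compact K \<and> K \<subseteq> \<Omega>"
      then have Ks: "K \<in> sets lebesgue" by (simp add: compact_imp_closed borel_closed)
      show "integrable (lebesgue_on K) v"
        unfolding integrable_lebesgue_on_iff[OF Ks] by (rule integrable_mult_indicator[OF Ks iv])
    qed
    fix \<phi> and i :: 'a assume \<phi>: "test_function \<Omega> \<phi>" and i: "i \<in> Basis"
    have "(LINT x|lebesgue_on \<Omega>. f x * frechet_derivative \<phi> (at x) i) = (LINT x|lebesgue. indicator \<Omega> x *\<^sub>R (f x * frechet_derivative \<phi> (at x) i))"
      using \<Omega>s by (intro integral_restrict_space) simp
    also have "\<dots> = - T i \<phi>" by (simp add: T_def F_def mult.assoc)
    also have "\<dots> = - (LINT x|lebesgue. (v x \<bullet> i) * \<phi> x)" using u i \<phi> by (simp add: vi)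
    also have "(LINT x|lebesgue. (v x \<bullet> i) * \<phi> x) = (LINT x|lebesgue_on \<Omega>. (v x \<bullet> i) * \<phi> x)"
    proof -
      obtain K where K: "K \<subseteq> \<Omega>" "\<And>x. x \<notin> K \<Longrightarrow> \<phi> x = 0"
        using test_function_support[OF \<phi>] by metis
      show ?thesis by (rule integral_lebesgue_on_eq[OF \<Omega>, symmetric]) (use K in auto)
    qed
    finally show "(LINT x|lebesgue_on \<Omega>. f x * frechet_derivative \<phi> (at x) i) = - (LINT x|lebesgue_on \<Omega>. (v x \<bullet> i) * \<phi> x)" .
  qed
  moreover have "AE x in lebesgue. x \<in> \<Omega> \<longrightarrow> norm (v x) \<le> 2 * DIM('a) * g x"
  proof -
    have "AE x in lebesgue. \<forall>i\<in>Basis. x \<in> \<Omega> \<longrightarrow> \<bar>u i x\<bar> \<le> G x"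
      using u by (intro AE_finite_allI) auto
    then show ?thesis
    proof (rule eventually_mono)
      fix x assume le: "\<forall>i\<in>Basis. x \<in> \<Omega> \<longrightarrow> \<bar>u i x\<bar> \<le> G x"
      show "x \<in> \<Omega> \<longrightarrow> norm (v x) \<le> 2 * DIM('a) * g x"
      proof
        assume x: "x \<in> \<Omega>"
        have "norm (v x) \<le> (\<Sum>i\<in>Basis. \<bar>v x \<bullet> i\<bar>)" by (rule norm_le_l1)
        also have "\<dots> \<le> (\<Sum>i\<in>(Basis::'a set). G x)" using le x by (intro sum_mono) (simp add: vi)
        also have "\<dots> = 2 * DIM('a) * g x" using x by (simp add: G_def)
        finally show "norm (v x) \<le> 2 * DIM('a) * g x" .
      qed
    qed
  qed
  ultimately show thesis using that[of v] iv by blast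
qed

section \<open>Grand norms\<close>

lemma SUP_ennreal_finite_iff:
  fixes a :: "'i \<Rightarrow> real"
  shows "(SUP i\<in>I. ennreal (a i)) < \<infinity> \<longleftrightarrow> (\<exists>C. \<forall>i\<in>I. a i \<le> C)"
proof
  assume fin: "(SUP i\<in>I. ennreal (a i)) < \<infinity>"
  then obtain C where C: "(SUP i\<in>I. ennreal (a i)) = ennreal C" "0 \<le> C"
    by (cases "SUP i\<in>I. ennreal (a i)") auto
  have "a i \<le> C" if "i \<in> I" for i
  proof -
    have "ennreal (a i) \<le> ennreal C" unfolding C(1)[symmetric] by (rule SUP_upper[OF that])
    then show ?thesis using C(2) by simp
  qed
  then show "\<exists>C. \<forall>i\<in>I. a i \<le> C" by blast
next
  assume "\<exists>C. \<forall>i\<in>I. a i \<le> C"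
  then obtain C where C: "\<forall>i\<in>I. a i \<le> C" by blast
  have "(SUP i\<in>I. ennreal (a i)) \<le> ennreal C" using C by (intro SUP_least ennreal_leI) auto
  also have "\<dots> < \<infinity>" by simp
  finally show "(SUP i\<in>I. ennreal (a i)) < \<infinity>" .
qed

text \<open>The exponents \<open>1 / r\<close> stay between \<open>1 / q\<close> and 1, so bounds can be transferred both ways.\<close>

lemma bounded_powr_inverse_iff:
  fixes a r :: "'i \<Rightarrow> real"
  assumes a: "\<And>i. i \<in> I \<Longrightarrow> 0 \<le> a i" and r: "\<And>i. i \<in> I \<Longrightarrow> 1 \<le> r i" "\<And>i. i \<in> I \<Longrightarrow> r i \<le> q"
  shows "(\<exists>C. \<forall>i\<in>I. a i powr (1 / r i) \<le> C) \<longleftrightarrow> (\<exists>C. \<forall>i\<in>I. a i \<le> C)"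
proof
  assume "\<exists>C. \<forall>i\<in>I. a i powr (1 / r i) \<le> C"
  then obtain C where C: "\<forall>i\<in>I. a i powr (1 / r i) \<le> C" by blast
  have "a i \<le> max 1 C powr q" if i: "i \<in> I" for i
  proof -
    have "a i = (a i powr (1 / r i)) powr r i"
      using a[OF i] r(1)[OF i] by (simp add: powr_powr)
    also have "\<dots> \<le> max 1 C powr r i"
      using C i r(1)[OF i] by (intro powr_mono2) (auto intro: order_trans)
    also have "\<dots> \<le> max 1 C powr q" using r(2)[OF i] by (intro powr_mono) auto
    finally show ?thesis .
  qed
  then show "\<exists>C. \<forall>i\<in>I. a i \<le> C" by blast
next
  assume "\<exists>C. \<forall>i\<in>I. a i \<le> C"
  then obtain C where C: "\<forall>i\<in>I. a i \<le> C" by blast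
  have "a i powr (1 / r i) \<le> max 1 C" if i: "i \<in> I" for i
  proof -
    have "a i powr (1 / r i) \<le> max 1 C powr (1 / r i)"
      using a[OF i] C i r(1)[OF i] by (intro powr_mono2) (auto intro: order_trans max.coboundedI2)
    also have "\<dots> \<le> max 1 C powr 1" using r(1)[OF i] by (intro powr_mono) auto
    also have "\<dots> = max 1 C" by simp
    finally show ?thesis .
  qed
  then show "\<exists>C. \<forall>i\<in>I. a i powr (1 / r i) \<le> C" by blast
qed

text \<open>Finiteness of the grand norm with the root removed. The values may be vectors, so that the notion applies to
  gradients as well.\<close>

definition grand_bounded :: "'a::euclidean_space set \<Rightarrow> real \<Rightarrow> ('a \<Rightarrow> 'b::real_normed_vector) \<Rightarrow> bool" where
  "grand_bounded \<Omega> q g \<longleftrightarrow> (\<forall>p\<in>{1<..<q}. g \<in> Lp_space \<Omega> p) \<and>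
     (\<exists>C. \<forall>\<epsilon>\<in>{0<..<q - 1}. \<epsilon> * (LINT x|lebesgue_on \<Omega>. norm (g x) powr (q - \<epsilon>)) \<le> C)"

lemma grand_Lebesgue_space_iff:
  "g \<in> grand_Lebesgue_space \<Omega> q \<longleftrightarrow> grand_bounded \<Omega> q g"
proof -
  have "(\<exists>C. \<forall>\<epsilon>\<in>{0<..<q - 1}. (\<epsilon> * (LINT x|lebesgue_on \<Omega>. \<bar>g x\<bar> powr (q - \<epsilon>))) powr (1 / (q - \<epsilon>)) \<le> C) \<longleftrightarrow>
    (\<exists>C. \<forall>\<epsilon>\<in>{0<..<q - 1}. \<epsilon> * (LINT x|lebesgue_on \<Omega>. \<bar>g x\<bar> powr (q - \<epsilon>)) \<le> C)"
    by (rule bounded_powr_inverse_iff[where q = q]) auto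
  then show ?thesis
    unfolding grand_Lebesgue_space_def grand_bounded_def grand_Lebesgue_norm_def SUP_ennreal_finite_iff by auto
qed

lemma borel_measurable_lebesgue_on_iff:
  fixes u :: "'a::euclidean_space \<Rightarrow> 'b::euclidean_space"
  assumes "\<Omega> \<in> sets lebesgue"
  shows "u \<in> borel_measurable (lebesgue_on \<Omega>) \<longleftrightarrow> (\<lambda>x. indicator \<Omega> x *\<^sub>R u x) \<in> borel_measurable lebesgue"
  using assms by (subst borel_measurable_restrict_space_iff) auto

text \<open>On an exhaustion by compact sets the function is the pointwise limit of its truncations.\<close>

lemma locally_integrable_on_imp_measurable:
  fixes u :: "'a::euclidean_space \<Rightarrow> 'b::euclidean_space"
  assumes \<Omega>: "open \<Omega>" and u: "locally_integrable_on \<Omega> u"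
  shows "u \<in> borel_measurable (lebesgue_on \<Omega>)"
proof -
  obtain C :: "nat \<Rightarrow> 'a set" where C: "\<And>n. compact (C n)" "\<And>n. C n \<subseteq> \<Omega>"
    "\<And>n. C n \<subseteq> interior (C (Suc n))" "\<Union>(range C) = \<Omega>"
    by (rule open_Union_compact_subsets[OF \<Omega>]) (rule that; assumption)
  have mono: "C m \<subseteq> C n" if "m \<le> n" for m n
    using that
  proof (induction rule: dec_induct)
    case (step n)
    then show ?case using subset_trans[OF C(3) interior_subset, of n] by simp
  qed simp
  have "(\<lambda>x. indicator \<Omega> x *\<^sub>R u x) \<in> borel_measurable lebesgue"
  proof (rule borel_measurable_LIMSEQ_metric)
    show "(\<lambda>x. indicator (C n) x *\<^sub>R u x) \<in> borel_measurable lebesgue" for n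
    proof -
      have "integrable (lebesgue_on (C n)) u" using u C(1,2)[of n] unfolding locally_integrable_on_def by simp
      moreover have "C n \<in> sets lebesgue" using C(1)[of n] by (simp add: compact_imp_closed borel_closed)
      ultimately show ?thesis by (simp add: integrable_lebesgue_on_iff)
    qed
    show "(\<lambda>n. indicator (C n) x *\<^sub>R u x) \<longlonglongrightarrow> indicator \<Omega> x *\<^sub>R u x" for x
    proof (cases "x \<in> \<Omega>")
      case True
      then obtain m where "x \<in> C m" unfolding C(4)[symmetric] by blast
      then have "\<forall>\<^sub>F n in sequentially. indicator (C n) x *\<^sub>R u x = indicator \<Omega> x *\<^sub>R u x"
        unfolding eventually_sequentially using mono True by (intro exI[of _ m]) (auto simp: subset_iff)
      then show ?thesis by (rule tendsto_eventually)
    next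
      case False
      then have "indicator (C n) x *\<^sub>R u x = indicator \<Omega> x *\<^sub>R u x" for n
        using C(2)[of n] by (auto simp: indicator_def)
      then show ?thesis by (simp only: tendsto_const)
    qed
  qed
  then show ?thesis using \<Omega> by (simp add: borel_measurable_lebesgue_on_iff)
qed

lemma Lp_space_cong_AE:
  fixes u v :: "'a::euclidean_space \<Rightarrow> 'b::euclidean_space"
  assumes u: "u \<in> borel_measurable (lebesgue_on \<Omega>)" and v: "v \<in> borel_measurable (lebesgue_on \<Omega>)"
    and eq: "AE x in lebesgue_on \<Omega>. u x = v x"
  shows "u \<in> Lp_space \<Omega> p \<longleftrightarrow> v \<in> Lp_space \<Omega> p"
    and "(LINT x|lebesgue_on \<Omega>. norm (u x) powr p) = (LINT x|lebesgue_on \<Omega>. norm (v x) powr p)"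
proof -
  note [measurable] = u v
  have ae: "AE x in lebesgue_on \<Omega>. norm (u x) powr p = norm (v x) powr p"
    using eq by (rule eventually_mono) simp
  show "(LINT x|lebesgue_on \<Omega>. norm (u x) powr p) = (LINT x|lebesgue_on \<Omega>. norm (v x) powr p)"
    by (rule integral_cong_AE[OF _ _ ae]) measurable
  have "integrable (lebesgue_on \<Omega>) (\<lambda>x. norm (u x) powr p) \<longleftrightarrow> integrable (lebesgue_on \<Omega>) (\<lambda>x. norm (v x) powr p)"
    by (rule integrable_cong_AE[OF _ _ ae]) measurable
  then show "u \<in> Lp_space \<Omega> p \<longleftrightarrow> v \<in> Lp_space \<Omega> p" using u v by (simp add: Lp_space_def)
qed

lemma weak_gradient_properties:
  fixes \<Omega> :: "'a::euclidean_space set"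
  assumes \<Omega>: "open \<Omega>" and v: "has_weak_gradient \<Omega> f v"
  shows "has_weak_gradient \<Omega> f (weak_gradient \<Omega> f)"
    and "weak_gradient \<Omega> f \<in> Lp_space \<Omega> p \<longleftrightarrow> v \<in> Lp_space \<Omega> p"
    and "(LINT x|lebesgue_on \<Omega>. norm (weak_gradient \<Omega> f x) powr p) = (LINT x|lebesgue_on \<Omega>. norm (v x) powr p)"
proof -
  show w: "has_weak_gradient \<Omega> f (weak_gradient \<Omega> f)"
    unfolding weak_gradient_def by (rule someI[of "has_weak_gradient \<Omega> f", OF v])
  have "AE x in lebesgue. x \<in> \<Omega> \<longrightarrow> weak_gradient \<Omega> f x = v x"
    by (rule weak_gradient_unique[OF \<Omega> w v])
  then have ae: "AE x in lebesgue_on \<Omega>. weak_gradient \<Omega> f x = v x"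
    using \<Omega> by (simp add: AE_restrict_space_iff)
  have m: "u \<in> borel_measurable (lebesgue_on \<Omega>)" if "has_weak_gradient \<Omega> f u" for u
    using that \<Omega> unfolding has_weak_gradient_def by (intro locally_integrable_on_imp_measurable) auto
  show "weak_gradient \<Omega> f \<in> Lp_space \<Omega> p \<longleftrightarrow> v \<in> Lp_space \<Omega> p"
    "(LINT x|lebesgue_on \<Omega>. norm (weak_gradient \<Omega> f x) powr p) = (LINT x|lebesgue_on \<Omega>. norm (v x) powr p)"
    using Lp_space_cong_AE[OF m[OF w] m[OF v] ae] by auto
qed

text \<open>By uniqueness of the weak gradient, the gradients for different exponents and the chosen one in the norm
  agree almost everywhere. So one gradient \<open>v\<close> serves for all exponents, and any choice of it gives the same
  norms.\<close>

lemma grand_sobolev_space_iff: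
  fixes \<Omega> :: "'a::euclidean_space set"
  assumes \<Omega>: "open \<Omega>" and q: "1 < q"
  shows "f \<in> grand_sobolev_space \<Omega> q \<longleftrightarrow>
    grand_bounded \<Omega> q f \<and> (\<exists>v. has_weak_gradient \<Omega> f v \<and> grand_bounded \<Omega> q v)"
proof -
  define D where "D = weak_gradient \<Omega> f"
  have split: "\<epsilon> powr (1 / (q - \<epsilon>)) * sobolev_norm \<Omega> (q - \<epsilon>) f
     = (\<epsilon> * (LINT x|lebesgue_on \<Omega>. norm (f x) powr (q - \<epsilon>))) powr (1 / (q - \<epsilon>))
     + (\<epsilon> * (LINT x|lebesgue_on \<Omega>. norm (D x) powr (q - \<epsilon>))) powr (1 / (q - \<epsilon>))"
    if "\<epsilon> \<in> {0<..<q - 1}" for \<epsilon>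
    using that by (simp add: sobolev_norm_def Lp_norm_def D_def distrib_left powr_mult)
  define a where "a \<epsilon> = \<epsilon> * (LINT x|lebesgue_on \<Omega>. norm (f x) powr (q - \<epsilon>))" for \<epsilon>
  define b where "b \<epsilon> = \<epsilon> * (LINT x|lebesgue_on \<Omega>. norm (D x) powr (q - \<epsilon>))" for \<epsilon>
  have a: "(\<exists>C. \<forall>\<epsilon>\<in>{0<..<q - 1}. a \<epsilon> powr (1 / (q - \<epsilon>)) \<le> C) \<longleftrightarrow> (\<exists>C. \<forall>\<epsilon>\<in>{0<..<q - 1}. a \<epsilon> \<le> C)"
    by (rule bounded_powr_inverse_iff[where q = q]) (auto simp: a_def)
  have b: "(\<exists>C. \<forall>\<epsilon>\<in>{0<..<q - 1}. b \<epsilon> powr (1 / (q - \<epsilon>)) \<le> C) \<longleftrightarrow> (\<exists>C. \<forall>\<epsilon>\<in>{0<..<q - 1}. b \<epsilon> \<le> C)"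
    by (rule bounded_powr_inverse_iff[where q = q]) (auto simp: b_def)
  have sum: "(\<exists>C. \<forall>\<epsilon>\<in>{0<..<q - 1}. a \<epsilon> powr (1 / (q - \<epsilon>)) + b \<epsilon> powr (1 / (q - \<epsilon>)) \<le> C) \<longleftrightarrow>
    (\<exists>C. \<forall>\<epsilon>\<in>{0<..<q - 1}. a \<epsilon> powr (1 / (q - \<epsilon>)) \<le> C) \<and> (\<exists>C. \<forall>\<epsilon>\<in>{0<..<q - 1}. b \<epsilon> powr (1 / (q - \<epsilon>)) \<le> C)"
    (is "?L \<longleftrightarrow> ?R")
  proof
    assume ?L
    then obtain C where C: "\<And>\<epsilon>. \<epsilon> \<in> {0<..<q - 1} \<Longrightarrow> a \<epsilon> powr (1 / (q - \<epsilon>)) + b \<epsilon> powr (1 / (q - \<epsilon>)) \<le> C" by blast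
    have "a \<epsilon> powr (1 / (q - \<epsilon>)) \<le> C" "b \<epsilon> powr (1 / (q - \<epsilon>)) \<le> C" if "\<epsilon> \<in> {0<..<q - 1}" for \<epsilon>
      using C[OF that] powr_ge_zero[of "a \<epsilon>" "1 / (q - \<epsilon>)"] powr_ge_zero[of "b \<epsilon>" "1 / (q - \<epsilon>)"] by argo+
    then show ?R by blast
  next
    assume ?R
    then obtain C C' where "\<And>\<epsilon>. \<epsilon> \<in> {0<..<q - 1} \<Longrightarrow> a \<epsilon> powr (1 / (q - \<epsilon>)) \<le> C"
      "\<And>\<epsilon>. \<epsilon> \<in> {0<..<q - 1} \<Longrightarrow> b \<epsilon> powr (1 / (q - \<epsilon>)) \<le> C'" by blast
    then show ?L by (intro exI[of _ "C + C'"] ballI add_mono) auto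
  qed
  have "grand_sobolev_norm \<Omega> q f < \<infinity> \<longleftrightarrow>
     (\<exists>C. \<forall>\<epsilon>\<in>{0<..<q - 1}. \<epsilon> powr (1 / (q - \<epsilon>)) * sobolev_norm \<Omega> (q - \<epsilon>) f \<le> C)"
    unfolding grand_sobolev_norm_def by (rule SUP_ennreal_finite_iff)
  also have "\<dots> \<longleftrightarrow> (\<exists>C. \<forall>\<epsilon>\<in>{0<..<q - 1}. a \<epsilon> powr (1 / (q - \<epsilon>)) + b \<epsilon> powr (1 / (q - \<epsilon>)) \<le> C)"
    using split by (simp add: a_def b_def)
  also have "\<dots> \<longleftrightarrow> (\<exists>C. \<forall>\<epsilon>\<in>{0<..<q - 1}. a \<epsilon> \<le> C) \<and> (\<exists>C. \<forall>\<epsilon>\<in>{0<..<q - 1}. b \<epsilon> \<le> C)"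
    unfolding sum a b ..
  finally have norm_iff: "grand_sobolev_norm \<Omega> q f < \<infinity> \<longleftrightarrow>
    (\<exists>C. \<forall>\<epsilon>\<in>{0<..<q - 1}. a \<epsilon> \<le> C) \<and> (\<exists>C. \<forall>\<epsilon>\<in>{0<..<q - 1}. b \<epsilon> \<le> C)" .
  have exps: "(\<forall>\<epsilon>\<in>{0<..<q - 1}. P (q - \<epsilon>)) \<longleftrightarrow> (\<forall>p\<in>{1<..<q}. P p)" for P
  proof (intro iffI ballI)
    fix p assume P: "\<forall>\<epsilon>\<in>{0<..<q - 1}. P (q - \<epsilon>)" and p: "p \<in> {1<..<q}"
    have "q - p \<in> {0<..<q - 1}" using p by simp
    with P have "P (q - (q - p))" by (rule bspec)
    then show "P p" by simp
  next
    fix \<epsilon> assume P: "\<forall>p\<in>{1<..<q}. P p" and "\<epsilon> \<in> {0<..<q - 1}"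
    then have "q - \<epsilon> \<in> {1<..<q}" by simp
    with P show "P (q - \<epsilon>)" by (rule bspec)
  qed
  have "(\<forall>p\<in>{1<..<q}. f \<in> sobolev_space \<Omega> p) \<longleftrightarrow>
     (\<forall>p\<in>{1<..<q}. f \<in> Lp_space \<Omega> p) \<and> has_weak_gradient \<Omega> f D \<and> (\<forall>p\<in>{1<..<q}. D \<in> Lp_space \<Omega> p)"
  proof
    assume f: "\<forall>p\<in>{1<..<q}. f \<in> sobolev_space \<Omega> p"
    have "f \<in> Lp_space \<Omega> p \<and> has_weak_gradient \<Omega> f D \<and> D \<in> Lp_space \<Omega> p" if "p \<in> {1<..<q}" for p
    proof -
      have "f \<in> sobolev_space \<Omega> p" using f that by (rule bspec)
      then obtain v where v: "f \<in> Lp_space \<Omega> p" "has_weak_gradient \<Omega> f v" "v \<in> Lp_space \<Omega> p"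
        unfolding sobolev_space_def by auto
      show ?thesis
        unfolding D_def using v weak_gradient_properties(1)[OF \<Omega> v(2)] weak_gradient_properties(2)[OF \<Omega> v(2), of p]
        by simp
    qed
    moreover have "(1 + q) / 2 \<in> {1<..<q}" using q by auto
    ultimately show "(\<forall>p\<in>{1<..<q}. f \<in> Lp_space \<Omega> p) \<and> has_weak_gradient \<Omega> f D \<and> (\<forall>p\<in>{1<..<q}. D \<in> Lp_space \<Omega> p)"
      by blast
  qed (auto simp: sobolev_space_def)
  moreover have "f \<in> (\<Inter>\<epsilon>\<in>{0<..<q - 1}. sobolev_space \<Omega> (q - \<epsilon>)) \<longleftrightarrow> (\<forall>p\<in>{1<..<q}. f \<in> sobolev_space \<Omega> p)"
    using exps[of "\<lambda>p. f \<in> sobolev_space \<Omega> p"] by simp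
  ultimately have iff1: "f \<in> grand_sobolev_space \<Omega> q \<longleftrightarrow> grand_bounded \<Omega> q f \<and> has_weak_gradient \<Omega> f D \<and> grand_bounded \<Omega> q D"
    unfolding grand_sobolev_space_def grand_bounded_def mem_Collect_eq norm_iff a_def b_def by blast
  have "grand_bounded \<Omega> q D" "has_weak_gradient \<Omega> f D" if "has_weak_gradient \<Omega> f v" "grand_bounded \<Omega> q v" for v
    using that(2) weak_gradient_properties[OF \<Omega> that(1)] unfolding grand_bounded_def D_def by auto
  then show ?thesis unfolding iff1 by blast
qed

lemma powr_le_one_plus_powr:
  fixes a p r :: real
  assumes "0 \<le> a" "0 \<le> p" "p \<le> r"
  shows "a powr p \<le> 1 + a powr r"
proof (cases "a \<le> 1")
  case True
  then have "a powr p \<le> 1" using assms by (metis powr_mono2 powr_one_eq_one)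
  then show ?thesis using powr_ge_zero[of a r] by linarith
next
  case False
  then have "a powr p \<le> a powr r" using assms by (intro powr_mono) auto
  then show ?thesis by simp
qed

lemma Lp_space_imp_integrable:
  fixes f :: "'a::euclidean_space \<Rightarrow> 'b::euclidean_space"
  assumes \<Omega>: "\<Omega> \<in> lmeasurable" and f: "f \<in> Lp_space \<Omega> p" and p: "1 \<le> p"
  shows "integrable (lebesgue_on \<Omega>) f"
proof (rule Bochner_Integration.integrable_bound)
  interpret finite_measure "lebesgue_on \<Omega>" by (rule finite_measure_lebesgue_on[OF \<Omega>])
  show "integrable (lebesgue_on \<Omega>) (\<lambda>x. 1 + norm (f x) powr p)"
    using f unfolding Lp_space_def by (intro Bochner_Integration.integrable_add) auto
  show "f \<in> borel_measurable (lebesgue_on \<Omega>)" using f by (simp add: Lp_space_def)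
  show "AE x in lebesgue_on \<Omega>. norm (f x) \<le> norm (1 + norm (f x) powr p)"
  proof (intro AE_I2)
    fix x
    show "norm (f x) \<le> norm (1 + norm (f x) powr p)"
      using powr_le_one_plus_powr[of "norm (f x)" 1 p] p by simp
  qed
qed

text \<open>On a set of finite measure \<open>|g| powr p \<le> 1 + |g| powr p0\<close> controls all exponents \<open>p\<close> below \<open>p0\<close>, while
  the factor \<open>\<epsilon>\<close> is at most \<open>q\<close>.\<close>

lemma grand_bounded_of_near:
  fixes g :: "'a::euclidean_space \<Rightarrow> 'b::euclidean_space"
  assumes \<Omega>: "\<Omega> \<in> lmeasurable" and p0: "1 < p0" "p0 < q"
    and g: "g \<in> borel_measurable (lebesgue_on \<Omega>)" and Lp: "\<And>p. p0 \<le> p \<Longrightarrow> p < q \<Longrightarrow> g \<in> Lp_space \<Omega> p"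
    and bound: "\<And>\<epsilon>. 0 < \<epsilon> \<Longrightarrow> \<epsilon> \<le> q - p0 \<Longrightarrow> \<epsilon> * (LINT x|lebesgue_on \<Omega>. norm (g x) powr (q - \<epsilon>)) \<le> C"
  shows "grand_bounded \<Omega> q g"
proof -
  interpret finite_measure "lebesgue_on \<Omega>" by (rule finite_measure_lebesgue_on[OF \<Omega>])
  note [measurable] = g
  define L where "L = (LINT x|lebesgue_on \<Omega>. 1 + norm (g x) powr p0)"
  have i0: "integrable (lebesgue_on \<Omega>) (\<lambda>x. 1 + norm (g x) powr p0)"
    using Lp[of p0] p0 unfolding Lp_space_def by (intro Bochner_Integration.integrable_add) auto
  have L0: "0 \<le> L" unfolding L_def by (intro Bochner_Integration.integral_nonneg) simp
  have small: "integrable (lebesgue_on \<Omega>) (\<lambda>x. norm (g x) powr p) \<and> (LINT x|lebesgue_on \<Omega>. norm (g x) powr p) \<le> L"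
    if p: "1 < p" "p < p0" for p
  proof
    have le: "norm (g x) powr p \<le> 1 + norm (g x) powr p0" for x
      using p by (intro powr_le_one_plus_powr) auto
    show i: "integrable (lebesgue_on \<Omega>) (\<lambda>x. norm (g x) powr p)"
    proof (rule Bochner_Integration.integrable_bound[OF i0])
      show "AE x in lebesgue_on \<Omega>. norm (norm (g x) powr p) \<le> norm (1 + norm (g x) powr p0)"
        using le by simp
    qed measurable
    show "(LINT x|lebesgue_on \<Omega>. norm (g x) powr p) \<le> L"
      unfolding L_def by (intro integral_mono i i0 le)
  qed
  have "g \<in> Lp_space \<Omega> p" if "p \<in> {1<..<q}" for p
    using that small[of p] Lp[of p] g by (cases "p < p0") (auto simp: Lp_space_def)
  moreover have "\<epsilon> * (LINT x|lebesgue_on \<Omega>. norm (g x) powr (q - \<epsilon>)) \<le> max C (q * L)" if "\<epsilon> \<in> {0<..<q - 1}" for \<epsilon>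
  proof (cases "\<epsilon> \<le> q - p0")
    case True
    then show ?thesis using bound[of \<epsilon>] that by auto
  next
    case False
    have "\<epsilon> * (LINT x|lebesgue_on \<Omega>. norm (g x) powr (q - \<epsilon>)) \<le> q * L"
      using small[of "q - \<epsilon>"] False that L0 p0 by (intro mult_mono) auto
    then show ?thesis by simp
  qed
  ultimately show ?thesis unfolding grand_bounded_def by blast
qed

lemma null_sets_lebesgue_of_AE:
  assumes "AE x in lebesgue. P x"
  shows "{x. \<not> P x} \<in> null_sets lebesgue"
proof -
  obtain N where N: "N \<in> null_sets lebesgue" "{x \<in> space lebesgue. \<not> P x} \<subseteq> N"
    using AE_E[OF assms] by (metis (no_types, lifting) null_setsI)
  have "negligible N" using N(1) by (simp add: negligible_iff_null_sets)
  moreover have "{x. \<not> P x} \<subseteq> N" using N(2) by simp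
  ultimately have "negligible {x. \<not> P x}" by (rule negligible_subset)
  then show ?thesis unfolding negligible_iff_null_sets .
qed

section \<open>The characterization of the grand Sobolev space\<close>

text \<open>The constant of the strong type estimate is decreasing in \<open>p\<close> apart from harmless powers, so it is bounded on
  exponents between \<open>p0 > 1\<close> and \<open>q\<close>; the remaining exponents are controlled by these.\<close>

lemma grand_bounded_hl_max:
  fixes v :: "'a::euclidean_space \<Rightarrow> 'b::euclidean_space"
  assumes \<Omega>: "open \<Omega>" "bounded \<Omega>" and q: "1 < q" and v: "grand_bounded \<Omega> q v" and K: "0 \<le> K"
  defines "M \<equiv> hl_max (\<lambda>w. ennreal (indicator \<Omega> w * norm (v w)))"
  shows "grand_bounded \<Omega> q (\<lambda>x. K * enn2real (M x))"
proof -
  have \<Omega>s: "\<Omega> \<in> sets lebesgue" using \<Omega> by simp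
  have \<Omega>l: "\<Omega> \<in> lmeasurable" using \<Omega> by (simp add: lmeasurable_open)
  define p0 where "p0 = (1 + q) / 2"
  have p0: "1 < p0" "p0 < q" using q by (auto simp: p0_def)
  define h where "h w = indicator \<Omega> w * norm (v w)" for w
  have vm: "v \<in> borel_measurable (lebesgue_on \<Omega>)"
    using v p0 unfolding grand_bounded_def Lp_space_def by auto
  have hm[measurable]: "h \<in> borel_measurable lebesgue"
  proof -
    have "(\<lambda>w. norm (v w)) \<in> borel_measurable (lebesgue_on \<Omega>)" using vm by measurable
    then show ?thesis using \<Omega>s by (simp add: borel_measurable_lebesgue_on_iff h_def[abs_def])
  qed
  have h0: "0 \<le> h w" for w by (simp add: h_def)
  have M: "M = hl_max (\<lambda>w. ennreal (h w))" by (simp add: M_def h_def)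
  have Mm[measurable]: "M \<in> borel_measurable lebesgue"
    unfolding M by (rule borel_measurable_hl_max) measurable
  define g where "g x = K * enn2real (M x)" for x
  have gm: "g \<in> borel_measurable lebesgue" unfolding g_def by measurable
  have gm': "g \<in> borel_measurable (lebesgue_on \<Omega>)" using gm by (rule measurable_restrict_space1)
  have g0: "0 \<le> g x" for x using K by (simp add: g_def)
  obtain C where C: "\<And>\<epsilon>. \<epsilon> \<in> {0<..<q - 1} \<Longrightarrow> \<epsilon> * (LINT x|lebesgue_on \<Omega>. norm (v x) powr (q - \<epsilon>)) \<le> C"
    using v unfolding grand_bounded_def by blast
  define \<omega> where "\<omega> = unit_ball_vol (DIM('a))"
  have \<omega>: "0 < \<omega>" by (simp add: \<omega>_def)
  define a0 :: real where "a0 = 2 powr (p0 - 1)"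
  have a0: "1 < a0" using p0 by (simp add: a0_def)
  \<comment> \<open>An upper bound for the constant of the strong type estimate at all exponents between \<open>p0\<close> and \<open>q\<close>.\<close>
  define c where "c = 2 powr q * 5 ^ DIM('a) * max 1 (2 * \<omega>) powr q * (a0 / (a0 - 1))"
  have c: "0 \<le> c" using a0 by (simp add: c_def)
  have main: "integrable (lebesgue_on \<Omega>) (\<lambda>x. norm (g x) powr p) \<and>
      (LINT x|lebesgue_on \<Omega>. norm (g x) powr p)
        \<le> max 1 K powr q * (measure lebesgue \<Omega> + c * (LINT x|lebesgue_on \<Omega>. norm (v x) powr p))"
    if p: "p0 \<le> p" "p < q" for p
  proof -
    have p1: "1 < p" using p p0 by simp
    define V where "V = (LINT x|lebesgue_on \<Omega>. norm (v x) powr p)"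
    have V0: "0 \<le> V" unfolding V_def by (intro Bochner_Integration.integral_nonneg) simp
    have iv: "integrable (lebesgue_on \<Omega>) (\<lambda>x. norm (v x) powr p)"
      using v p1 p unfolding grand_bounded_def Lp_space_def by auto
    have hV: "(\<integral>\<^sup>+x. ennreal (h x powr p) \<partial>lebesgue) = ennreal V"
    proof -
      have "(\<integral>\<^sup>+x. ennreal (h x powr p) \<partial>lebesgue) = (\<integral>\<^sup>+x. ennreal (norm (v x) powr p) * indicator \<Omega> x \<partial>lebesgue)"
        by (intro nn_integral_cong) (auto simp: h_def indicator_def)
      also have "\<dots> = (\<integral>\<^sup>+x. ennreal (norm (v x) powr p) \<partial>lebesgue_on \<Omega>)"
        using \<Omega>s by (intro nn_integral_restrict_space[symmetric]) simp
      also have "\<dots> = ennreal V"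
        unfolding V_def by (intro nn_integral_eq_integral iv) simp
      finally show ?thesis .
    qed
    define a :: real where "a = 2 powr (p - 1)"
    have a: "a0 \<le> a" using p by (simp add: a_def a0_def)
    have aa: "a / (a - 1) \<le> a0 / (a0 - 1)" using a a0 by (simp add: divide_simps) (simp add: algebra_simps)
    have cle: "2 powr p * 5 ^ DIM('a) * (2 * \<omega>) powr p * (a / (a - 1)) \<le> c"
      unfolding c_def
    proof (intro mult_mono aa)
      show "2 powr p \<le> 2 powr q" using p by simp
      have "(2 * \<omega>) powr p \<le> max 1 (2 * \<omega>) powr p" using p1 \<omega> by (intro powr_mono2) auto
      also have "\<dots> \<le> max 1 (2 * \<omega>) powr q" using p by (intro powr_mono) auto
      finally show "(2 * \<omega>) powr p \<le> max 1 (2 * \<omega>) powr q" .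
    qed (use a a0 in auto)
    have Kle: "K powr p \<le> max 1 K powr q"
    proof -
      have "K powr p \<le> max 1 K powr p" using p1 K by (intro powr_mono2) auto
      also have "\<dots> \<le> max 1 K powr q" using p by (intro powr_mono) auto
      finally show ?thesis .
    qed
    have "(\<integral>\<^sup>+x. ennreal (norm (g x) powr p) \<partial>lebesgue_on \<Omega>) = (\<integral>\<^sup>+x. ennreal (norm (g x) powr p) * indicator \<Omega> x \<partial>lebesgue)"
      using \<Omega>s by (intro nn_integral_restrict_space) simp
    also have "\<dots> = (\<integral>\<^sup>+x. ennreal (K powr p) * (ennreal (enn2real (M x) powr p) * indicator \<Omega> x) \<partial>lebesgue)"
      using K by (intro nn_integral_cong) (auto simp: g_def powr_mult abs_mult ennreal_mult' indicator_def)
    also have "\<dots> = ennreal (K powr p) * (\<integral>\<^sup>+x\<in>\<Omega>. ennreal (enn2real (M x) powr p) \<partial>lebesgue)"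
    proof (intro nn_integral_cmult)
      note [measurable] = \<Omega>s
      show "(\<lambda>x. ennreal (enn2real (M x) powr p) * indicator \<Omega> x) \<in> borel_measurable lebesgue" by measurable
    qed
    also have "(\<integral>\<^sup>+x\<in>\<Omega>. ennreal (enn2real (M x) powr p) \<partial>lebesgue) \<le> emeasure lebesgue \<Omega> +
      ennreal (2 powr p * 5 ^ DIM('a) * (2 * \<omega>) powr p * (a / (a - 1))) * (\<integral>\<^sup>+x. ennreal (h x powr p) \<partial>lebesgue)"
      unfolding M \<omega>_def a_def by (rule hl_max_strong_type[OF hm h0 p1 \<Omega>s])
    also have "\<dots> \<le> ennreal (measure lebesgue \<Omega>) + ennreal c * ennreal V"
      unfolding hV using \<Omega>l cle by (intro add_mono mult_right_mono ennreal_leI) (auto simp: emeasure_eq_measure2)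
    also have "\<dots> = ennreal (measure lebesgue \<Omega> + c * V)"
      using c V0 by (simp add: ennreal_mult)
    also have "ennreal (K powr p) * ennreal (measure lebesgue \<Omega> + c * V) \<le> ennreal (max 1 K powr q * (measure lebesgue \<Omega> + c * V))"
      using Kle c V0 by (subst ennreal_mult'[symmetric]) (auto intro!: ennreal_leI mult_right_mono)
    finally have nn: "(\<integral>\<^sup>+x. ennreal (norm (g x) powr p) \<partial>lebesgue_on \<Omega>) \<le> ennreal (max 1 K powr q * (measure lebesgue \<Omega> + c * V))"
      by (simp add: mult_left_mono)
    have int: "integrable (lebesgue_on \<Omega>) (\<lambda>x. norm (g x) powr p)"
    proof (rule integrableI_bounded)
      show "(\<lambda>x. norm (g x) powr p) \<in> borel_measurable (lebesgue_on \<Omega>)" using gm' by measurable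
      show "(\<integral>\<^sup>+x. ennreal (norm (norm (g x) powr p)) \<partial>lebesgue_on \<Omega>) < \<infinity>"
        using le_less_trans[OF nn] by simp
    qed
    have "ennreal (LINT x|lebesgue_on \<Omega>. norm (g x) powr p) = (\<integral>\<^sup>+x. ennreal (norm (g x) powr p) \<partial>lebesgue_on \<Omega>)"
      by (rule nn_integral_eq_integral[OF int, symmetric]) simp
    then have "ennreal (LINT x|lebesgue_on \<Omega>. norm (g x) powr p) \<le> ennreal (max 1 K powr q * (measure lebesgue \<Omega> + c * V))"
      using nn by simp
    then show ?thesis using int c V0 by (auto simp: V_def)
  qed
  have "grand_bounded \<Omega> q g"
  proof (rule grand_bounded_of_near[OF \<Omega>l p0 gm'])
    show "g \<in> Lp_space \<Omega> p" if "p0 \<le> p" "p < q" for p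
      using main[OF that] gm' by (simp add: Lp_space_def)
    fix \<epsilon> assume \<epsilon>: "0 < \<epsilon>" "\<epsilon> \<le> q - p0"
    define V where "V = (LINT x|lebesgue_on \<Omega>. norm (v x) powr (q - \<epsilon>))"
    have "\<epsilon> * (LINT x|lebesgue_on \<Omega>. norm (g x) powr (q - \<epsilon>)) \<le> \<epsilon> * (max 1 K powr q * (measure lebesgue \<Omega> + c * V))"
      using main[of "q - \<epsilon>"] \<epsilon> unfolding V_def by (intro mult_left_mono) auto
    also have "\<dots> = max 1 K powr q * (\<epsilon> * measure lebesgue \<Omega> + c * (\<epsilon> * V))" by (simp add: algebra_simps)
    also have "\<dots> \<le> max 1 K powr q * (q * measure lebesgue \<Omega> + c * C)"
      using C[of \<epsilon>] \<epsilon> p0 c unfolding V_def by (intro mult_left_mono add_mono mult_right_mono) auto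
    finally show "\<epsilon> * (LINT x|lebesgue_on \<Omega>. norm (g x) powr (q - \<epsilon>)) \<le> max 1 K powr q * (q * measure lebesgue \<Omega> + c * C)" .
  qed
  then show ?thesis by (simp add: g_def[abs_def])
qed

text \<open>The exceptional set consists of the points that are not Lebesgue points of \<open>f\<close> and those where the maximal
  function is infinite. At the latter \<open>enn2real\<close> makes \<open>g\<close> vanish.\<close>

theorem grand_sobolev_imp_pointwise:
  fixes \<Omega> :: "'a::euclidean_space set" and f :: "'a \<Rightarrow> real"
  assumes \<Omega>: "open \<Omega>" "bounded \<Omega>" and q: "1 < q"
    and fv: "has_weak_gradient \<Omega> f v" and v: "grand_bounded \<Omega> q v"
  shows "\<exists>g\<in>grand_Lebesgue_space \<Omega> q. (\<forall>x\<in>\<Omega>. 0 \<le> g x) \<and>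
      (\<exists>S. S \<subseteq> \<Omega> \<and> S \<in> null_sets lebesgue \<and>
        (\<forall>x\<in>\<Omega> - S. \<forall>y\<in>\<Omega> - S. ball x (3 * norm (x - y)) \<subseteq> \<Omega> \<longrightarrow>
           \<bar>f x - f y\<bar> \<le> norm (x - y) * (g x + g y)))"
proof -
  have \<Omega>s: "\<Omega> \<in> sets lebesgue" using \<Omega> by simp
  have \<Omega>l: "\<Omega> \<in> lmeasurable" using \<Omega> by (simp add: lmeasurable_open)
  define K where "K = 3 ^ Suc DIM('a) * mollifier_bound TYPE('a)"
  have K: "0 \<le> K" using order_trans[OF abs_ge_zero abs_mollifier_le[of "0::'a"]] by (simp add: K_def)
  define h where "h w = indicator \<Omega> w * norm (v w)" for w
  define M where "M = hl_max (\<lambda>w. ennreal (h w))"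
  define g where "g x = K * enn2real (M x)" for x
  have "(1 + q) / 2 \<in> {1<..<q}" "1 \<le> (1 + q) / 2" using q by auto
  then have "integrable (lebesgue_on \<Omega>) v"
    using v Lp_space_imp_integrable[OF \<Omega>l, of v "(1 + q) / 2"] unfolding grand_bounded_def by blast
  then have "integrable (lebesgue_on \<Omega>) (\<lambda>x. norm (v x))" by (rule integrable_norm)
  then have ih: "integrable lebesgue h"
    by (simp add: integrable_lebesgue_on_iff[OF \<Omega>s] h_def[abs_def])
  then have hm[measurable]: "h \<in> borel_measurable lebesgue" by (rule borel_measurable_integrable)
  have "(\<integral>\<^sup>+x. ennreal (h x) \<partial>lebesgue) = ennreal (LINT x|lebesgue. h x)"
    by (rule nn_integral_eq_integral[OF ih]) (simp add: h_def)
  then have Mfin: "AE x in lebesgue. M x < \<infinity>"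
    unfolding M_def by (intro AE_hl_max_finite) auto
  have lf: "locally_integrable_on \<Omega> f" using fv unfolding has_weak_gradient_def by simp
  define S where "S = {x. \<not> ((x \<in> \<Omega> \<longrightarrow> lebesgue_point f x) \<and> M x < \<infinity>)} \<inter> \<Omega>"
  have "{x. \<not> ((x \<in> \<Omega> \<longrightarrow> lebesgue_point f x) \<and> M x < \<infinity>)} \<in> null_sets lebesgue"
    by (rule null_sets_lebesgue_of_AE) (use AE_lebesgue_point[OF \<Omega>(1) lf] Mfin in eventually_elim, auto)
  then have S: "S \<in> null_sets lebesgue" unfolding S_def by (rule null_set_Int2[OF _ \<Omega>s])
  have "g \<in> grand_Lebesgue_space \<Omega> q"
    using grand_bounded_hl_max[OF \<Omega> q v K] unfolding grand_Lebesgue_space_iff g_def[abs_def] M_def h_def[abs_def] .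
  moreover have "\<bar>f x - f y\<bar> \<le> norm (x - y) * (g x + g y)"
    if x: "x \<in> \<Omega> - S" and y: "y \<in> \<Omega> - S" and sub: "ball x (3 * norm (x - y)) \<subseteq> \<Omega>" for x y
  proof -
    have "lebesgue_point f x" "lebesgue_point f y" using x y by (auto simp: S_def)
    moreover have "M x = ennreal (enn2real (M x))" "M y = ennreal (enn2real (M y))"
      using x y by (auto simp: S_def less_top)
    ultimately have "\<bar>f x - f y\<bar> \<le> K * norm (x - y) * (enn2real (M x) + enn2real (M y))"
      unfolding K_def
      by (intro weak_gradient_pointwise_estimate[OF \<Omega>(1) fv _ _ _ _ enn2real_nonneg _ enn2real_nonneg sub])
        (use hm in \<open>auto simp: M_def h_def[abs_def]\<close>)
    also have "\<dots> = norm (x - y) * (g x + g y)" by (simp add: g_def algebra_simps)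
    finally show ?thesis .
  qed
  moreover have "0 \<le> g x" for x using K by (simp add: g_def)
  moreover have "S \<subseteq> \<Omega>" by (simp add: S_def)
  ultimately show ?thesis using S by blast
qed

text \<open>The gradient is bounded by a multiple of \<open>g\<close> with the same factor for all exponents.\<close>

theorem pointwise_imp_grand_sobolev:
  fixes \<Omega> :: "'a::euclidean_space set" and f g :: "'a \<Rightarrow> real"
  assumes \<Omega>: "open \<Omega>" "bounded \<Omega>" and q: "1 < q"
    and f: "grand_bounded \<Omega> q f" and g: "grand_bounded \<Omega> q g" and g0: "\<And>x. x \<in> \<Omega> \<Longrightarrow> 0 \<le> g x"
    and S: "S \<in> null_sets lebesgue"
    and est: "\<And>x y. x \<in> \<Omega> - S \<Longrightarrow> y \<in> \<Omega> - S \<Longrightarrow> ball x (3 * norm (x - y)) \<subseteq> \<Omega> \<Longrightarrow>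
      \<bar>f x - f y\<bar> \<le> norm (x - y) * (g x + g y)"
  obtains v where "has_weak_gradient \<Omega> f v" "grand_bounded \<Omega> q v"
proof -
  have \<Omega>s: "\<Omega> \<in> sets lebesgue" using \<Omega> by simp
  have \<Omega>l: "\<Omega> \<in> lmeasurable" using \<Omega> by (simp add: lmeasurable_open)
  have int: "integrable (lebesgue_on \<Omega>) u" if "grand_bounded \<Omega> q u" for u :: "'a \<Rightarrow> real"
  proof (rule Lp_space_imp_integrable[OF \<Omega>l])
    show "u \<in> Lp_space \<Omega> ((1 + q) / 2)" using that q unfolding grand_bounded_def by auto
  qed (use q in auto)
  obtain v where v: "integrable lebesgue v" "has_weak_gradient \<Omega> f v"
    "AE x in lebesgue. x \<in> \<Omega> \<longrightarrow> norm (v x) \<le> 2 * DIM('a) * g x"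
    using pointwise_estimate_imp_weak_gradient[OF \<Omega>(1) int[OF f] int[OF g] g0 S est] by blast
  define N where "N = 2 * real DIM('a)"
  have N: "1 \<le> N"
  proof -
    have "1 \<le> DIM('a)" using DIM_positive[where 'a='a] by linarith
    then have "1 \<le> real DIM('a)" by simp
    then show ?thesis unfolding N_def by linarith
  qed
  have ae: "AE x in lebesgue_on \<Omega>. norm (v x) \<le> N * \<bar>g x\<bar>"
    using v(3) g0 \<Omega>s by (subst AE_restrict_space_iff) (auto simp: N_def elim: eventually_mono)
  have vm[measurable]: "v \<in> borel_measurable (lebesgue_on \<Omega>)"
    using v(1) by (intro measurable_restrict_space1 borel_measurable_integrable)
  have bound: "integrable (lebesgue_on \<Omega>) (\<lambda>x. norm (v x) powr p) \<and>
      (LINT x|lebesgue_on \<Omega>. norm (v x) powr p) \<le> N powr q * (LINT x|lebesgue_on \<Omega>. norm (g x) powr p)"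
    if p: "p \<in> {1<..<q}" for p
  proof
    have ig: "integrable (lebesgue_on \<Omega>) (\<lambda>x. N powr q * norm (g x) powr p)"
      using g p unfolding grand_bounded_def Lp_space_def by (intro integrable_mult_right) auto
    have ae': "AE x in lebesgue_on \<Omega>. norm (v x) powr p \<le> N powr q * norm (g x) powr p"
      using ae
    proof (rule eventually_mono)
      fix x assume "norm (v x) \<le> N * \<bar>g x\<bar>"
      then have "norm (v x) powr p \<le> (N * \<bar>g x\<bar>) powr p" using p by (intro powr_mono2) auto
      also have "\<dots> = N powr p * norm (g x) powr p" using N by (simp add: powr_mult)
      also have "\<dots> \<le> N powr q * norm (g x) powr p" using p N by (intro mult_right_mono powr_mono) auto
      finally show "norm (v x) powr p \<le> N powr q * norm (g x) powr p" .
    qed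
    show iv: "integrable (lebesgue_on \<Omega>) (\<lambda>x. norm (v x) powr p)"
    proof (rule Bochner_Integration.integrable_bound[OF ig])
      show "AE x in lebesgue_on \<Omega>. norm (norm (v x) powr p) \<le> norm (N powr q * norm (g x) powr p)"
        using ae' by (rule eventually_mono) (simp add: abs_mult)
    qed measurable
    have "(LINT x|lebesgue_on \<Omega>. norm (v x) powr p) \<le> (LINT x|lebesgue_on \<Omega>. N powr q * norm (g x) powr p)"
      by (rule integral_mono_AE[OF iv ig ae'])
    then show "(LINT x|lebesgue_on \<Omega>. norm (v x) powr p) \<le> N powr q * (LINT x|lebesgue_on \<Omega>. norm (g x) powr p)" by simp
  qed
  obtain C where C: "\<And>\<epsilon>. \<epsilon> \<in> {0<..<q - 1} \<Longrightarrow> \<epsilon> * (LINT x|lebesgue_on \<Omega>. norm (g x) powr (q - \<epsilon>)) \<le> C"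
    using g unfolding grand_bounded_def by blast
  have "\<epsilon> * (LINT x|lebesgue_on \<Omega>. norm (v x) powr (q - \<epsilon>)) \<le> N powr q * C" if \<epsilon>: "\<epsilon> \<in> {0<..<q - 1}" for \<epsilon>
  proof -
    have "\<epsilon> * (LINT x|lebesgue_on \<Omega>. norm (v x) powr (q - \<epsilon>)) \<le> \<epsilon> * (N powr q * (LINT x|lebesgue_on \<Omega>. norm (g x) powr (q - \<epsilon>)))"
      using bound[of "q - \<epsilon>"] \<epsilon> by (intro mult_left_mono) auto
    also have "\<dots> = N powr q * (\<epsilon> * (LINT x|lebesgue_on \<Omega>. norm (g x) powr (q - \<epsilon>)))" by simp
    also have "\<dots> \<le> N powr q * C" by (intro mult_left_mono C \<epsilon>) simp
    finally show ?thesis .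
  qed
  then have "grand_bounded \<Omega> q v" using bound vm unfolding grand_bounded_def Lp_space_def by blast
  with v(2) show thesis by (rule that)
qed

theorem corollary4p22:
  fixes \<Omega> :: "(real ^ 'n) set" and f :: "real ^ 'n \<Rightarrow> real" and q :: real
  assumes "2 \<le> CARD('n)"
    and "1 < q"
    and "domain \<Omega>"
    and "bounded \<Omega>"
  shows "f \<in> grand_sobolev_space \<Omega> q \<longleftrightarrow>
    f \<in> grand_Lebesgue_space \<Omega> q \<and>
    (\<exists>g\<in>grand_Lebesgue_space \<Omega> q. (\<forall>x\<in>\<Omega>. 0 \<le> g x) \<and>
      (\<exists>S. S \<subseteq> \<Omega> \<and> S \<in> null_sets lebesgue \<and>
        (\<forall>x\<in>\<Omega> - S. \<forall>y\<in>\<Omega> - S. ball x (3 * norm (x - y)) \<subseteq> \<Omega> \<longrightarrow>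
           \<bar>f x - f y\<bar> \<le> norm (x - y) * (g x + g y))))"
proof -
  have \<Omega>: "open \<Omega>" using assms(3) by (simp add: domain_def)
  note iff = grand_sobolev_space_iff[OF \<Omega> assms(2), of f]
  show ?thesis
  proof (rule iffI, goal_cases)
    case 1
    then obtain v where f: "grand_bounded \<Omega> q f" and v: "has_weak_gradient \<Omega> f v" "grand_bounded \<Omega> q v"
      unfolding iff by blast
    from f grand_sobolev_imp_pointwise[OF \<Omega> assms(4,2) v] show ?case
      unfolding grand_Lebesgue_space_iff by (rule conjI)
  next
    case 2
    then obtain g S where f: "grand_bounded \<Omega> q f" and g: "grand_bounded \<Omega> q g" and g0: "\<forall>x\<in>\<Omega>. 0 \<le> g x"
      and S: "S \<in> null_sets lebesgue"
      and est: "\<forall>x\<in>\<Omega> - S. \<forall>y\<in>\<Omega> - S. ball x (3 * norm (x - y)) \<subseteq> \<Omega> \<longrightarrow>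
           \<bar>f x - f y\<bar> \<le> norm (x - y) * (g x + g y)"
      unfolding grand_Lebesgue_space_iff by (elim conjE bexE exE) (simp only: grand_Lebesgue_space_iff)
    obtain v where "has_weak_gradient \<Omega> f v" "grand_bounded \<Omega> q v"
      by (rule pointwise_imp_grand_sobolev[OF \<Omega> assms(4,2) f g bspec[OF g0] S est[rule_format]])
    with f show ?case unfolding iff by blast
  qed
qed

end
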